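(* Let $\circ\in\{\land,\lor\}$, let $n \in \mathbb N$ and let $S$ be the leftist circuit over $\{\circ\}$ on inputs $x_0, \dotsc, x_{n-1}$. Let $K \subseteq \{x_0,\dots,x_{n-1}\}$ be triangular with $k := |K|$. Furthermore, let a set $L$ of further inputs (not necessarily inputs of $S$) with $l := |L|$ and $K \cap L = \emptyset$ be given. Consider arrival times $a(y) = 0$ for each $y \in K$ and $a(y) \in \mathbb N$ for each $y \in L$, where $L$ is given sorted by increasing arrival time. Then a delay-optimum symmetric $\circ$-tree on $K \cup L$ with respect to the arrival times $a$ can be constructed, possibly reusing gates of $S$, in time $\mathcal O(\log_2 k + l)$, assuming the precomputed data described below is available. The number of gates used that are not gates of $S$ is at most $k + l - 1$ if $k \leq 2$ and at most $2 \log_2 k + l - 2$ if $k \geq 3$.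
   Context: Circuits: a circuit over $\{\circ\}$ on inputs $x_0,\dots,x_{n-1}$ is a finite directed acyclic graph whose sources are the input vertices and whose other vertices are gates, each with exactly two predecessors, computing $\circ$ of their values. For a vertex $v$, $\mathrm{In}_v(S)$ is the set of input vertices from which there is a directed path to $v$ (for an input $v$, $\mathrm{In}_v(S)=\{v\}$). The depth of a vertex is the maximum number of edges on a directed path from an input to it. Leftist circuit: the circuit $S$ on $x_0,\dots,x_{n-1}$ constructed as follows. Set $i=0$, $N=n$; while $N \ge 2$: let $k$ be maximal with $2^k\le N$, add a perfect binary tree of $\circ$-gates of depth $k$ whose leaves, read from left to right, are $x_i,\dots,x_{i+2^k-1}$ (so each vertex of the tree has as $\mathrm{In}_v$ a set of inputs with an interval $I_v$ of indices), then set $i\leftarrow i+2^k$, $N\leftarrow N-2^k$. A vertex $v$ is left of $w$ if $I_v\cap I_w=\emptyset$ and $\max I_v<\min I_w$; the two predecessors of a gate are thus its left and right predecessor. Boundary vertices: for $K\subseteq\{x_0,\dots,x_{n-1}\}$, $B(K,S)=\{v : \mathrm{In}_v(S)\subseteq K \text{ and } \mathrm{In}_w(S)\not\subseteq K \text{ for every successor } w \text{ of } v\}$. The boundary tree sequence $T_0,\dots,T_{|B|-1}$ of $K$ consists of the subcircuits formed by each boundary vertex $b$ together with all vertices having a directed path to $b$ (these are perfect binary trees), ordered from left to right; $\mathrm{depth}(T_j)$ is the depth of its root. $K$ is triangular if there is $J\in\{0,\dots,|B|-1\}$ such that the inputs of $T_0,\dots,T_J$ form a set of inputs with consecutive indices,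 the inputs of $T_{J+1},\dots,T_{|B|-1}$ form a set of inputs with consecutive indices, $\mathrm{depth}(T_j)<\mathrm{depth}(T_{j+1})$ for $0\le j<J-1$, and $\mathrm{depth}(T_j)>\mathrm{depth}(T_{j+1})$ for $J+1\le j<|B|-1$; the empty set is also triangular. Symmetric trees and delay: a symmetric $\circ$-tree on an input set $X$ is a circuit over $\{\circ\}$ whose underlying graph is a tree with leaves exactly $X$, computing the $\circ$ of all elements of $X$. Given arrival times $a\colon X\to\mathbb N$, the delay of a circuit is the maximum over inputs $x$ of $a(x)$ plus the maximum number of edges on a directed path starting at $x$. Delay-optimum means minimum delay among all symmetric $\circ$-trees on $X$. Precomputed data: a right descendant of input $x_i$ is a vertex $v$ such that there are vertices $x_i=s_0(x_i),s_1(x_i),\dots,s_r(x_i)=v$ with $s_j(x_i)$ the left predecessor of $s_{j+1}(x_i)$; $s_j(x_i)$ has depth $j$; let $r_i$ be the largest depth of a right descendant of $x_i$. The data consist of: for each input $x_i$, an array with constant-time access storing pointers to $s_j(x_i)$ for $0\le j\le r_i$; for every vertex $v$, the largest index $r(v)$ of an input in $\mathrm{In}_v(S)$; and for every $i$, the value $r_i$.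
   Formalization: In "triangular", depth(T_j) < depth(T_{j+1}) is required for all 0 ≤ j < J rather than 0 ≤ j < J−1 (else n=8, K={x1,x2,x5}, L=∅ violates the gate bound); K ∪ L is assumed nonempty. *)

theory Defs
  imports Complex_Main
begin

section \<open>Circuits\<close>

record 'v circuit =
  inputs :: "'v set"
  gates :: "'v set"
  lpred :: "'v \<Rightarrow> 'v"
  rpred :: "'v \<Rightarrow> 'v"

definition verts :: "('v, 'b) circuit_scheme \<Rightarrow> 'v set" where
  "verts C = inputs C \<union> gates C"

definition edges :: "('v, 'b) circuit_scheme \<Rightarrow> 'v rel" where
  "edges C = {(u, v). v \<in> gates C \<and> (u = lpred C v \<or> u = rpred C v)}"

definition is_circuit :: "'v circuit \<Rightarrow> bool" where
  "is_circuit C \<longleftrightarrow>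
     finite (verts C) \<and> inputs C \<inter> gates C = {} \<and>
     (\<forall>v \<in> gates C. lpred C v \<in> verts C \<and> rpred C v \<in> verts C \<and> lpred C v \<noteq> rpred C v) \<and>
     acyclic (edges C)"

definition In :: "'v circuit \<Rightarrow> 'v \<Rightarrow> 'v set" where
  "In C v = {x \<in> inputs C. (x, v) \<in> (edges C)\<^sup>*}"

definition depth :: "'v circuit \<Rightarrow> 'v \<Rightarrow> nat" where
  "depth C v = Max {k. \<exists>x \<in> inputs C. (x, v) \<in> edges C ^^ k}"

definition subcircuit :: "'v circuit \<Rightarrow> 'v \<Rightarrow> 'v circuit" where
  "subcircuit C b =
     C\<lparr>inputs := {v \<in> inputs C. (v, b) \<in> (edges C)\<^sup>*},
       gates := {v \<in> gates C. (v, b) \<in> (edges C)\<^sup>*}\<rparr>"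

definition circuit_iso :: "('v \<Rightarrow> 'w) \<Rightarrow> 'v circuit \<Rightarrow> 'w circuit \<Rightarrow> bool" where
  "circuit_iso f C D \<longleftrightarrow>
     inj_on f (verts C) \<and> inputs D = f ` inputs C \<and> gates D = f ` gates C \<and>
     (\<forall>v \<in> gates C. lpred D (f v) = f (lpred C v) \<and> rpred D (f v) = f (rpred C v))"


section \<open>Boolean functions computed by circuits\<close>

datatype bop = AND | OR

fun bop_fun :: "bop \<Rightarrow> bool \<Rightarrow> bool \<Rightarrow> bool" where
  "bop_fun AND = (\<and>)"
| "bop_fun OR = (\<or>)"

text \<open>The \<open>\<circ>\<close> of all elements of a (finite, nonempty) set.\<close>

fun big_bop :: "bop \<Rightarrow> 'v set \<Rightarrow> ('v \<Rightarrow> bool) \<Rightarrow> bool" where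
  "big_bop AND X \<sigma> = (\<forall>x \<in> X. \<sigma> x)"
| "big_bop OR X \<sigma> = (\<exists>x \<in> X. \<sigma> x)"

inductive has_value :: "bop \<Rightarrow> 'v circuit \<Rightarrow> ('v \<Rightarrow> bool) \<Rightarrow> 'v \<Rightarrow> bool \<Rightarrow> bool"
  for op C \<sigma> where
  input: "x \<in> inputs C \<Longrightarrow> has_value op C \<sigma> x (\<sigma> x)"
| gate: "v \<in> gates C \<Longrightarrow> has_value op C \<sigma> (lpred C v) a \<Longrightarrow> has_value op C \<sigma> (rpred C v) b \<Longrightarrow>
    has_value op C \<sigma> v (bop_fun op a b)"


section \<open>The leftist circuit\<close>

text \<open>The vertex \<open>(i, d)\<close> is the root of a perfect binary tree of depth \<open>d\<close> with leaves
  \<open>x\<^sub>i, \<dots>\<close> up to index \<open>i + 2 ^ d - 1\<close>; in particular, \<open>(i, 0)\<close> is the input \<open>x\<^sub>i\<close>.\<close>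

fun tree_gates :: "nat \<Rightarrow> nat \<Rightarrow> (nat \<times> nat) set" where
  "tree_gates i 0 = {}"
| "tree_gates i (Suc d) = insert (i, Suc d) (tree_gates i d \<union> tree_gates (i + 2 ^ d) d)"

function leftist_gates :: "nat \<Rightarrow> nat \<Rightarrow> (nat \<times> nat) set" where
  "leftist_gates i N =
     (if N \<ge> 2
      then let k = (GREATEST k. 2 ^ k \<le> N) in tree_gates i k \<union> leftist_gates (i + 2 ^ k) (N - 2 ^ k)
      else {})"
  by pat_completeness auto
termination
  by (relation "measure snd") auto

declare leftist_gates.simps [simp del]

definition leftist :: "nat \<Rightarrow> (nat \<times> nat) circuit" where
  "leftist n =
     \<lparr>inputs = {(i, 0) | i. i < n},
      gates = leftist_gates 0 n,
      lpred = (\<lambda>(i, d). (i, d - 1)),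
      rpred = (\<lambda>(i, d). (i + 2 ^ (d - 1), d - 1))\<rparr>"


section \<open>Boundary vertices and triangular sets\<close>

text \<open>From here on, \<open>x 0, \<dots>, x (n - 1)\<close> enumerates the inputs of the circuit \<open>S\<close>.\<close>

definition indices :: "nat \<Rightarrow> (nat \<Rightarrow> 'v) \<Rightarrow> 'v set \<Rightarrow> nat set" where
  "indices n x A = {i. i < n \<and> x i \<in> A}"

definition left_of :: "'v circuit \<Rightarrow> nat \<Rightarrow> (nat \<Rightarrow> 'v) \<Rightarrow> 'v \<Rightarrow> 'v \<Rightarrow> bool" where
  "left_of S n x v w \<longleftrightarrow>
     indices n x (In S v) \<inter> indices n x (In S w) = {} \<and>
     Max (indices n x (In S v)) < Min (indices n x (In S w))"

definition boundary :: "'v set \<Rightarrow> 'v circuit \<Rightarrow> 'v set" where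
  "boundary K S = {v \<in> verts S. In S v \<subseteq> K \<and> (\<forall>w. (v, w) \<in> edges S \<longrightarrow> \<not> In S w \<subseteq> K)}"

definition boundary_tree_sequence ::
    "'v circuit \<Rightarrow> nat \<Rightarrow> (nat \<Rightarrow> 'v) \<Rightarrow> 'v set \<Rightarrow> 'v list \<Rightarrow> 'v circuit list \<Rightarrow> bool" where
  "boundary_tree_sequence S n x K bs Ts \<longleftrightarrow>
     set bs = boundary K S \<and> sorted_wrt (left_of S n x) bs \<and> Ts = map (subcircuit S) bs"

definition consecutive :: "nat set \<Rightarrow> bool" where
  "consecutive A \<longleftrightarrow> (\<exists>p q. A = {p..<q})"

text \<open>The depths are strictly increasing along the whole left sequence \<open>T\<^sub>0, \<dots>, T\<^sub>J\<close>, i.e. for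
  \<open>0 \<le> j < J\<close>. Requiring this for \<open>0 \<le> j < J - 1\<close> only would make \<open>{x\<^sub>1, x\<^sub>2, x\<^sub>5}\<close> with \<open>n = 8\<close> and
  \<open>J = 1\<close> triangular; a tree on these inputs needs two gates outside \<open>S\<close>, more than
  \<open>2 log\<^sub>2 3 - 2\<close>.\<close>

definition triangular :: "'v circuit \<Rightarrow> nat \<Rightarrow> (nat \<Rightarrow> 'v) \<Rightarrow> 'v set \<Rightarrow> bool" where
  "triangular S n x K \<longleftrightarrow> K = {} \<or>
     (\<exists>bs Ts J. boundary_tree_sequence S n x K bs Ts \<and> J < length Ts \<and>
        consecutive (indices n x (\<Union>j \<in> {0..J}. inputs (Ts ! j))) \<and>
        consecutive (indices n x (\<Union>j \<in> {J + 1..<length Ts}. inputs (Ts ! j))) \<and>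
        (\<forall>j. j < J \<longrightarrow> depth (Ts ! j) (bs ! j) < depth (Ts ! (j + 1)) (bs ! (j + 1))) \<and>
        (\<forall>j. J + 1 \<le> j \<and> j + 1 < length Ts \<longrightarrow>
           depth (Ts ! j) (bs ! j) > depth (Ts ! (j + 1)) (bs ! (j + 1))))"


section \<open>Symmetric trees and delay\<close>

text \<open>The underlying graph is undirected. Circuits have no loops or parallel edges, so cycles of
  length at least 3 are all that has to be excluded. (The predicate \<open>tree\<close> of the AFP entry on
  graph theory excludes directed cycles only and is satisfied by every connected acyclic
  digraph.)\<close>

definition uedges :: "'v circuit \<Rightarrow> 'v rel" where
  "uedges C = edges C \<union> (edges C)\<inverse>"

definition undirected_cycle :: "'v circuit \<Rightarrow> 'v list \<Rightarrow> bool" where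
  "undirected_cycle C p \<longleftrightarrow>
     length p \<ge> 3 \<and> distinct p \<and> (\<forall>i < length p. (p ! i, p ! (Suc i mod length p)) \<in> uedges C)"

definition underlying_tree :: "'v circuit \<Rightarrow> bool" where
  "underlying_tree C \<longleftrightarrow>
     verts C \<noteq> {} \<and> (\<forall>u \<in> verts C. \<forall>v \<in> verts C. (u, v) \<in> (uedges C)\<^sup>*) \<and>
     (\<nexists>p. undirected_cycle C p)"

definition leaves :: "'v circuit \<Rightarrow> 'v set" where
  "leaves C = {v \<in> verts C. card {w. (v, w) \<in> uedges C} \<le> 1}"

text \<open>The vertex \<open>r\<close> is the output.\<close>

definition symmetric_tree :: "bop \<Rightarrow> 'v set \<Rightarrow> 'v circuit \<Rightarrow> 'v \<Rightarrow> bool" where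
  "symmetric_tree op X T r \<longleftrightarrow>
     is_circuit T \<and> inputs T = X \<and> underlying_tree T \<and> leaves T = X \<and> r \<in> verts T \<and>
     (\<forall>\<sigma>. has_value op T \<sigma> r (big_bop op X \<sigma>))"

definition delay :: "('v \<Rightarrow> nat) \<Rightarrow> 'v circuit \<Rightarrow> nat" where
  "delay a C = Max ((\<lambda>x. a x + Max {k. \<exists>v. (x, v) \<in> edges C ^^ k}) ` inputs C)"

definition delay_optimum_tree ::
    "bop \<Rightarrow> ('v \<Rightarrow> nat) \<Rightarrow> 'v set \<Rightarrow> 'v circuit \<Rightarrow> 'v \<Rightarrow> bool" where
  "delay_optimum_tree op a X T r \<longleftrightarrow>
     symmetric_tree op X T r \<and> (\<forall>T' r'. symmetric_tree op X T' r' \<longrightarrow> delay a T \<le> delay a T')"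


section \<open>Random access machine\<close>

text \<open>Running times refer to programs over natural-number variables and arrays. Every arithmetic
  operation, comparison, variable access and array access takes one unit of time. There is
  neither multiplication nor any operation on vertices other than comparing, copying and
  calculating with their addresses.\<close>

record state =
  var :: "string \<Rightarrow> nat"
  arr :: "string \<Rightarrow> nat \<Rightarrow> nat"

datatype aexp =
    Const nat
  | Var string
  | Arr string aexp
  | Plus aexp aexp
  | Minus aexp aexp

datatype bexp =
    Less aexp aexp
  | BNot bexp
  | BAnd bexp bexp

datatype com =
    Skip
  | Assign string aexp
  | Store string aexp aexp
  | Seq com com
  | Cond bexp com com
  | While bexp com

fun aval :: "aexp \<Rightarrow> state \<Rightarrow> nat" where
  "aval (Const c) s = c"
| "aval (Var y) s = var s y"
| "aval (Arr A e) s = arr s A (aval e s)"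
| "aval (Plus e f) s = aval e s + aval f s"
| "aval (Minus e f) s = aval e s - aval f s"

fun acost :: "aexp \<Rightarrow> nat" where
  "acost (Const c) = 1"
| "acost (Var y) = 1"
| "acost (Arr A e) = acost e + 1"
| "acost (Plus e f) = acost e + acost f + 1"
| "acost (Minus e f) = acost e + acost f + 1"

fun bval :: "bexp \<Rightarrow> state \<Rightarrow> bool" where
  "bval (Less e f) s = (aval e s < aval f s)"
| "bval (BNot b) s = (\<not> bval b s)"
| "bval (BAnd b c) s = (bval b s \<and> bval c s)"

fun bcost :: "bexp \<Rightarrow> nat" where
  "bcost (Less e f) = acost e + acost f + 1"
| "bcost (BNot b) = bcost b + 1"
| "bcost (BAnd b c) = bcost b + bcost c + 1"

text \<open>\<open>exec P s t s'\<close>: started in state \<open>s\<close>, the program \<open>P\<close> halts after \<open>t\<close> units of time in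
  state \<open>s'\<close>.\<close>

inductive exec :: "com \<Rightarrow> state \<Rightarrow> nat \<Rightarrow> state \<Rightarrow> bool" where
  Skip: "exec Skip s 1 s"
| Assign: "exec (Assign y e) s (acost e + 1) (s\<lparr>var := (var s)(y := aval e s)\<rparr>)"
| Store: "exec (Store A e f) s (acost e + acost f + 1)
    (s\<lparr>arr := (arr s)(A := (arr s A)(aval e s := aval f s))\<rparr>)"
| Seq: "exec P s t s' \<Longrightarrow> exec Q s' u s'' \<Longrightarrow> exec (Seq P Q) s (t + u) s''"
| CondTrue: "bval b s \<Longrightarrow> exec P s t s' \<Longrightarrow> exec (Cond b P Q) s (bcost b + t) s'"
| CondFalse: "\<not> bval b s \<Longrightarrow> exec Q s t s' \<Longrightarrow> exec (Cond b P Q) s (bcost b + t) s'"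
| WhileFalse: "\<not> bval b s \<Longrightarrow> exec (While b P) s (bcost b) s"
| WhileTrue: "bval b s \<Longrightarrow> exec P s t s' \<Longrightarrow> exec (While b P) s' u s'' \<Longrightarrow>
    exec (While b P) s (bcost b + t + u) s''"

lemma exec_deterministic:
  "exec P s t s' \<Longrightarrow> exec P s u s'' \<Longrightarrow> t = u \<and> s' = s''"
proof (induction arbitrary: u s'' rule: exec.induct)
  case Skip
  then show ?case by (auto elim: exec.cases)
next
  case Assign
  then show ?case by (auto elim: exec.cases)
next
  case Store
  then show ?case by (auto elim: exec.cases)
next
  case Seq
  from Seq.prems show ?case by cases (use Seq.IH in blast)
next
  case CondTrue
  from CondTrue.prems show ?case by cases (use CondTrue in blast)+
next
  case CondFalse
  from CondFalse.prems show ?case by cases (use CondFalse in blast)+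
next
  case WhileFalse
  from WhileFalse.prems show ?case by cases (use WhileFalse in blast)+
next
  case WhileTrue
  from WhileTrue.prems show ?case by cases (use WhileTrue in blast)+
qed


section \<open>Memory layout\<close>

text \<open>Vertices are identified with their addresses. Gates are stored by the addresses of their
  predecessors.\<close>

definition stores_circuit :: "state \<Rightarrow> nat circuit \<Rightarrow> bool" where
  "stores_circuit s S \<longleftrightarrow>
     (\<forall>v \<in> gates S. arr s ''left'' v = lpred S v \<and> arr s ''right'' v = rpred S v)"

text \<open>\<open>(x i, v) \<in> right_step S ^^ j\<close> says that \<open>v\<close> is the right descendant \<open>s\<^sub>j\<close> of \<open>x\<^sub>i\<close>.\<close>

definition right_step :: "'v circuit \<Rightarrow> 'v rel" where
  "right_step S = {(u, v). v \<in> gates S \<and> lpred S v = u}"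

definition max_right_depth :: "'v circuit \<Rightarrow> 'v \<Rightarrow> nat" where
  "max_right_depth S u = Max {depth S v | v. (u, v) \<in> (right_step S)\<^sup>*}"

text \<open>The array of right descendants of \<open>x i\<close> starts at position \<open>arr s ''base'' i\<close> of the pool
  \<open>arr s ''desc''\<close>.\<close>

definition stores_precomputed :: "state \<Rightarrow> nat circuit \<Rightarrow> nat \<Rightarrow> (nat \<Rightarrow> nat) \<Rightarrow> bool" where
  "stores_precomputed s S n x \<longleftrightarrow>
     (\<forall>i < n. \<forall>j \<le> max_right_depth S (x i). \<forall>v. (x i, v) \<in> right_step S ^^ j \<longrightarrow>
        arr s ''desc'' (arr s ''base'' i + j) = v) \<and>
     (\<forall>v \<in> verts S. arr s ''maxindex'' v = Max (indices n x (In S v))) \<and>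
     (\<forall>i < n. arr s ''maxdepth'' i = max_right_depth S (x i))"

text \<open>A triangular set is the union of at most two index intervals and is passed to the program
  by their endpoints: reading its elements one by one would take time \<open>k\<close>.\<close>

definition stores_intervals :: "state \<Rightarrow> nat \<Rightarrow> (nat \<Rightarrow> nat) \<Rightarrow> nat set \<Rightarrow> bool" where
  "stores_intervals s n x K \<longleftrightarrow>
     var s ''begin1'' \<le> var s ''end1'' \<and> var s ''end1'' \<le> var s ''begin2'' \<and>
     var s ''begin2'' \<le> var s ''end2'' \<and> var s ''end2'' \<le> n \<and>
     K = x ` ({var s ''begin1''..<var s ''end1''} \<union> {var s ''begin2''..<var s ''end2''})"

definition stores_list :: "state \<Rightarrow> nat list \<Rightarrow> (nat \<Rightarrow> nat) \<Rightarrow> bool" where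
  "stores_list s ys a \<longleftrightarrow>
     var s ''l'' = length ys \<and>
     (\<forall>i < length ys. arr s ''L'' i = ys ! i \<and> arr s ''arrival'' i = a (ys ! i))"

text \<open>All addresses from \<open>var s ''free''\<close> on are available for new gates.\<close>

definition free_from :: "state \<Rightarrow> nat set \<Rightarrow> bool" where
  "free_from s V \<longleftrightarrow> (\<forall>v \<in> V. v < var s ''free'')"

text \<open>The circuit in memory after a run from \<open>s\<close> to \<open>s'\<close>: the inputs and gates of \<open>S\<close>, the
  further inputs \<open>L\<close>, and the new gates, whose addresses are those taken from the free ones.\<close>

definition result_circuit :: "nat circuit \<Rightarrow> nat set \<Rightarrow> state \<Rightarrow> state \<Rightarrow> nat circuit" where
  "result_circuit S L s s' =
     \<lparr>inputs = inputs S \<union> L,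
      gates = gates S \<union> {var s ''free''..<var s' ''free''},
      lpred = arr s' ''left'',
      rpred = arr s' ''right''\<rparr>"

end

theory Submission
  imports Defs "HOL-Library.Multiset"
begin

text \<open>Since all inputs in \<open>K\<close> arrive at time 0, a boundary tree of depth \<open>d\<close> may be treated as a
  single input that arrives at time \<open>d\<close>. By Kraft's inequality, every symmetric tree of delay \<open>D\<close>
  satisfies \<open>\<Sum> 2 ^ a y \<le> 2 ^ D\<close>. This inequality survives if the two items that arrive first are
  replaced by one item that arrives one unit after the later of them, so doing this repeatedly
  produces a delay-optimum tree. New gates arise in the order of their arrival times; if the boundary
  trees are sorted as well, the earliest items are found at the heads of three queues.

  The boundary trees of an interval of indices are peeled off from both ends, by increasing depth;
  this takes constant time per depth. As \<open>K\<close> is triangular, it has at most two boundary trees of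
  each depth, so a sequence of \<open>m\<close> of them contains at least
  \<open>1 + 1 + 2 + 2 + 4 + 4 + \<dots>\<close> (\<open>m\<close> summands) inputs, and \<open>2 ^ (m + 1) \<le> k\<^sup>2\<close> follows for \<open>k \<ge> 3\<close>.\<close>

section \<open>Trees in circuits\<close>

text \<open>Optimality is certified by one invariant on exponents: every \<open>2 ^ D\<close> that
  bounds the initial weights still bounds the weights of the remaining items. For the single last
  item, of value \<open>z\<close>, this reads \<open>z \<le> D\<close>, and \<open>D\<close> may be
  the delay of any competing tree.

  The obstacle is sharing. A subcircuit in memory is a tree only if no vertex is used twice, so the
  trees under construction are kept as unfoldings together with the multiset of their vertices, and
  every step preserves distinctness over the whole forest.

  The machine cannot test divisibility. Since the vertices of the leftist circuit are exactly the
  pairs \<open>(i, d)\<close> with \<open>2 ^ d dvd i\<close> and \<open>i + 2 ^ d \<le> n\<close>,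
  one comparison with the stored depth of the largest right descendant decides whether an index is
  aligned.

  Counting: \<open>m\<close> boundary trees and \<open>l\<close> further inputs are
  \<open>m + l\<close> items, hence \<open>m + l - 1\<close> new gates;
  \<open>2 ^ (m + 1) \<le> k\<^sup>2\<close> gives \<open>m + 1 \<le> 2 * log 2 k\<close>, which
  turns the \<open>- 1\<close> into the \<open>- 2\<close> of the claim. At most about
  \<open>log 2 k\<close> depths are scanned, and each combination takes constant time.\<close>

datatype 'v btree = Leaf 'v | Node "'v btree" 'v "'v btree"

fun tree_root :: "'v btree \<Rightarrow> 'v" where
  "tree_root (Leaf x) = x"
| "tree_root (Node l g r) = g"

fun vertex_mset :: "'v btree \<Rightarrow> 'v multiset" where
  "vertex_mset (Leaf x) = {#x#}"
| "vertex_mset (Node l g r) = add_mset g (vertex_mset l + vertex_mset r)"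

fun leaf_mset :: "'v btree \<Rightarrow> 'v multiset" where
  "leaf_mset (Leaf x) = {#x#}"
| "leaf_mset (Node l g r) = leaf_mset l + leaf_mset r"

fun tree_delay :: "('v \<Rightarrow> nat) \<Rightarrow> 'v btree \<Rightarrow> nat" where
  "tree_delay a (Leaf x) = a x"
| "tree_delay a (Node l g r) = Suc (max (tree_delay a l) (tree_delay a r))"

fun represents :: "'v circuit \<Rightarrow> 'v btree \<Rightarrow> bool" where
  "represents C (Leaf x) \<longleftrightarrow> x \<in> inputs C"
| "represents C (Node l g r) \<longleftrightarrow>
     g \<in> gates C \<and> lpred C g = tree_root l \<and> rpred C g = tree_root r \<and> represents C l \<and> represents C r"

text \<open>\<open>represents\<close> alone admits shared gates, which occur repeatedly in the
  unfolding. Distinctness of \<open>vertex_mset t\<close> is the separate condition that makes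
  \<open>t\<close> a faithful picture of the circuit below its root.\<close>

definition distinct_mset :: "'a multiset \<Rightarrow> bool" where
  "distinct_mset M \<longleftrightarrow> (\<forall>v. count M v \<le> 1)"

lemma distinct_mset_union:
  "distinct_mset (M + N) \<longleftrightarrow> distinct_mset M \<and> distinct_mset N \<and> set_mset M \<inter> set_mset N = {}"
proof -
  have "count M v + count N v \<le> 1 \<longleftrightarrow>
    count M v \<le> 1 \<and> count N v \<le> 1 \<and> \<not> (v \<in># M \<and> v \<in># N)" for v
    using count_greater_zero_iff[of M v] count_greater_zero_iff[of N v] by linarith
  then show ?thesis
    unfolding distinct_mset_def by (auto simp del: count_greater_zero_iff)
qed

lemma distinct_mset_add_mset:
  "distinct_mset (add_mset v M) \<longleftrightarrow> v \<notin># M \<and> distinct_mset M"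
  using distinct_mset_union[of "{#v#}" M] by (auto simp: distinct_mset_def)

lemma distinct_mset_mset_set: "distinct_mset (mset_set A)"
  by (simp add: distinct_mset_def count_mset_set')

lemma root_in_vertex_mset [simp]: "tree_root t \<in># vertex_mset t"
  by (cases t) auto

lemma leaf_subset_vertex: "set_mset (leaf_mset t) \<subseteq> set_mset (vertex_mset t)"
  by (induction t) auto

lemma leaf_mset_nonempty: "leaf_mset t \<noteq> {#}"
  by (induction t) auto

text \<open>Carries trees from \<open>S\<close> into the circuit in memory, and from one memory
  state to the next after a gate has been appended.\<close>

lemma represents_mono:
  assumes "represents C t" "inputs C \<subseteq> inputs C'" "gates C \<subseteq> gates C'"
    "\<And>g. g \<in> gates C \<Longrightarrow> lpred C' g = lpred C g \<and> rpred C' g = rpred C g"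
  shows "represents C' t"
  using assms(1) by (induction t) (use assms(2-) in auto)

lemma represents_vertices:
  assumes "represents C t"
  shows "set_mset (vertex_mset t) \<subseteq> verts C"
    and "set_mset (leaf_mset t) \<subseteq> inputs C"
  using assms by (induction t) (auto simp: verts_def)

lemma represents_inputs:
  assumes "represents C t" "inputs C \<inter> gates C = {}"
  shows "set_mset (vertex_mset t) \<inter> inputs C = set_mset (leaf_mset t)"
  using assms by (induction t) auto

text \<open>Distinctness of the vertices matters: otherwise a leaf of one subtree could be
  the tree_root of another.\<close>

lemma represents_pred:
  assumes "represents C t" "inputs C \<inter> gates C = {}" "distinct_mset (vertex_mset t)"
    "w \<in># vertex_mset t" "(u, w) \<in> edges C"
  shows "u \<in># vertex_mset t \<and> u \<noteq> tree_root t"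
  using assms
proof (induction t)
  case (Leaf x)
  then show ?case by (auto simp: edges_def)
next
  case (Node l g r)
  have rt: "tree_root l \<in># vertex_mset l" "tree_root r \<in># vertex_mset r" by auto
  show ?case
    using Node rt
    by (auto simp: edges_def distinct_mset_add_mset distinct_mset_union)
qed

lemma represents_edges_to_root:
  assumes "represents C t" "v \<in># vertex_mset t"
  shows "(v, tree_root t) \<in> (edges C)\<^sup>*"
  using assms
proof (induction t)
  case (Node l g r)
  have "(tree_root l, g) \<in> edges C" "(tree_root r, g) \<in> edges C"
    using Node.prems by (auto simp: edges_def)
  then show ?case
    using Node by (auto intro: rtrancl_into_rtrancl)
qed auto

text \<open>By \<open>represents_pred\<close> the vertices of the tree are closed under
  predecessors, so the subcircuit below the root contains nothing else.\<close>

lemma represents_reach: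
  assumes "represents C t" "inputs C \<inter> gates C = {}" "distinct_mset (vertex_mset t)"
  shows "(v, tree_root t) \<in> (edges C)\<^sup>* \<longleftrightarrow> v \<in># vertex_mset t"
proof
  assume "(v, tree_root t) \<in> (edges C)\<^sup>*"
  then show "v \<in># vertex_mset t"
    by (induction rule: converse_rtrancl_induct) (use represents_pred[OF assms] in auto)
qed (rule represents_edges_to_root[OF assms(1)])

lemma In_represents:
  assumes "represents C t" "inputs C \<inter> gates C = {}" "distinct_mset (vertex_mset t)"
  shows "In C (tree_root t) = set_mset (leaf_mset t)"
  using represents_reach[OF assms] represents_inputs[OF assms(1,2)] by (auto simp: In_def)

text \<open>The two subtrees share no vertex, and the top gate is a successor of their roots only,
  which by \<open>represents_pred\<close> have no successor inside their own subtree. Uniqueness of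
  successors is what excludes undirected cycles.\<close>

lemma represents_unique_successor:
  assumes "represents C t" "inputs C \<inter> gates C = {}" "distinct_mset (vertex_mset t)"
    "w \<in># vertex_mset t" "w' \<in># vertex_mset t" "(u, w) \<in> edges C" "(u, w') \<in> edges C"
  shows "w = w'"
  using assms
proof (induction t)
  case (Node l g r)
  have d: "distinct_mset (vertex_mset l)" "distinct_mset (vertex_mset r)"
    "set_mset (vertex_mset l) \<inter> set_mset (vertex_mset r) = {}"
    using Node.prems by (auto simp: distinct_mset_add_mset distinct_mset_union)
  have rt: "tree_root l \<in># vertex_mset l" "tree_root r \<in># vertex_mset r" by auto
  have rep: "represents C l" "represents C r" using Node.prems by auto
  have g: "(u, g) \<in> edges C \<Longrightarrow> u = tree_root l \<or> u = tree_root r"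
    using Node.prems by (auto simp: edges_def)
  note pl = represents_pred[OF rep(1) Node.prems(2) d(1)]
  note pr = represents_pred[OF rep(2) Node.prems(2) d(2)]
  have "w = g \<or> w \<in># vertex_mset l \<or> w \<in># vertex_mset r"
    "w' = g \<or> w' \<in># vertex_mset l \<or> w' \<in># vertex_mset r"
    using Node.prems by auto
  then show ?case
    using Node.IH rep Node.prems(2,6,7) d rt g pl[of w u] pl[of w' u] pr[of w u] pr[of w' u]
    by (auto simp: disjoint_iff)
qed auto

lemma subcircuit_represents:
  assumes "represents C t" "inputs C \<inter> gates C = {}" "distinct_mset (vertex_mset t)"
  defines "T \<equiv> subcircuit C (tree_root t)"
  shows "inputs T = set_mset (leaf_mset t)"
    and "gates T = set_mset (vertex_mset t) \<inter> gates C"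
    and "verts T = set_mset (vertex_mset t)"
    and "lpred T = lpred C" and "rpred T = rpred C"
    and "edges T = {(u, v) \<in> edges C. v \<in># vertex_mset t}"
    and "represents T t"
proof -
  note r = represents_reach[OF assms(1-3)] represents_inputs[OF assms(1,2)]
  show 1: "inputs T = set_mset (leaf_mset t)"
    and 2: "gates T = set_mset (vertex_mset t) \<inter> gates C"
    and 3: "lpred T = lpred C" "rpred T = rpred C"
    using r by (auto simp: T_def subcircuit_def)
  show "verts T = set_mset (vertex_mset t)"
    using 1 2 represents_vertices[OF assms(1)] represents_inputs[OF assms(1,2)]
    by (auto simp: verts_def)
  show "edges T = {(u, v) \<in> edges C. v \<in># vertex_mset t}"
    using 2 3 by (auto simp: edges_def)
  have "represents T u" if "represents C u" "set_mset (vertex_mset u) \<subseteq> set_mset (vertex_mset t)" for u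
    using that
  proof (induction u)
    case (Leaf x)
    then show ?case using 1 represents_inputs[OF assms(1,2)] by auto
  next
    case (Node l g r)
    then show ?case using 2 3 by auto
  qed
  then show "represents T t" using assms(1) by blast
qed

lemma acyclic_rank:
  fixes \<rho> :: "'v \<Rightarrow> nat"
  assumes "\<And>u v. (u, v) \<in> R \<Longrightarrow> \<rho> u < \<rho> v"
  shows "acyclic R"
proof -
  have "(u, v) \<in> R\<^sup>+ \<Longrightarrow> \<rho> u < \<rho> v" for u v
    by (induction rule: trancl_induct) (use assms in \<open>force\<close>)+
  then show ?thesis by (force simp: acyclic_def)
qed

lemma finite_edges: "finite (verts C) \<Longrightarrow> finite (edges C)"
  by (rule finite_subset[of _ "(lpred C ` verts C \<union> rpred C ` verts C) \<times> verts C"])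
    (auto simp: edges_def verts_def)

lemma is_circuit_wf: "is_circuit C \<Longrightarrow> wf (edges C)"
  by (simp add: is_circuit_def finite_edges finite_acyclic_wf)

text \<open>A vertex of the cycle that is minimal with respect to the edges has only successors as
  neighbours in the cycle.\<close>

lemma no_undirected_cycle:
  assumes "is_circuit T" and uniq: "\<And>u w w'. (u, w) \<in> edges T \<Longrightarrow> (u, w') \<in> edges T \<Longrightarrow> w = w'"
  shows "\<not> undirected_cycle T p"
proof
  assume "undirected_cycle T p"
  then have len: "length p \<ge> 3" and d: "distinct p"
    and adj: "\<And>i. i < length p \<Longrightarrow> (p ! i, p ! (Suc i mod length p)) \<in> uedges T"
    by (auto simp: undirected_cycle_def)
  have "p ! 0 \<in> set p" using len by (intro nth_mem) auto
  then obtain z where z: "z \<in> set p" "\<And>y. (y, z) \<in> edges T \<Longrightarrow> y \<notin> set p"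
    using wfE_min[OF is_circuit_wf[OF assms(1)]] by metis
  then obtain i where i: "i < length p" "p ! i = z" by (auto simp: in_set_conv_nth)
  define n where "n = length p"
  have n: "n \<ge> 3" "i < n" using len i by (auto simp: n_def)
  \<comment> \<open>\<open>j\<close> and \<open>k\<close> are the positions before and after
    \<open>i\<close> on the cycle; they differ because the cycle has length at least 3.\<close>
  define j where "j = (if i = 0 then n - 1 else i - 1)"
  define k where "k = Suc i mod n"
  have j: "j < n" "Suc j mod n = i" using n by (auto simp: j_def)
  have k: "k < n" "k \<noteq> j" using n by (auto simp: k_def j_def mod_Suc)
  have "(p ! j, z) \<in> uedges T" using adj[of j] j i by (simp add: n_def)
  moreover have "p ! j \<in> set p" "p ! k \<in> set p" using j k by (auto simp: n_def)
  moreover have "(z, p ! k) \<in> uedges T" using adj[of i] i by (simp add: n_def k_def)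
  ultimately have "(z, p ! j) \<in> edges T" "(z, p ! k) \<in> edges T"
    using z(2) by (auto simp: uedges_def)
  then have "p ! j = p ! k" by (rule uniq)
  then show False using d j k by (simp add: nth_eq_iff_index_eq n_def)
qed

lemma big_bop_union:
  "big_bop op (A \<union> B) \<sigma> = bop_fun op (big_bop op A \<sigma>) (big_bop op B \<sigma>)"
  by (cases op) auto

lemma has_value_represents:
  "represents C t \<Longrightarrow> has_value op C \<sigma> (tree_root t) (big_bop op (set_mset (leaf_mset t)) \<sigma>)"
proof (induction t)
  case (Leaf x)
  have "big_bop op {x} \<sigma> = \<sigma> x" by (cases op) auto
  then show ?case using Leaf by (auto intro: has_value.input)
next
  case (Node l g r)
  then show ?case by (auto simp: big_bop_union intro!: has_value.gate)
qed

lemma is_circuit_subcircuit: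
  assumes "is_circuit C"
  shows "is_circuit (subcircuit C b)"
proof -
  have sub: "edges (subcircuit C b) \<subseteq> edges C" "verts (subcircuit C b) \<subseteq> verts C"
    by (auto simp: edges_def subcircuit_def verts_def)
  have "lpred C v \<in> verts (subcircuit C b) \<and> rpred C v \<in> verts (subcircuit C b)"
    if "v \<in> gates (subcircuit C b)" for v
  proof -
    have v: "v \<in> gates C" "(v, b) \<in> (edges C)\<^sup>*" using that by (auto simp: subcircuit_def)
    then have "(lpred C v, b) \<in> (edges C)\<^sup>*" "(rpred C v, b) \<in> (edges C)\<^sup>*"
      by (auto simp: edges_def intro: converse_rtrancl_into_rtrancl)
    then show ?thesis using v assms by (auto simp: is_circuit_def subcircuit_def verts_def)
  qed
  then show ?thesis
    using assms sub unfolding is_circuit_def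
    by (auto simp: finite_subset acyclic_subset) (auto simp: subcircuit_def)
qed

text \<open>Connectivity goes through the root, the absence of cycles through unique successors.
  Degrees identify the leaves: a gate has two distinct predecessors, an input none and at most one
  successor.\<close>

lemma symmetric_tree_represents:
  assumes C: "is_circuit C" and t: "represents C t" "distinct_mset (vertex_mset t)"
  shows "symmetric_tree op (set_mset (leaf_mset t)) (subcircuit C (tree_root t)) (tree_root t)"
proof -
  let ?T = "subcircuit C (tree_root t)"
  have disj: "inputs C \<inter> gates C = {}" using C by (simp add: is_circuit_def)
  note s = subcircuit_represents[OF t(1) disj t(2)]
  have T: "is_circuit ?T" by (rule is_circuit_subcircuit[OF C])
  have uniq: "w = w'" if "(u, w) \<in> edges ?T" "(u, w') \<in> edges ?T" for u w w'
    using represents_unique_successor[OF t(1) disj t(2)] that by (auto simp: s)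
  have reach: "(v, tree_root t) \<in> (uedges ?T)\<^sup>*" if "v \<in> verts ?T" for v
    using represents_edges_to_root[OF s(7)] that rtrancl_mono[of "edges ?T" "uedges ?T"]
    by (auto simp: s uedges_def)
  have sy: "sym ((uedges ?T)\<^sup>*)" by (intro sym_rtrancl) (auto simp: sym_def uedges_def)
  have "(u, v) \<in> (uedges ?T)\<^sup>*" if "u \<in> verts ?T" "v \<in> verts ?T" for u v
    using reach[OF that(1)] symD[OF sy reach[OF that(2)]] by (rule rtrancl_trans)
  moreover have "tree_root t \<in> verts ?T" by (simp add: s)
  moreover have "\<not> undirected_cycle ?T p" for p by (rule no_undirected_cycle[OF T]) (rule uniq)
  ultimately have "underlying_tree ?T"
    unfolding underlying_tree_def by (intro conjI ballI notI) auto
  moreover have "leaves ?T = set_mset (leaf_mset t)"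
  proof (intro set_eqI iffI)
    fix v assume v: "v \<in> leaves ?T"
    then have vt: "v \<in> verts ?T" by (simp add: leaves_def)
    show "v \<in># leaf_mset t"
    proof (rule ccontr)
      assume "v \<notin># leaf_mset t"
      then have g: "v \<in> gates ?T" using vt s by (auto simp: verts_def)
      have fin: "finite {w. (v, w) \<in> uedges ?T}"
        by (rule finite_subset[of _ "verts ?T"])
          (use T in \<open>auto simp: is_circuit_def uedges_def edges_def verts_def\<close>)
      have "{lpred ?T v, rpred ?T v} \<subseteq> {w. (v, w) \<in> uedges ?T}"
        using g by (auto simp: uedges_def edges_def)
      then have "card {lpred ?T v, rpred ?T v} \<le> card {w. (v, w) \<in> uedges ?T}"
        by (intro card_mono fin)
      moreover have "lpred ?T v \<noteq> rpred ?T v" using T g by (auto simp: is_circuit_def)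
      ultimately show False using v by (simp add: leaves_def)
    qed
  next
    fix v assume v: "v \<in># leaf_mset t"
    then have "v \<notin> gates ?T" using T by (auto simp: is_circuit_def s)
    then have "{w. (v, w) \<in> uedges ?T} = {w. (v, w) \<in> edges ?T}"
      unfolding uedges_def edges_def by blast
    moreover have "finite {w. (v, w) \<in> edges ?T}"
      by (rule finite_subset[of _ "verts ?T"]) (use T in \<open>auto simp: is_circuit_def edges_def verts_def\<close>)
    then have "card {w. (v, w) \<in> edges ?T} \<le> Suc 0"
      unfolding card_le_Suc0_iff_eq[OF \<open>finite {w. (v, w) \<in> edges ?T}\<close>] using uniq by blast
    ultimately have "card {w. (v, w) \<in> uedges ?T} \<le> 1" by simp
    then show "v \<in> leaves ?T" using v leaf_subset_vertex[of t] by (auto simp: leaves_def s)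
  qed
  ultimately show ?thesis
    using T has_value_represents[OF s(7)] by (auto simp: symmetric_tree_def s)
qed


section \<open>Delay\<close>

text \<open>Walks of an acyclic relation visit every vertex at most once.\<close>

lemma relpow_length_bound:
  assumes "finite R" "acyclic R" "(u, v) \<in> R ^^ k"
  shows "k \<le> card (Field R)"
proof (cases "k = 0")
  case False
  obtain f where f: "f 0 = u" "f k = v" "\<And>i. i < k \<Longrightarrow> (f i, f (Suc i)) \<in> R"
    using assms(3) by (auto simp: relpow_fun_conv)
  have path: "i < j \<Longrightarrow> j \<le> k \<Longrightarrow> (f i, f j) \<in> R\<^sup>+" for i j
  proof (induction j)
    case (Suc j)
    then have "(f j, f (Suc j)) \<in> R" using f(3) by simp
    then show ?case using Suc by (cases "i = j") (auto intro: trancl_into_trancl)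
  qed auto
  have "inj_on f {1..k}"
  proof (rule linorder_inj_onI)
    fix i j assume "i < j" "i \<in> {1..k}" "j \<in> {1..k}"
    then have "(f i, f j) \<in> R\<^sup>+" using path by auto
    then show "f i \<noteq> f j" using assms(2) by (metis acyclic_def)
  qed auto
  moreover have "f ` {1..k} \<subseteq> Field R"
  proof clarify
    fix i assume "i \<in> {1..k}"
    then have "(f (i - 1), f i) \<in> R" using f(3)[of "i - 1"] by auto
    then show "f i \<in> Field R" by (auto simp: Field_def)
  qed
  ultimately have "card {1..k} \<le> card (Field R)"
    using card_inj_on_le[of f "{1..k}" "Field R"] finite_Field[OF assms(1)] by simp
  then show ?thesis by simp
qed auto

text \<open>Needed because \<open>Max\<close> in \<open>delay\<close> carries information only on
  finite sets.\<close>

lemma finite_path_lengths: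
  assumes "is_circuit C"
  shows "finite {k. \<exists>v. (u, v) \<in> edges C ^^ k}"
  by (rule finite_subset[of _ "{..card (Field (edges C))}"])
    (use assms relpow_length_bound[OF finite_edges] in \<open>auto simp: is_circuit_def\<close>)

lemma delay_le:
  assumes "is_circuit C" "inputs C \<noteq> {}"
    "\<And>x k v. x \<in> inputs C \<Longrightarrow> (x, v) \<in> edges C ^^ k \<Longrightarrow> a x + k \<le> D"
  shows "delay a C \<le> D"
proof -
  have "a x + Max {k. \<exists>v. (x, v) \<in> edges C ^^ k} \<le> D" if "x \<in> inputs C" for x
  proof -
    have "0 \<in> {k. \<exists>v. (x, v) \<in> edges C ^^ k}" by auto
    then have "Max {k. \<exists>v. (x, v) \<in> edges C ^^ k} \<in> {k. \<exists>v. (x, v) \<in> edges C ^^ k}"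
      by (intro Max_in finite_path_lengths[OF assms(1)]) blast
    then show ?thesis using assms(3)[OF that] by auto
  qed
  then show ?thesis
    using assms(1,2) by (auto simp: delay_def is_circuit_def verts_def)
qed

lemma le_delay:
  assumes "is_circuit C" "x \<in> inputs C" "(x, v) \<in> edges C ^^ k"
  shows "a x + k \<le> delay a C"
proof -
  have "k \<le> Max {k. \<exists>v. (x, v) \<in> edges C ^^ k}"
    using assms(3) by (intro Max_ge finite_path_lengths[OF assms(1)]) auto
  then have "a x + k \<le> a x + Max {k. \<exists>v. (x, v) \<in> edges C ^^ k}" by simp
  also have "\<dots> \<le> delay a C"
    unfolding delay_def using assms(1,2) by (intro Max_ge) (auto simp: is_circuit_def verts_def)
  finally show ?thesis .
qed

text \<open>The intended \<open>f v\<close> is the delay of the subtree rooted at \<open>v\<close>;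
  distinctness of the vertices lets the functions of the two subtrees be glued. Such a potential
  grows along every edge, so it bounds the lengths of all paths at once.\<close>

lemma tree_delay_potential:
  assumes "represents C t" "distinct_mset (vertex_mset t)"
  shows "\<exists>f. f (tree_root t) = tree_delay a t \<and> (\<forall>x \<in># leaf_mset t. f x = a x) \<and>
    (\<forall>v \<in># vertex_mset t. f v \<le> tree_delay a t) \<and>
    (\<forall>v \<in># vertex_mset t. v \<notin># leaf_mset t \<longrightarrow>
       f (lpred C v) < f v \<and> f (rpred C v) < f v \<and>
       lpred C v \<in># vertex_mset t \<and> rpred C v \<in># vertex_mset t)"
  using assms
proof (induction t)
  case (Node l g r)
  have d: "distinct_mset (vertex_mset l)" "distinct_mset (vertex_mset r)"
    "set_mset (vertex_mset l) \<inter> set_mset (vertex_mset r) = {}"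
    "g \<notin># vertex_mset l" "g \<notin># vertex_mset r"
    using Node.prems by (auto simp: distinct_mset_add_mset distinct_mset_union)
  obtain f1 where f1: "f1 (tree_root l) = tree_delay a l" "\<forall>x \<in># leaf_mset l. f1 x = a x"
    "\<forall>v \<in># vertex_mset l. f1 v \<le> tree_delay a l"
    "\<forall>v \<in># vertex_mset l. v \<notin># leaf_mset l \<longrightarrow> f1 (lpred C v) < f1 v \<and> f1 (rpred C v) < f1 v \<and>
       lpred C v \<in># vertex_mset l \<and> rpred C v \<in># vertex_mset l"
    using Node.IH(1) Node.prems d by auto
  obtain f2 where f2: "f2 (tree_root r) = tree_delay a r" "\<forall>x \<in># leaf_mset r. f2 x = a x"
    "\<forall>v \<in># vertex_mset r. f2 v \<le> tree_delay a r"
    "\<forall>v \<in># vertex_mset r. v \<notin># leaf_mset r \<longrightarrow> f2 (lpred C v) < f2 v \<and> f2 (rpred C v) < f2 v \<and>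
       lpred C v \<in># vertex_mset r \<and> rpred C v \<in># vertex_mset r"
    using Node.IH(2) Node.prems d by auto
  define f where "f v = (if v = g then tree_delay a (Node l g r)
    else if v \<in># vertex_mset l then f1 v else f2 v)" for v
  have fl: "f v = f1 v" if "v \<in># vertex_mset l" for v using that d by (auto simp: f_def)
  have fr: "f v = f2 v" if "v \<in># vertex_mset r" for v using that d by (auto simp: f_def)
  have fg: "f g = Suc (max (tree_delay a l) (tree_delay a r))" by (simp add: f_def)
  have rt: "tree_root l \<in># vertex_mset l" "tree_root r \<in># vertex_mset r" by auto
  have lv: "x \<in># vertex_mset l" if "x \<in># leaf_mset l" for x using that leaf_subset_vertex by fastforce
  have rv: "x \<in># vertex_mset r" if "x \<in># leaf_mset r" for x using that leaf_subset_vertex by fastforce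
  show ?case
  proof (intro exI[of _ f] conjI ballI impI)
    show "f (tree_root (Node l g r)) = tree_delay a (Node l g r)" by (simp add: fg)
    show "f x = a x" if "x \<in># leaf_mset (Node l g r)" for x
      using that lv rv fl fr f1(2) f2(2) by auto
    show "f v \<le> tree_delay a (Node l g r)" if "v \<in># vertex_mset (Node l g r)" for v
      using that fl fr fg f1(3) f2(3) by (auto simp: max_def intro: le_SucI order_trans)
  next
    fix v assume v: "v \<in># vertex_mset (Node l g r)" "v \<notin># leaf_mset (Node l g r)"
    consider "v = g" | "v \<in># vertex_mset l" | "v \<in># vertex_mset r" using v by auto
    then have "f (lpred C v) < f v \<and> f (rpred C v) < f v \<and>
       lpred C v \<in># vertex_mset (Node l g r) \<and> rpred C v \<in># vertex_mset (Node l g r)"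
    proof cases
      case 1
      then show ?thesis using Node.prems rt fl fr fg f1(1) f2(1) by auto
    next
      case 2
      then show ?thesis using v f1(4) fl by auto
    next
      case 3
      then show ?thesis using v f2(4) fr by auto
    qed
    then show "f (lpred C v) < f v" "f (rpred C v) < f v"
      "lpred C v \<in># vertex_mset (Node l g r)" "rpred C v \<in># vertex_mset (Node l g r)" by auto
  qed
qed auto

text \<open>Along a path from a leaf \<open>x\<close> the potential starts at \<open>a x\<close>,
  gains at least one per edge and never exceeds \<open>tree_delay a t\<close>. This upper bound is
  later compared with the Kraft lower bound for every competitor.\<close>

lemma delay_subcircuit_le:
  assumes C: "is_circuit C" and t: "represents C t" "distinct_mset (vertex_mset t)"
  shows "delay a (subcircuit C (tree_root t)) \<le> tree_delay a t"
proof (rule delay_le)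
  let ?T = "subcircuit C (tree_root t)"
  have disj: "inputs C \<inter> gates C = {}" using C by (simp add: is_circuit_def)
  note s = subcircuit_represents[OF t(1) disj t(2)]
  show "is_circuit ?T" by (rule is_circuit_subcircuit[OF C])
  show "inputs ?T \<noteq> {}" using leaf_mset_nonempty[of t] by (simp add: s)
  obtain f where f: "\<forall>x \<in># leaf_mset t. f x = a x"
    "\<forall>v \<in># vertex_mset t. f v \<le> tree_delay a t"
    "\<forall>v \<in># vertex_mset t. v \<notin># leaf_mset t \<longrightarrow> f (lpred C v) < f v \<and> f (rpred C v) < f v"
    using tree_delay_potential[OF t, of a] by auto
  have step: "f u < f v \<and> v \<in># vertex_mset t" if "(u, v) \<in> edges ?T" for u v
  proof -
    have "v \<notin># leaf_mset t"
      using that represents_vertices(2)[OF t(1)] disj by (auto simp: s edges_def)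
    then show ?thesis using that f(3) by (auto simp: s edges_def)
  qed
  have path: "(x, v) \<in> edges ?T ^^ k \<Longrightarrow> x \<in># leaf_mset t \<Longrightarrow> a x + k \<le> f v \<and> v \<in># vertex_mset t"
    for x v k
  proof (induction k arbitrary: v)
    case 0
    then show ?case using f(1) leaf_subset_vertex[of t] by auto
  next
    case (Suc k)
    then show ?case using step by fastforce
  qed
  show "a x + k \<le> tree_delay a t" if "x \<in> inputs ?T" "(x, v) \<in> edges ?T ^^ k" for x k v
    using path[OF that(2)] that(1) f(2) order_trans by (fastforce simp: s)
qed


section \<open>Lower bound on the delay\<close>

lemma has_value_unique:
  assumes "has_value op C \<sigma> v b" "has_value op C \<sigma> v b'" "inputs C \<inter> gates C = {}"
  shows "b = b'"
  using assms(1,2)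
proof (induction arbitrary: b')
  case (input x)
  then show ?case using assms(3) by (auto elim: has_value.cases)
next
  case (gate v a b)
  from gate.prems gate.hyps(1) assms(3)
  obtain a2 b2 where "has_value op C \<sigma> (lpred C v) a2" "has_value op C \<sigma> (rpred C v) b2"
    "b' = bop_fun op a2 b2"
    by (auto elim: has_value.cases)
  then show ?case using gate.IH by auto
qed

lemma In_gate:
  assumes "inputs C \<inter> gates C = {}" "v \<in> gates C"
  shows "In C v = In C (lpred C v) \<union> In C (rpred C v)"
proof
  show "In C v \<subseteq> In C (lpred C v) \<union> In C (rpred C v)"
  proof
    fix x assume x: "x \<in> In C v"
    then have "x \<noteq> v" using assms by (auto simp: In_def)
    then obtain u where "(x, u) \<in> (edges C)\<^sup>*" "(u, v) \<in> edges C"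
      using x by (auto simp: In_def elim: rtranclE)
    then show "x \<in> In C (lpred C v) \<union> In C (rpred C v)"
      using x by (auto simp: In_def edges_def)
  qed
  have "(lpred C v, v) \<in> edges C" "(rpred C v, v) \<in> edges C" using assms by (auto simp: edges_def)
  then show "In C (lpred C v) \<union> In C (rpred C v) \<subseteq> In C v"
    by (auto simp: In_def intro: rtrancl_into_rtrancl)
qed

lemma In_input:
  assumes "inputs C \<inter> gates C = {}" "x \<in> inputs C"
  shows "In C x = {x}"
proof -
  have "y = x" if "(y, x) \<in> (edges C)\<^sup>*" for y
    using that by (rule rtranclE) (use assms in \<open>auto simp: edges_def\<close>)
  then show ?thesis using assms by (auto simp: In_def)
qed

lemma has_value_cong:
  assumes "has_value op C \<sigma> v b" "inputs C \<inter> gates C = {}" "\<And>x. x \<in> In C v \<Longrightarrow> \<sigma> x = \<sigma>' x"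
  shows "has_value op C \<sigma>' v b"
  using assms(1,3)
proof induction
  case (input x)
  then have "\<sigma> x = \<sigma>' x" using In_input[OF assms(2)] by auto
  then show ?case using has_value.input[OF input(1), of op \<sigma>'] by simp
next
  case (gate v a b)
  then show ?case using In_gate[OF assms(2) gate.hyps(1)] by (auto intro: has_value.gate)
qed

text \<open>The value at \<open>r\<close> depends only on \<open>In T r\<close>. If all inputs carry
  the neutral element of the operation, changing one \<open>x \<in> X\<close> to the absorbing
  element changes the result.\<close>

lemma symmetric_tree_In:
  assumes "symmetric_tree op X T r"
  shows "X \<subseteq> In T r"
proof
  fix x assume x: "x \<in> X"
  have disj: "inputs T \<inter> gates T = {}" and val: "\<And>\<sigma>. has_value op T \<sigma> r (big_bop op X \<sigma>)"
    using assms by (auto simp: symmetric_tree_def is_circuit_def)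
  \<comment> \<open>\<open>op = AND\<close> is the neutral element: \<open>True\<close> for
    \<open>AND\<close>, \<open>False\<close> for \<open>OR\<close>. The negation used for
    \<open>x\<close> below is the absorbing one.\<close>
  define \<sigma> where "\<sigma> = (\<lambda>y :: 'a. op = AND)"
  define \<sigma>' where "\<sigma>' = \<sigma>(x := (op \<noteq> AND))"
  show "x \<in> In T r"
  proof (rule ccontr)
    assume "x \<notin> In T r"
    then have "has_value op T \<sigma>' r (big_bop op X \<sigma>)"
      by (intro has_value_cong[OF val disj]) (auto simp: \<sigma>'_def)
    then have "big_bop op X \<sigma> = big_bop op X \<sigma>'" using has_value_unique[OF _ val disj] by blast
    moreover have "big_bop op X \<sigma> \<noteq> big_bop op X \<sigma>'"
      using x by (cases op) (auto simp: \<sigma>_def \<sigma>'_def)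
    ultimately show False by simp
  qed
qed

text \<open>The walk of length \<open>j\<close> leaving \<open>v\<close> makes the induction
  descend: a predecessor of \<open>v\<close> starts a walk of length \<open>Suc j\<close>, and each
  of the two predecessors accounts for half of the bound. Inputs below both of them only decrease
  the left side. At an input the claim is \<open>a v + j \<le> delay a T\<close>.\<close>

lemma kraft_below_vertex:
  fixes a :: "'v \<Rightarrow> nat"
  assumes T: "is_circuit T" and v: "v \<in> verts T" "(v, u) \<in> edges T ^^ j"
  shows "(\<Sum>x \<in> In T v. 2 ^ a x) * 2 ^ j \<le> (2 :: nat) ^ delay a T"
  using v
proof (induction v arbitrary: j u rule: wf_induct_rule[OF is_circuit_wf[OF T]])
  case (1 v)
  have disj: "inputs T \<inter> gates T = {}" and fin: "finite (inputs T)"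
    using T by (auto simp: is_circuit_def verts_def)
  show ?case
  proof (cases "v \<in> inputs T")
    case True
    have "(2 :: nat) ^ (a v + j) \<le> 2 ^ delay a T"
      using le_delay[OF T True 1(3)] by (intro power_increasing) auto
    then show ?thesis using True disj by (simp add: In_input power_add)
  next
    case False
    then have g: "v \<in> gates T" using 1(2) by (auto simp: verts_def)
    let ?f = "\<lambda>v. \<Sum>x \<in> In T v. (2 :: nat) ^ a x"
    have e: "(lpred T v, v) \<in> edges T" "(rpred T v, v) \<in> edges T" using g by (auto simp: edges_def)
    have "lpred T v \<in> verts T" "rpred T v \<in> verts T" using T g by (auto simp: is_circuit_def)
    then have "?f (lpred T v) * 2 ^ Suc j \<le> 2 ^ delay a T" "?f (rpred T v) * 2 ^ Suc j \<le> 2 ^ delay a T"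
      using e 1(1)[of _ u "Suc j"] relpow_Suc_I2[OF _ 1(3)] by blast+
    moreover have "?f v \<le> ?f (lpred T v) + ?f (rpred T v)"
      unfolding In_gate[OF disj g]
      by (subst sum_Un_nat) (use fin in \<open>auto simp: In_def\<close>)
    then have "?f v * 2 ^ Suc j \<le> ?f (lpred T v) * 2 ^ Suc j + ?f (rpred T v) * 2 ^ Suc j"
      by (metis add_mult_distrib mult_le_mono1)
    ultimately show ?thesis by simp
  qed
qed

lemma kraft_symmetric_tree:
  assumes "symmetric_tree op X T r"
  shows "(\<Sum>x \<in> X. 2 ^ a x) \<le> (2 :: nat) ^ delay a T"
proof -
  have T: "is_circuit T" "r \<in> verts T" using assms by (auto simp: symmetric_tree_def)
  have "(\<Sum>x \<in> X. 2 ^ a x) \<le> (\<Sum>x \<in> In T r. (2 :: nat) ^ a x)"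
    using symmetric_tree_In[OF assms] T
    by (intro sum_mono2) (auto simp: In_def is_circuit_def verts_def)
  then show ?thesis using kraft_below_vertex[OF T, of r 0 a] by simp
qed

text \<open>Hypothesis \<open>opt\<close> is applied to the delay of a competitor, which is an
  admissible \<open>D\<close> by Kraft's inequality.\<close>

lemma delay_optimum_tree_represents:
  assumes C: "is_circuit C" and t: "represents C t" "distinct_mset (vertex_mset t)"
    and opt: "\<And>D. (\<Sum>x \<in># leaf_mset t. 2 ^ a x) \<le> (2 :: nat) ^ D \<Longrightarrow> tree_delay a t \<le> D"
    and leaves: "leaf_mset t = mset_set X" "finite X"
  shows "delay_optimum_tree op a X (subcircuit C (tree_root t)) (tree_root t)"
proof -
  have "symmetric_tree op X (subcircuit C (tree_root t)) (tree_root t)"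
    using symmetric_tree_represents[OF C t, of op] leaves by simp
  moreover have "delay a (subcircuit C (tree_root t)) \<le> delay a T'" if "symmetric_tree op X T' r'" for T' r'
    using delay_subcircuit_le[OF C t, of a] opt[of "delay a T'"] kraft_symmetric_tree[OF that, of a]
    by (simp add: leaves sum_unfold_sum_mset)
  ultimately show ?thesis by (auto simp: delay_optimum_tree_def)
qed

text \<open>All numbers other than \<open>2 ^ p\<close> are multiples of \<open>2 ^ q\<close>, so rounding \<open>p\<close> up to \<open>q\<close>
  cannot exceed the power \<open>2 ^ D\<close>.\<close>

lemma kraft_merge:
  fixes p q D :: nat
  assumes "p \<le> q" "\<And>z. z \<in># R \<Longrightarrow> q \<le> z" "2 ^ p + (2 ^ q + (\<Sum>z \<in># R. 2 ^ z)) \<le> (2 :: nat) ^ D"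
  shows "2 ^ Suc q + (\<Sum>z \<in># R. 2 ^ z) \<le> (2 :: nat) ^ D"
proof -
  let ?s = "2 ^ q + (\<Sum>z \<in># R. (2 :: nat) ^ z)"
  have "(2 :: nat) ^ q dvd (\<Sum>z \<in># R. 2 ^ z)"
    using assms(2) by (induction R) (auto intro!: dvd_add le_imp_power_dvd)
  then have "2 ^ q dvd ?s" by simp
  then obtain s where s: "?s = 2 ^ q * s" by (rule dvdE)
  have "(2 :: nat) ^ q \<le> 2 ^ D" using assms(3) by linarith
  then have "q \<le> D" by simp
  then have D: "(2 :: nat) ^ D = 2 ^ q * 2 ^ (D - q)" by (simp add: power_add[symmetric])
  \<comment> \<open>Dropping the positive term \<open>2 ^ p\<close> makes the inequality strict, and
    between multiples of \<open>2 ^ q\<close> strictness leaves room for a further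
    \<open>2 ^ q\<close>.\<close>
  have "?s < 2 ^ D" using assms(3) zero_less_power[of "2 :: nat" p] by linarith
  then have "s < 2 ^ (D - q)" by (simp add: s D)
  then have "2 ^ q * Suc s \<le> 2 ^ q * 2 ^ (D - q)" by (intro mult_le_mono2) simp
  then have "2 ^ q + ?s \<le> 2 ^ D" by (simp add: s D)
  then show ?thesis by simp
qed


section \<open>The vertices of the leftist circuit\<close>

text \<open>A description of the vertices of \<open>leftist n\<close> without recursion: the aligned
  blocks of length \<open>2 ^ d\<close> below \<open>n\<close>. It reduces questions about
  successors and right descendants to divisibility.\<close>

definition dyadic :: "nat \<Rightarrow> (nat \<times> nat) set" where
  "dyadic n = {(i, d). 2 ^ d dvd i \<and> i + 2 ^ d \<le> n}"

text \<open>Applied with \<open>m\<close> the border between two halves of a tree, or between two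
  trees of the leftist circuit, it puts every aligned block on one side of the border.\<close>

lemma multiple_not_straddled:
  fixes c j m :: nat
  assumes "c dvd j" "c dvd m"
  shows "j + c \<le> m \<or> m \<le> j"
proof (rule ccontr)
  assume *: "\<not> ?thesis"
  then have "c dvd m - j" using assms by (simp add: dvd_diff_nat)
  then have "c \<le> m - j" using * by (intro dvd_imp_le) auto
  then show False using * by linarith
qed

lemma tree_gates_eq:
  assumes "2 ^ d dvd i"
  shows "tree_gates i d = {(j, e). 1 \<le> e \<and> 2 ^ e dvd j \<and> i \<le> j \<and> j + 2 ^ e \<le> i + 2 ^ d}"
  using assms
proof (induction d arbitrary: i)
  case (Suc d)
  have d1: "2 ^ d dvd i" using Suc.prems by (metis dvd_mult_right power_Suc)
  then have d2: "2 ^ d dvd i + 2 ^ d" by simp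
  have "(j, e) \<in> tree_gates i (Suc d) \<longleftrightarrow>
      1 \<le> e \<and> 2 ^ e dvd j \<and> i \<le> j \<and> j + 2 ^ e \<le> i + 2 ^ Suc d" (is "_ \<longleftrightarrow> ?r") for j e
  proof
    assume "(j, e) \<in> tree_gates i (Suc d)"
    then show ?r using Suc.prems by (auto simp: Suc.IH[OF d1] Suc.IH[OF d2])
  next
    assume r: ?r
    then have "(2 :: nat) ^ e \<le> 2 ^ Suc d" by linarith
    then have "e \<le> Suc d" by (rule power_le_imp_le_exp[rotated]) simp
    then consider "e = Suc d" | "e \<le> d" by linarith
    then show "(j, e) \<in> tree_gates i (Suc d)"
    proof cases
      case 1
      then show ?thesis using r by auto
    next
      case 2
      then have "2 ^ e dvd i + 2 ^ d" using d2 by (meson dvd_trans le_imp_power_dvd)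
      from multiple_not_straddled[OF _ this, of j] r
      have "j + 2 ^ e \<le> i + 2 ^ d \<or> i + 2 ^ d \<le> j" by blast
      then show ?thesis using r by (auto simp: Suc.IH[OF d1] Suc.IH[OF d2])
    qed
  qed
  then show ?case by auto
next
  case 0
  have False if "1 \<le> e" "i \<le> j" "j + 2 ^ e \<le> Suc i" for j e :: nat
  proof -
    have "(2 :: nat) ^ 1 \<le> 2 ^ e" using that by (intro power_increasing) auto
    then show False using that by simp
  qed
  then show ?case by auto
qed

text \<open>The hypothesis is the invariant of the recursion: \<open>i\<close> is aligned for every
  power that still fits. It survives because the exponents that fit afterwards are at most the
  maximal \<open>k\<close> just used, so their powers divide both \<open>i\<close> and
  \<open>2 ^ k\<close>.\<close>

lemma leftist_gates_eq:
  assumes "\<And>k. 2 ^ k \<le> N \<Longrightarrow> 2 ^ k dvd i"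
  shows "leftist_gates i N = {(j, e). 1 \<le> e \<and> 2 ^ e dvd j \<and> i \<le> j \<and> j + 2 ^ e \<le> i + N}"
  using assms
proof (induction i N rule: leftist_gates.induct)
  case (1 i N)
  show ?case
  proof (cases "N \<ge> 2")
    case False
    have "False" if "1 \<le> e" "i \<le> j" "j + 2 ^ e \<le> i + N" for j e
    proof -
      have "(2 :: nat) ^ 1 \<le> 2 ^ e" using that by (intro power_increasing) auto
      then show False using that False by simp
    qed
    then show ?thesis using False by (subst leftist_gates.simps) auto
  next
    case True
    define k where "k = (GREATEST k. (2 :: nat) ^ k \<le> N)"
    have bound: "j \<le> N" if "2 ^ j \<le> N" for j :: nat
      using that less_exp[of j] by linarith
    have k: "2 ^ k \<le> N"
      unfolding k_def by (rule GreatestI_nat[of _ 0 N]) (use True in simp, blast intro: bound)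
    have max: "j \<le> k" if "2 ^ j \<le> N" for j
      unfolding k_def by (rule Greatest_le_nat[of _ _ N]) (use that in simp, blast intro: bound)
    have "N < 2 ^ Suc k" using max[of "Suc k"] by (meson Suc_n_not_le_n not_le)
    have dk: "2 ^ k dvd i" using 1(2) k by blast
    have "2 ^ j dvd i + 2 ^ k" if "2 ^ j \<le> N - 2 ^ k" for j
      using 1(2)[of j] that max[of j] by (intro dvd_add le_imp_power_dvd) auto
    then have rec: "leftist_gates (i + 2 ^ k) (N - 2 ^ k) =
      {(j, e). 1 \<le> e \<and> 2 ^ e dvd j \<and> i + 2 ^ k \<le> j \<and> j + 2 ^ e \<le> i + 2 ^ k + (N - 2 ^ k)}"
      using 1(1)[OF True k_def] by simp
    have "leftist_gates i N = tree_gates i k \<union> leftist_gates (i + 2 ^ k) (N - 2 ^ k)"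
      using True by (subst leftist_gates.simps) (simp add: Let_def k_def)
    moreover have "j + 2 ^ e \<le> i + 2 ^ k \<or> i + 2 ^ k \<le> j"
      if "2 ^ e dvd j" "i \<le> j" "j + 2 ^ e \<le> i + N" for j e
    proof (rule multiple_not_straddled)
      have "e \<le> k" using that by (intro max) linarith
      then show "2 ^ e dvd i + 2 ^ k"
        using dk by (meson dvd_add dvd_trans le_imp_power_dvd)
    qed (use that in simp)
    ultimately show ?thesis
      using k by (auto simp: rec tree_gates_eq[OF dk])
  qed
qed

lemma leftist_simps:
  "inputs (leftist n) = {(i, 0) | i. i < n}"
  "gates (leftist n) = {(i, d) \<in> dyadic n. 1 \<le> d}"
  "verts (leftist n) = dyadic n"
  "lpred (leftist n) (i, Suc d) = (i, d)"
  "rpred (leftist n) (i, Suc d) = (i + 2 ^ d, d)"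
proof -
  show i: "inputs (leftist n) = {(i, 0) | i. i < n}" by (simp add: leftist_def)
  show g: "gates (leftist n) = {(i, d) \<in> dyadic n. 1 \<le> d}"
    using leftist_gates_eq[of n 0] by (auto simp: leftist_def dyadic_def)
  show "verts (leftist n) = dyadic n"
    unfolding verts_def i g
  proof (intro set_eqI, clarify)
    fix j d :: nat
    show "(j, d) \<in> {(i, 0) | i. i < n} \<union> {(i, d) \<in> dyadic n. 1 \<le> d} \<longleftrightarrow> (j, d) \<in> dyadic n"
      by (cases d) (auto simp: dyadic_def)
  qed
qed (auto simp: leftist_def)

lemma dyadic_Suc:
  assumes "(i, Suc d) \<in> dyadic n"
  shows "(i, d) \<in> dyadic n" "(i + 2 ^ d, d) \<in> dyadic n"
proof -
  have "2 ^ d dvd i" using assms by (metis (no_types, lifting) dyadic_def case_prodD dvd_mult_right mem_Collect_eq power_Suc)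
  then show "(i, d) \<in> dyadic n" "(i + 2 ^ d, d) \<in> dyadic n" using assms by (auto simp: dyadic_def)
qed

lemma finite_dyadic: "finite (dyadic n)"
proof (rule finite_subset)
  have "d \<le> n" if "i + 2 ^ d \<le> n" for i d :: nat using that less_exp[of d] by linarith
  then show "dyadic n \<subseteq> {..n} \<times> {..n}" by (auto simp: dyadic_def)
qed auto

fun block_tree :: "(nat \<times> nat \<Rightarrow> 'v) \<Rightarrow> nat \<Rightarrow> nat \<Rightarrow> 'v btree" where
  "block_tree \<nu> i 0 = Leaf (\<nu> (i, 0))"
| "block_tree \<nu> i (Suc d) = Node (block_tree \<nu> i d) (\<nu> (i, Suc d)) (block_tree \<nu> (i + 2 ^ d) d)"

lemma tree_root_block_tree [simp]: "tree_root (block_tree \<nu> i d) = \<nu> (i, d)"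
  by (cases d) auto

text \<open>\<open>maximal_block P Q (i, d)\<close>: the indices below \<open>(i, d)\<close> lie between \<open>P\<close> and \<open>Q\<close>, while those
  below a successor \<open>(i', d + 1)\<close> of \<open>(i, d)\<close> do not.\<close>

definition maximal_block :: "nat \<Rightarrow> nat \<Rightarrow> nat \<times> nat \<Rightarrow> bool" where
  "maximal_block P Q = (\<lambda>(i, d). 2 ^ d dvd i \<and> P \<le> i \<and> i + 2 ^ d \<le> Q \<and>
     (\<forall>i'. 2 ^ Suc d dvd i' \<and> (i' = i \<or> i' + 2 ^ d = i) \<longrightarrow> \<not> (P \<le> i' \<and> i' + 2 ^ Suc d \<le> Q)))"

text \<open>A multiset, so that the single equation \<open>covered es = mset_set I\<close> says that
  the blocks are disjoint and that they exhaust \<open>I\<close>.\<close>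

definition covered :: "(nat \<times> nat) list \<Rightarrow> nat multiset" where
  "covered es = (\<Sum>(i, d) \<leftarrow> es. mset_set {i..<i + 2 ^ d})"

lemma covered_simps [simp]:
  "covered [] = {#}"
  "covered ((i, d) # es) = mset_set {i..<i + 2 ^ d} + covered es"
  "covered (es @ es') = covered es + covered es'"
  by (auto simp: covered_def)

lemma size_covered: "size (covered es) = (\<Sum>e \<leftarrow> es. 2 ^ snd e)"
  by (induction es) auto

lemma covered_block: "(i, d) \<in> set es \<Longrightarrow> j \<in> {i..<i + 2 ^ d} \<Longrightarrow> j \<in># covered es"
  by (induction es) auto

lemma covered_distinct:
  assumes "distinct_mset (covered es)"
  shows "distinct es"
  using assms
proof (induction es)
  case (Cons e es)
  obtain i d where e: "e = (i, d)" by fastforce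
  have "i \<in># covered es" if "(i, d) \<in> set es"
    using covered_block[OF that, of i] by simp
  then show ?case using Cons by (auto simp: e distinct_mset_union disjoint_iff)
qed auto

text \<open>Vertices are arbitrary memory addresses, so \<open>S\<close> is given only up to an
  isomorphism \<open>\<nu>\<close>, through which its structure is read off
  \<open>dyadic n\<close>.\<close>

locale leftist_copy =
  fixes n :: nat and \<nu> :: "nat \<times> nat \<Rightarrow> 'v" and S :: "'v circuit" and x :: "nat \<Rightarrow> 'v"
  assumes iso: "circuit_iso \<nu> (leftist n) S" and x: "\<And>i. i < n \<Longrightarrow> x i = \<nu> (i, 0)"
begin

lemma inj: "inj_on \<nu> (dyadic n)"
  using iso by (simp add: circuit_iso_def leftist_simps)

lemma inj_eq: "e \<in> dyadic n \<Longrightarrow> e' \<in> dyadic n \<Longrightarrow> \<nu> e = \<nu> e' \<longleftrightarrow> e = e'"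
  using inj by (auto dest: inj_onD)

lemma gates_S: "gates S = \<nu> ` {(i, d) \<in> dyadic n. 1 \<le> d}"
  using iso by (simp add: circuit_iso_def leftist_simps)

lemma inputs_S: "inputs S = x ` {0..<n}"
  using iso by (force simp: circuit_iso_def leftist_simps x)

lemma verts_S: "verts S = \<nu> ` dyadic n"
proof -
  have "verts S = \<nu> ` verts (leftist n)" using iso by (auto simp: verts_def circuit_iso_def)
  then show ?thesis by (simp add: leftist_simps)
qed

lemma preds_S:
  assumes "(i, Suc d) \<in> dyadic n"
  shows "lpred S (\<nu> (i, Suc d)) = \<nu> (i, d)" "rpred S (\<nu> (i, Suc d)) = \<nu> (i + 2 ^ d, d)"
  using iso assms by (auto simp: circuit_iso_def leftist_simps)

lemma dyadic_input: "i < n \<Longrightarrow> (i, 0) \<in> dyadic n"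
  by (simp add: dyadic_def)

lemma x_inj: "inj_on x {0..<n}"
  by (rule inj_onI) (auto simp: x inj_eq dyadic_input)

lemma disj_S: "inputs S \<inter> gates S = {}"
  by (auto simp: inputs_S gates_S x inj_eq dyadic_input)

lemma gateE:
  assumes "v \<in> gates S"
  obtains i d where "v = \<nu> (i, Suc d)" "(i, Suc d) \<in> dyadic n"
  using assms by (auto simp: gates_S dest!: Suc_le_D)

lemma edgeE:
  assumes "(u, v) \<in> edges S"
  obtains i d j where "v = \<nu> (i, Suc d)" "(i, Suc d) \<in> dyadic n" "u = \<nu> (j, d)" "(j, d) \<in> dyadic n"
    "j = i \<or> j = i + 2 ^ d"
proof -
  have v: "v \<in> gates S" and u: "u = lpred S v \<or> u = rpred S v" using assms by (auto simp: edges_def)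
  obtain i d where i: "v = \<nu> (i, Suc d)" "(i, Suc d) \<in> dyadic n" using v by (rule gateE)
  then show thesis using u that preds_S dyadic_Suc by metis
qed

text \<open>Every edge raises it by exactly one; hence it proves acyclicity and also computes
  depths.\<close>

definition rank :: "'v \<Rightarrow> nat" where
  "rank v = snd (inv_into (dyadic n) \<nu> v)"

lemma rank: "(i, d) \<in> dyadic n \<Longrightarrow> rank (\<nu> (i, d)) = d"
  by (simp add: rank_def inv_into_f_f[OF inj])

lemma rank_edge: "(u, v) \<in> edges S \<Longrightarrow> rank v = Suc (rank u)"
  by (erule edgeE) (simp add: rank)

lemma rank_input: "u \<in> inputs S \<Longrightarrow> rank u = 0"
  by (auto simp: inputs_S x rank dyadic_input)

lemma is_circuit_S: "is_circuit S"
proof -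
  have "lpred S v \<in> verts S \<and> rpred S v \<in> verts S \<and> lpred S v \<noteq> rpred S v" if "v \<in> gates S" for v
    using that
  proof (rule gateE)
    fix i d assume v: "v = \<nu> (i, Suc d)" "(i, Suc d) \<in> dyadic n"
    then show ?thesis using dyadic_Suc[OF v(2)] by (simp add: preds_S verts_S inj_eq)
  qed
  moreover have "acyclic (edges S)" by (rule acyclic_rank[of _ rank]) (simp add: rank_edge)
  moreover have "finite (verts S)" using finite_dyadic by (simp add: verts_S)
  ultimately show ?thesis using disj_S by (simp add: is_circuit_def)
qed

lemma represents_block_tree: "(i, d) \<in> dyadic n \<Longrightarrow> represents S (block_tree \<nu> i d)"
proof (induction d arbitrary: i)
  case 0
  then show ?case by (auto simp: inputs_S dyadic_def image_iff x intro!: bexI[of _ i])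
next
  case (Suc d)
  then have "\<nu> (i, Suc d) \<in> gates S" by (auto simp: gates_S)
  then show ?case using Suc dyadic_Suc[OF Suc.prems] by (simp add: preds_S)
qed

lemma leaf_mset_block_tree:
  "i + 2 ^ d \<le> n \<Longrightarrow> leaf_mset (block_tree \<nu> i d) = image_mset x (mset_set {i..<i + 2 ^ d})"
proof (induction d arbitrary: i)
  case (Suc d)
  have "{i..<i + 2 ^ Suc d} = {i..<i + 2 ^ d} \<union> {i + 2 ^ d..<i + 2 ^ d + 2 ^ d}" by auto
  then have "mset_set {i..<i + 2 ^ Suc d} =
    mset_set {i..<i + 2 ^ d} + mset_set {i + 2 ^ d..<i + 2 ^ d + 2 ^ d}"
    by (simp add: mset_set_Union)
  then show ?case using Suc.IH[of i] Suc.IH[of "i + 2 ^ d"] Suc.prems by simp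
qed (auto simp: x)

lemma vertices_block_tree:
  assumes "(i, d) \<in> dyadic n" "v \<in># vertex_mset (block_tree \<nu> i d)"
  shows "\<exists>j e. v = \<nu> (j, e) \<and> (j, e) \<in> dyadic n \<and> i \<le> j \<and> j + 2 ^ e \<le> i + 2 ^ d \<and> e \<le> d"
  using assms
proof (induction d arbitrary: i)
  case (Suc d)
  consider "v = \<nu> (i, Suc d)" | "v \<in># vertex_mset (block_tree \<nu> i d)"
    | "v \<in># vertex_mset (block_tree \<nu> (i + 2 ^ d) d)"
    using Suc.prems(2) by auto
  then show ?case
  proof cases
    case 1
    then show ?thesis using Suc.prems(1) by blast
  next
    case 2
    then show ?thesis using Suc.IH[OF dyadic_Suc(1)[OF Suc.prems(1)]] by fastforce
  next
    case 3
    then show ?thesis using Suc.IH[OF dyadic_Suc(2)[OF Suc.prems(1)]] by fastforce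
  qed
qed auto

lemma vertex_mset_block_tree_disjoint:
  assumes "(i, d) \<in> dyadic n" "(j, e) \<in> dyadic n" "i + 2 ^ d \<le> j"
  shows "set_mset (vertex_mset (block_tree \<nu> i d)) \<inter> set_mset (vertex_mset (block_tree \<nu> j e)) = {}"
proof -
  have False if v: "v \<in># vertex_mset (block_tree \<nu> i d)" "v \<in># vertex_mset (block_tree \<nu> j e)" for v
  proof -
    obtain i1 d1 where 1: "v = \<nu> (i1, d1)" "(i1, d1) \<in> dyadic n" "i1 + 2 ^ d1 \<le> i + 2 ^ d"
      using vertices_block_tree[OF assms(1) v(1)] by auto
    obtain j1 e1 where 2: "v = \<nu> (j1, e1)" "(j1, e1) \<in> dyadic n" "j \<le> j1"
      using vertices_block_tree[OF assms(2) v(2)] by auto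
    have "i1 = j1" using 1 2 by (simp add: inj_eq)
    then have "i1 + 2 ^ d1 \<le> i1" using 1(3) 2(3) assms(3) by linarith
    then show False by simp
  qed
  then show ?thesis by blast
qed

lemma distinct_vertex_mset_block_tree:
  "(i, d) \<in> dyadic n \<Longrightarrow> distinct_mset (vertex_mset (block_tree \<nu> i d))"
proof (induction d arbitrary: i)
  case 0
  then show ?case by (simp add: distinct_mset_def)
next
  case (Suc d)
  note s = dyadic_Suc[OF Suc.prems]
  have "\<nu> (i, Suc d) \<notin># vertex_mset (block_tree \<nu> j d)" if "(j, d) \<in> dyadic n" for j
    using vertices_block_tree[OF that, of "\<nu> (i, Suc d)"] Suc.prems by (auto simp: inj_eq)
  then show ?case
    using s Suc.IH vertex_mset_block_tree_disjoint[OF s] by (simp add: distinct_mset_add_mset distinct_mset_union)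
qed

lemma distinct_vertex_mset_blocks:
  assumes "set es \<subseteq> dyadic n" "distinct_mset (covered es)"
  shows "distinct_mset (\<Sum>(i, d) \<leftarrow> es. vertex_mset (block_tree \<nu> i d))"
  using assms
proof (induction es)
  case Nil
  then show ?case by (simp add: distinct_mset_def)
next
  case (Cons e es)
  obtain i d where e: "e = (i, d)" by fastforce
  have "set_mset (vertex_mset (block_tree \<nu> i d)) \<inter> set_mset (vertex_mset (block_tree \<nu> j c)) = {}"
    if jc: "(j, c) \<in> set es" for j c
  proof -
    have *: "{i..<i + 2 ^ d} \<inter> {j..<j + 2 ^ c} = {}"
      using covered_block[OF jc] Cons.prems by (fastforce simp: e distinct_mset_union)
    have "i + 2 ^ d \<le> j \<or> j + 2 ^ c \<le> i"
    proof (rule ccontr)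
      assume "\<not> (i + 2 ^ d \<le> j \<or> j + 2 ^ c \<le> i)"
      \<comment> \<open>If neither block lies entirely to the left of the other, the later of the
        two starts belongs to both.\<close>
      then have "max i j \<in> {i..<i + 2 ^ d} \<inter> {j..<j + 2 ^ c}" by auto
      then show False using * by blast
    qed
    moreover have "(i, d) \<in> dyadic n" "(j, c) \<in> dyadic n" using Cons.prems jc by (auto simp: e)
    ultimately show ?thesis
      using vertex_mset_block_tree_disjoint[of i d j c] vertex_mset_block_tree_disjoint[of j c i d] by blast
  qed
  then have "set_mset (vertex_mset (block_tree \<nu> i d)) \<inter>
    set_mset (\<Sum>(i, d) \<leftarrow> es. vertex_mset (block_tree \<nu> i d)) = {}"
    by (induction es) (auto simp: disjoint_iff)
  then show ?case
    using Cons distinct_vertex_mset_block_tree by (auto simp: e distinct_mset_union)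
qed

lemma In_S:
  assumes "(i, d) \<in> dyadic n"
  shows "In S (\<nu> (i, d)) = x ` {i..<i + 2 ^ d}"
  using In_represents[OF represents_block_tree[OF assms] disj_S distinct_vertex_mset_block_tree[OF assms]]
    assms by (simp add: leaf_mset_block_tree dyadic_def)

lemma path_rank: "(u, v) \<in> edges S ^^ k \<Longrightarrow> rank v = rank u + k"
  by (induction k arbitrary: v) (auto simp: rank_edge)

text \<open>All walks from an input to \<open>v\<close> have length \<open>rank v\<close>, so the
  set under \<open>Max\<close> is a singleton. Stated for subgraphs to serve \<open>S\<close> and
  its subcircuits alike.\<close>

lemma depth_eq_rank:
  assumes "edges C \<subseteq> edges S" "inputs C \<subseteq> inputs S" "u \<in> inputs C" "(u, v) \<in> (edges C)\<^sup>*"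
  shows "depth C v = rank v"
proof -
  have len: "k = rank v" if "y \<in> inputs C" "(y, v) \<in> edges C ^^ k" for y k
  proof -
    have "(y, w) \<in> edges C ^^ j \<Longrightarrow> (y, w) \<in> edges S ^^ j" for j w
      by (induction j arbitrary: w) (use assms(1) in auto)
    then show ?thesis using that path_rank[of y v k] rank_input[of y] assms(2) by auto
  qed
  obtain k where "(u, v) \<in> edges C ^^ k" using assms(4) rtrancl_imp_relpow by blast
  then have "{k. \<exists>y \<in> inputs C. (y, v) \<in> edges C ^^ k} = {rank v}"
    using len assms(3) by blast
  then show ?thesis by (simp add: depth_def)
qed

lemma reach_block:
  assumes "(i, d) \<in> dyadic n"
  shows "x i \<in> inputs S" "(x i, \<nu> (i, d)) \<in> (edges S)\<^sup>*"
proof -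
  have "x i \<in> In S (\<nu> (i, d))" using assms by (simp add: In_S)
  then show "x i \<in> inputs S" "(x i, \<nu> (i, d)) \<in> (edges S)\<^sup>*" by (auto simp: In_def)
qed

lemma depth_S: "(i, d) \<in> dyadic n \<Longrightarrow> depth S (\<nu> (i, d)) = d"
  using depth_eq_rank[of S] reach_block[of i d] rank[of i d] by simp

lemma depth_subcircuit_S:
  assumes "(i, d) \<in> dyadic n"
  defines "b \<equiv> \<nu> (i, d)"
  shows "depth (subcircuit S b) b = d"
proof -
  let ?C = "subcircuit S b"
  have sub: "edges ?C \<subseteq> edges S" "inputs ?C \<subseteq> inputs S" by (auto simp: edges_def subcircuit_def)
  have "(u, b) \<in> (edges ?C)\<^sup>*" if "(u, b) \<in> (edges S)\<^sup>*" for u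
    using that
  proof (induction rule: converse_rtrancl_induct)
    case (step y z)
    then have "(y, z) \<in> edges ?C" by (auto simp: edges_def subcircuit_def)
    then show ?case using step by (simp add: converse_rtrancl_into_rtrancl)
  qed simp
  moreover have "x i \<in> inputs ?C" using reach_block[OF assms(1)] by (simp add: subcircuit_def b_def)
  ultimately show ?thesis
    using depth_eq_rank[OF sub] reach_block[OF assms(1)] rank[OF assms(1)] by (auto simp: b_def)
qed

section \<open>Right descendants and boundary vertices in terms of dyadic blocks\<close>

lemma right_step_S:
  assumes "(i, d) \<in> dyadic n"
  shows "(\<nu> (i, d), v) \<in> right_step S \<longleftrightarrow> (i, Suc d) \<in> dyadic n \<and> v = \<nu> (i, Suc d)"
proof
  assume "(\<nu> (i, d), v) \<in> right_step S"
  then have v: "v \<in> gates S" "lpred S v = \<nu> (i, d)" by (auto simp: right_step_def)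
  from v(1) show "(i, Suc d) \<in> dyadic n \<and> v = \<nu> (i, Suc d)"
  proof (rule gateE)
    fix j c assume j: "v = \<nu> (j, Suc c)" "(j, Suc c) \<in> dyadic n"
    then have "\<nu> (j, c) = \<nu> (i, d)" using v(2) preds_S by simp
    then have "j = i \<and> c = d" using inj_eq[OF dyadic_Suc(1)[OF j(2)] assms] by simp
    then show ?thesis using j by simp
  qed
next
  assume "(i, Suc d) \<in> dyadic n \<and> v = \<nu> (i, Suc d)"
  then show "(\<nu> (i, d), v) \<in> right_step S" by (auto simp: right_step_def gates_S preds_S)
qed

lemma right_descendant:
  "(i, d) \<in> dyadic n \<Longrightarrow> (x i, \<nu> (i, d)) \<in> right_step S ^^ d"
proof (induction d)
  case 0
  then show ?case by (simp add: x dyadic_def)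
next
  case (Suc d)
  then show ?case using right_step_S dyadic_Suc by auto
qed

lemma right_descendants:
  assumes "i < n"
  shows "(x i, v) \<in> (right_step S)\<^sup>* \<longleftrightarrow> (\<exists>d. v = \<nu> (i, d) \<and> (i, d) \<in> dyadic n)"
proof
  assume "(x i, v) \<in> (right_step S)\<^sup>*"
  then show "\<exists>d. v = \<nu> (i, d) \<and> (i, d) \<in> dyadic n"
  proof (induction rule: rtrancl_induct)
    case base
    then show ?case using assms x dyadic_input by blast
  next
    case (step y z)
    then show ?case using right_step_S by blast
  qed
qed (use right_descendant relpow_imp_rtrancl in blast)

lemma less_max_right_depth:
  assumes "i < n"
  shows "d < max_right_depth S (x i) \<longleftrightarrow> (\<exists>e > d. (i, e) \<in> dyadic n)"
proof -
  have "{depth S v | v. (x i, v) \<in> (right_step S)\<^sup>*} = {d. (i, d) \<in> dyadic n}" (is "?A = _")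
    using depth_S by (auto simp: right_descendants[OF assms]) metis
  moreover have "finite {d. (i, d) \<in> dyadic n}"
    by (rule finite_subset[of _ "snd ` dyadic n"]) (use finite_dyadic in force)+
  moreover have "0 \<in> {d. (i, d) \<in> dyadic n}" using dyadic_input[OF assms] by simp
  ultimately show ?thesis
    unfolding max_right_depth_def by (subst Max_gr_iff) auto
qed

text \<open>The divisibility test available to the machine. A right descendant of depth above
  \<open>d\<close> forces the alignment; conversely, the assumption makes the aligned block of depth
  \<open>Suc d\<close> fit below \<open>n\<close>, so it is a vertex.\<close>

lemma less_max_right_depth_dvd:
  assumes "i + 2 ^ Suc d \<le> n"
  shows "d < max_right_depth S (x i) \<longleftrightarrow> 2 ^ Suc d dvd i"
proof -
  have "i < n" using assms less_exp[of "Suc d"] by linarith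
  moreover have "2 ^ Suc d dvd i" if "d < e" "(i, e) \<in> dyadic n" for e
    using that le_imp_power_dvd[of "Suc d" e "2 :: nat"] dvd_trans by (auto simp: dyadic_def)
  moreover have "(i, Suc d) \<in> dyadic n" if "2 ^ Suc d dvd i"
    using that assms by (simp add: dyadic_def)
  ultimately show ?thesis by (auto simp: less_max_right_depth)
qed

text \<open>The indices below a successor are contiguous, and nonempty intervals are separated by a
  gap. A successor inside \<open>K\<close> would therefore stay within the interval that contains
  the block, contradicting maximality there.\<close>

lemma maximal_block_boundary:
  assumes K: "K = x ` ({P..<Q} \<union> {P'..<Q'})" "Q \<le> n" "Q' \<le> n" "Q < P' \<or> P' = Q'"
    and e: "maximal_block P Q e \<or> maximal_block P' Q' e"
  shows "e \<in> dyadic n" "\<nu> e \<in> boundary K S"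
proof -
  obtain i d where id: "e = (i, d)" by fastforce
  have md: "2 ^ d dvd i" "P \<le> i \<and> i + 2 ^ d \<le> Q \<or> P' \<le> i \<and> i + 2 ^ d \<le> Q'"
    using e unfolding maximal_block_def id by blast+
  show dy: "e \<in> dyadic n" using md K(2,3) by (auto simp: dyadic_def id)
  have "{i..<i + 2 ^ d} \<subseteq> {P..<Q} \<union> {P'..<Q'}" using md(2) by auto
  then have "x ` {i..<i + 2 ^ d} \<subseteq> K" unfolding K(1) by blast
  moreover have "\<not> In S w \<subseteq> K" if "(\<nu> e, w) \<in> edges S" for w
    using that
  proof (rule edgeE)
    fix i' d' j
    assume w: "w = \<nu> (i', Suc d')" "(i', Suc d') \<in> dyadic n" "\<nu> e = \<nu> (j, d')" "(j, d') \<in> dyadic n"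
      "j = i' \<or> j = i' + 2 ^ d'"
    then have j: "j = i" "d' = d" using inj_eq[OF dy, of "(j, d')"] by (auto simp: id)
    have dv: "2 ^ Suc d dvd i'" and n': "i' + 2 ^ Suc d \<le> n" using w(2) j by (auto simp: dyadic_def)
    have i: "i' \<le> i" "i < i' + 2 ^ Suc d" "i' = i \<or> i' + 2 ^ d = i" using w(5) j by auto
    show ?thesis
    proof
      assume "In S w \<subseteq> K"
      then have "x ` {i'..<i' + 2 ^ Suc d} \<subseteq> x ` ({P..<Q} \<union> {P'..<Q'})"
        using w(1,2) j by (simp add: In_S K(1))
      moreover have "{i'..<i' + 2 ^ Suc d} \<subseteq> {0..<n}" "{P..<Q} \<union> {P'..<Q'} \<subseteq> {0..<n}"
        using n' K(2,3) by auto
      ultimately have sub: "{i'..<i' + 2 ^ Suc d} \<subseteq> {P..<Q} \<union> {P'..<Q'}"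
        using inj_on_image_mem_iff[OF x_inj] by blast
      define u where "u = i' + 2 ^ Suc d"
      have u: "i' < u" "i < u" using i by (auto simp: u_def)
      have inner: "k \<in> {P..<Q} \<union> {P'..<Q'}" if "i' \<le> k" "k < u" for k
        using that unfolding u_def by (intro subsetD[OF sub]) simp
      have ends: "i' \<in> {P..<Q} \<union> {P'..<Q'}" "u - 1 \<in> {P..<Q} \<union> {P'..<Q'}"
        using u by (intro inner; linarith)+
      from e show False
      proof
        assume m: "maximal_block P Q e"
        then have "P \<le> i" "i + 2 ^ d \<le> Q" by (simp_all add: maximal_block_def id)
        then have iPQ: "P \<le> i" "i < Q" using less_le_trans[of i "i + 2 ^ d" Q] by simp_all
        \<comment> \<open>Index \<open>Q\<close> belongs to neither interval, so a run of indices of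
          \<open>K\<close> that contains \<open>i < Q\<close> has to stop before it.\<close>
        have "u \<le> Q" using inner[of Q] i(1) iPQ K(4) by (cases "u \<le> Q") auto
        moreover have "P \<le> i'" using ends(1) i(1) iPQ K(4) by auto
        ultimately show False using m dv i(3) by (auto simp: maximal_block_def id u_def)
      next
        assume m: "maximal_block P' Q' e"
        then have "P' \<le> i" "i + 2 ^ d \<le> Q'" by (simp_all add: maximal_block_def id)
        then have iPQ: "P' \<le> i" "i < Q'" using less_le_trans[of i "i + 2 ^ d" Q'] by simp_all
        then have gap: "Q < P'" using K(4) by auto
        have "u \<le> Q'" using ends(2) u iPQ gap by auto
        moreover have "P' \<le> i'"
        proof (rule ccontr)
          assume "\<not> P' \<le> i'"
          \<comment> \<open>The index \<open>P' - 1\<close> lies in the gap.\<close>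
          then have "P' - 1 \<in> {P..<Q} \<union> {P'..<Q'}" using u(2) iPQ by (intro inner) linarith+
          then show False using gap by auto
        qed
        ultimately show False using m dv i(3) by (auto simp: maximal_block_def id u_def)
      qed
    qed
  qed
  ultimately show "\<nu> e \<in> boundary K S"
    using dy by (auto simp: boundary_def verts_S In_S id)
qed

text \<open>The increasing and the decreasing part of the boundary tree sequence contain at most one
  tree of each depth.\<close>

lemma triangular_depth:
  assumes tri: "triangular S n x K" and "distinct [e1, e2, e3]"
    and e: "\<And>e. e \<in> {e1, e2, e3} \<Longrightarrow> e \<in> dyadic n \<and> \<nu> e \<in> boundary K S \<and> snd e = d"
  shows False
proof -
  have "K \<noteq> {}"
  proof
    assume "K = {}"
    moreover have "In S (\<nu> e1) \<subseteq> K" "e1 \<in> dyadic n" using e by (auto simp: boundary_def)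
    ultimately show False by (cases e1) (auto simp: In_S)
  qed
  then obtain bs Ts J where b: "set bs = boundary K S" "Ts = map (subcircuit S) bs" "J < length Ts"
    and up: "\<And>j. j < J \<Longrightarrow> depth (Ts ! j) (bs ! j) < depth (Ts ! (j + 1)) (bs ! (j + 1))"
    and down: "\<And>j. J + 1 \<le> j \<Longrightarrow> j + 1 < length Ts \<Longrightarrow>
      depth (Ts ! j) (bs ! j) > depth (Ts ! (j + 1)) (bs ! (j + 1))"
    using tri unfolding triangular_def boundary_tree_sequence_def by blast
  define f where "f j = depth (Ts ! j) (bs ! j)" for j
  have mono: "j < j' \<Longrightarrow> j' \<le> J \<Longrightarrow> f j < f j'" for j j'
  proof (induction j')
    case (Suc j')
    then have "f j' < f (Suc j')" using up[of j'] by (simp add: f_def)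
    then show ?case using Suc by (cases "j = j'") auto
  qed auto
  have anti: "j < j' \<Longrightarrow> J + 1 \<le> j \<Longrightarrow> j' < length Ts \<Longrightarrow> f j > f j'" for j j'
  proof (induction j')
    case (Suc j')
    then have "f j' > f (Suc j')" using down[of j'] by (simp add: f_def)
    then show ?case using Suc by (cases "j = j'") auto
  qed auto
  have ex: "\<exists>j < length Ts. bs ! j = \<nu> e' \<and> f j = d" if e': "e' \<in> {e1, e2, e3}" for e'
  proof -
    obtain j where "j < length bs" "bs ! j = \<nu> e'"
      using e[OF e'] b(1) by (metis in_set_conv_nth)
    then show ?thesis using e[OF e'] b(2) depth_subcircuit_S[of "fst e'" "snd e'"]
      by (auto simp: f_def intro!: exI[of _ j])
  qed
  obtain j1 where 1: "j1 < length Ts" "bs ! j1 = \<nu> e1" "f j1 = d" using ex[of e1] by auto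
  obtain j2 where 2: "j2 < length Ts" "bs ! j2 = \<nu> e2" "f j2 = d" using ex[of e2] by auto
  obtain j3 where 3: "j3 < length Ts" "bs ! j3 = \<nu> e3" "f j3 = d" using ex[of e3] by auto
  have "\<nu> e1 \<noteq> \<nu> e2" "\<nu> e1 \<noteq> \<nu> e3" "\<nu> e2 \<noteq> \<nu> e3"
    using assms(2) e by (auto simp: inj_eq)
  then have ne: "j1 \<noteq> j2" "j1 \<noteq> j3" "j2 \<noteq> j3" using 1 2 3 by auto
  \<comment> \<open>Of three positions, two lie on the same side of \<open>J\<close>, where the
    depths are strictly monotone.\<close>
  have "\<not> (j \<noteq> j' \<and> (j \<le> J \<longleftrightarrow> j' \<le> J) \<and> f j = f j')" if "j < length Ts" "j' < length Ts" for j j'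
    using mono[of j j'] mono[of j' j] anti[of j j'] anti[of j' j] that by linarith
  then show False using 1 2 3 ne by metis
qed

end

section \<open>The number of boundary trees\<close>

text \<open>With \<open>g m\<close> for the sum, \<open>g (m + 2) = 2 + 2 * g m\<close>: the right
  side grows by more than the factor 4 by which the left side grows. The base cases are
  \<open>16 \<le> 4\<^sup>2\<close> and \<open>32 \<le> 6\<^sup>2\<close>; for \<open>m = 2\<close>
  the claim would fail.\<close>

lemma pairs_of_powers_bound:
  assumes "m \<ge> 3"
  shows "2 ^ (m + 1) \<le> (\<Sum>i < m. (2 :: nat) ^ (i div 2))\<^sup>2"
  using assms
proof (induction m rule: less_induct)
  case (less m)
  let ?g = "\<lambda>m. \<Sum>i < m. (2 :: nat) ^ (i div 2)"
  have "{..<3 :: nat} = {0, 1, 2}" "{..<4 :: nat} = {0, 1, 2, 3}" by auto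
  then have small: "?g 3 = 4" "?g 4 = 6" by simp_all
  consider "m = 3" | "m = 4" | m' where "m = Suc (Suc m')" "m' \<ge> 3"
    using less.prems that(3)[of "m - 2"] by fastforce
  then show ?case
  proof cases
    case 3
    have shift: "?g (Suc (Suc m')) = 2 + 2 * ?g m'" for m'
      unfolding sum.lessThan_Suc_shift by (simp add: sum_distrib_left)
    have "2 ^ (m' + 1) \<le> (?g m')\<^sup>2" using less.IH 3 by simp
    then have "2 ^ (m + 1) \<le> (2 * ?g m')\<^sup>2" using 3 by (simp add: power2_eq_square)
    also have "\<dots> \<le> (?g m)\<^sup>2" using 3 shift by (intro power_mono) auto
    finally show ?thesis .
  qed (simp_all only: small, simp_all)
qed

text \<open>Since no depth occurs three times, the \<open>i\<close>-th smallest one is at least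
  \<open>i div 2\<close>, and the sum is bounded below by the one of
  \<open>pairs_of_powers_bound\<close>.\<close>

lemma number_of_blocks_bound:
  assumes "sorted ds" and rep: "\<And>i. i + 2 < length ds \<Longrightarrow> ds ! i < ds ! (i + 2)"
    and k: "(\<Sum>d \<leftarrow> ds. 2 ^ d) = (k :: nat)" "k \<ge> 3"
  shows "2 ^ (length ds + 1) \<le> k\<^sup>2"
proof (cases "length ds \<ge> 3")
  case True
  have "i < length ds \<Longrightarrow> i div 2 \<le> ds ! i" for i
  proof (induction i rule: less_induct)
    case (less i)
    show ?case
    proof (cases "i < 2")
      case False
      then obtain j where "i = j + 2" by (metis add.commute le_Suc_ex not_less)
      then show ?thesis using less.IH[of j] less.prems rep[of j] by simp
    qed auto
  qed
  then have "(\<Sum>i < length ds. (2 :: nat) ^ (i div 2)) \<le> (\<Sum>i < length ds. 2 ^ (ds ! i))"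
    by (intro sum_mono power_increasing) auto
  also have "\<dots> = k" using k(1) by (simp add: sum_list_sum_nth atLeast0LessThan)
  finally have "(\<Sum>i < length ds. (2 :: nat) ^ (i div 2))\<^sup>2 \<le> k\<^sup>2" by (rule power_mono) simp
  then show ?thesis using pairs_of_powers_bound[OF True] by linarith
next
  case False
  \<comment> \<open>With at most two trees, \<open>8 \<le> 9\<close> is enough; this is where
    \<open>k \<ge> 3\<close> enters.\<close>
  then have "(2 :: nat) ^ (length ds + 1) \<le> 2 ^ 3" by (intro power_increasing) auto
  also have "\<dots> \<le> 3\<^sup>2" by simp
  also have "\<dots> \<le> k\<^sup>2" using k(2) by (intro power_mono) auto
  finally show ?thesis .
qed


section \<open>Execution of programs\<close>

text \<open>On loops, \<open>run\<close> and \<open>com_cost\<close> have junk values.\<close>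

fun loop_free :: "com \<Rightarrow> bool" where
  "loop_free (Seq P Q) \<longleftrightarrow> loop_free P \<and> loop_free Q"
| "loop_free (Cond b P Q) \<longleftrightarrow> loop_free P \<and> loop_free Q"
| "loop_free (While b P) \<longleftrightarrow> False"
| "loop_free _ \<longleftrightarrow> True"

fun run :: "com \<Rightarrow> state \<Rightarrow> state" where
  "run (Assign y e) s = s\<lparr>var := (var s)(y := aval e s)\<rparr>"
| "run (Store A e f) s = s\<lparr>arr := (arr s)(A := (arr s A)(aval e s := aval f s))\<rparr>"
| "run (Seq P Q) s = run Q (run P s)"
| "run (Cond b P Q) s = (if bval b s then run P s else run Q s)"
| "run _ s = s"

fun com_cost :: "com \<Rightarrow> nat" where
  "com_cost Skip = 1"
| "com_cost (Assign y e) = acost e + 1"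
| "com_cost (Store A e f) = acost e + acost f + 1"
| "com_cost (Seq P Q) = com_cost P + com_cost Q"
| "com_cost (Cond b P Q) = bcost b + com_cost P + com_cost Q"
| "com_cost (While b P) = 0"

text \<open>Only an upper bound on the time: \<open>com_cost\<close> adds up both branches of a
  \<open>Cond\<close> in order to be independent of the state.\<close>

lemma exec_loop_free: "loop_free P \<Longrightarrow> \<exists>t \<le> com_cost P. exec P s t (run P s)"
proof (induction P arbitrary: s)
  case (Seq P Q)
  obtain t where t: "t \<le> com_cost P" "exec P s t (run P s)" using Seq by force
  obtain u where u: "u \<le> com_cost Q" "exec Q (run P s) u (run Q (run P s))" using Seq by force
  have "exec (Seq P Q) s (t + u) (run Q (run P s))" using t u by (blast intro: exec.Seq)
  then show ?case using t u by (auto intro: exI[of _ "t + u"])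
next
  case (Cond b P Q)
  show ?case
  proof (cases "bval b s")
    case True
    obtain t where t: "t \<le> com_cost P" "exec P s t (run P s)" using Cond by force
    then have "exec (Cond b P Q) s (bcost b + t) (run P s)" using True by (blast intro: exec.CondTrue)
    then show ?thesis using t True by (auto intro: exI[of _ "bcost b + t"])
  next
    case False
    obtain t where t: "t \<le> com_cost Q" "exec Q s t (run Q s)" using Cond by force
    then have "exec (Cond b P Q) s (bcost b + t) (run Q s)" using False by (blast intro: exec.CondFalse)
    then show ?thesis using t False by (auto intro: exI[of _ "bcost b + t"])
  qed
next
  case Skip
  have "exec Skip s (com_cost Skip) (run Skip s)" using exec.Skip[of s] by simp
  then show ?case by blast
next
  case (Assign y e)
  have "exec (Assign y e) s (com_cost (Assign y e)) (run (Assign y e) s)"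
    using exec.Assign[of y e s] by simp
  then show ?case by blast
next
  case (Store A e f)
  have "exec (Store A e f) s (com_cost (Store A e f)) (run (Store A e f) s)"
    using exec.Store[of A e f s] by simp
  then show ?case by blast
qed auto

text \<open>The measure bounds the number of iterations; the last summand \<open>bcost b\<close>
  pays for the test that ends the loop.\<close>

lemma exec_While:
  fixes \<mu> :: "state \<Rightarrow> nat"
  assumes "loop_free P" "I s"
    and step: "\<And>s. I s \<Longrightarrow> bval b s \<Longrightarrow> I (run P s) \<and> \<mu> (run P s) < \<mu> s"
  shows "\<exists>t s'. exec (While b P) s t s' \<and> I s' \<and> \<not> bval b s' \<and>
    t \<le> \<mu> s * (com_cost P + bcost b) + bcost b"
  using assms(2)
proof (induction "\<mu> s" arbitrary: s rule: less_induct)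
  case less
  show ?case
  proof (cases "bval b s")
    case False
    then show ?thesis using less.prems exec.WhileFalse[OF False, of P] by force
  next
    case True
    note st = step[OF less.prems True]
    obtain t where t: "t \<le> com_cost P" "exec P s t (run P s)"
      using exec_loop_free[OF assms(1)] by blast
    obtain u s' where u: "exec (While b P) (run P s) u s'" "I s'" "\<not> bval b s'"
      "u \<le> \<mu> (run P s) * (com_cost P + bcost b) + bcost b"
      using less.hyps[of "run P s"] st by blast
    have "Suc (\<mu> (run P s)) * (com_cost P + bcost b) \<le> \<mu> s * (com_cost P + bcost b)"
      using st by (intro mult_le_mono1) simp
    then have "bcost b + t + u \<le> \<mu> s * (com_cost P + bcost b) + bcost b"
      using t u(4) by simp
    then show ?thesis using exec.WhileTrue[OF True t(2) u(1)] u(2,3) by blast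
  qed
qed

abbreviation Le :: "aexp \<Rightarrow> aexp \<Rightarrow> bexp" where
  "Le e f \<equiv> BNot (Less f e)"

abbreviation BOr :: "bexp \<Rightarrow> bexp \<Rightarrow> bexp" where
  "BOr b c \<equiv> BNot (BAnd (BNot b) (BNot c))"


section \<open>Scanning an interval level by level\<close>

text \<open>The part \<open>[p, q)\<close> of \<open>[P, Q)\<close> that remains before, respectively in the middle of, the
  treatment of depth \<open>d\<close>. The predicates say nothing about an empty remainder.\<close>

definition remainder :: "nat \<Rightarrow> nat \<Rightarrow> nat \<Rightarrow> nat \<Rightarrow> nat \<Rightarrow> bool" where
  "remainder d P Q p q \<longleftrightarrow> P \<le> p \<and> p \<le> q \<and> q \<le> Q \<and>
     (p < q \<longrightarrow> 2 ^ d dvd p \<and> 2 ^ d dvd q \<and> p < P + 2 ^ d \<and> Q < q + 2 ^ d)"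

definition half_remainder :: "nat \<Rightarrow> nat \<Rightarrow> nat \<Rightarrow> nat \<Rightarrow> nat \<Rightarrow> bool" where
  "half_remainder d P Q p q \<longleftrightarrow> P \<le> p \<and> p \<le> q \<and> q \<le> Q \<and>
     (p < q \<longrightarrow> 2 ^ Suc d dvd p \<and> 2 ^ d dvd q \<and> p < P + 2 ^ Suc d \<and> Q < q + 2 ^ d)"

lemma multiples_gap:
  fixes c p q :: nat
  assumes "c dvd p" "c dvd q" "p < q"
  shows "p + c \<le> q"
  using multiple_not_straddled[OF assms(1,2)] assms(3) by simp

lemma dvd_add_half:
  fixes p :: nat
  assumes "2 ^ d dvd p" "\<not> 2 ^ Suc d dvd p"
  shows "2 ^ Suc d dvd p + 2 ^ d"
proof -
  obtain b where b: "p = 2 ^ d * b" using assms(1) by (rule dvdE)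
  then have "odd b" using assms(2) by (auto elim!: evenE)
  then have "even (Suc b)" by simp
  then obtain c where c: "Suc b = 2 * c" by (rule evenE)
  have "p + 2 ^ d = 2 ^ d * Suc b" by (simp add: b)
  also have "\<dots> = 2 ^ Suc d * c" by (simp add: c)
  finally show ?thesis by simp
qed

lemma remainder_skip_left:
  assumes "remainder d P Q p q" "p < q \<Longrightarrow> 2 ^ Suc d dvd p"
  shows "half_remainder d P Q p q"
  using assms by (auto simp: remainder_def half_remainder_def)

text \<open>Neither possible successor stays in \<open>[P, Q)\<close>. One that starts at
  \<open>p - 2 ^ d\<close> starts before \<open>P\<close>, as \<open>p < P + 2 ^ d\<close>. If one
  that starts at \<open>p\<close> is aligned, then the remainder is a single block, and the
  successor ends after \<open>Q\<close>, as \<open>Q < q + 2 ^ d\<close>.\<close>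

lemma remainder_emit_left:
  assumes r: "remainder d P Q p q" and pq: "p < q" and no: "\<not> (p + 2 ^ Suc d \<le> q \<and> 2 ^ Suc d dvd p)"
  shows "p + 2 ^ d \<le> q" "maximal_block P Q (p, d)" "half_remainder d P Q (p + 2 ^ d) q"
proof -
  define w :: nat where "w = 2 ^ d"
  have w2: "2 ^ Suc d = 2 * w" by (simp add: w_def)
  have h: "P \<le> p" "q \<le> Q" "w dvd p" "w dvd q" "p < P + w" "Q < q + w"
    using r pq by (auto simp: remainder_def w_def)
  show le: "p + 2 ^ d \<le> q" using multiples_gap[OF h(3,4) pq] by (simp add: w_def)
  have short: "q \<le> p + w \<or> p + 2 * w \<le> q"
  proof (cases "p + w < q")
    case True
    then show ?thesis using multiples_gap[of w "p + w" q] h by auto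
  qed simp
  show "maximal_block P Q (p, d)"
    unfolding maximal_block_def prod.case w2 w_def[symmetric]
    using h le short no w2 by (auto simp: w_def[symmetric])
  show "half_remainder d P Q (p + 2 ^ d) q"
    unfolding half_remainder_def
  proof (intro conjI impI)
    assume "p + 2 ^ d < q"
    then have "\<not> 2 ^ Suc d dvd p" using short no by (auto simp: w_def)
    then show "2 ^ Suc d dvd p + 2 ^ d" using h(3) dvd_add_half by (simp add: w_def)
  qed (use h le in \<open>auto simp: w_def\<close>)
qed

text \<open>Alignment of \<open>q\<close> is expressed at \<open>q - 2 ^ Suc d\<close>, the start of
  the block that would end at \<open>q\<close>, because the precomputed data refer to first indices.
  The condition on \<open>p\<close> keeps the truncated subtraction harmless.\<close>

lemma remainder_skip_right:
  assumes "half_remainder d P Q p q" "p < q \<Longrightarrow> p + 2 ^ Suc d \<le> q \<and> 2 ^ Suc d dvd q - 2 ^ Suc d"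
  shows "remainder (Suc d) P Q p q"
proof -
  have "2 ^ Suc d dvd q" if "p < q"
    using assms(2)[OF that] by (metis add_leD2 dvd_diffD dvd_refl)
  then show ?thesis using assms by (auto simp: remainder_def half_remainder_def)
qed

text \<open>The mirror image, except that \<open>p\<close> is already a multiple of
  \<open>2 ^ Suc d\<close>. A successor that extends to the right passes \<open>Q\<close>; one that
  extends to the left would start at \<open>q - 2 ^ Suc d\<close>, which is excluded by the failed
  test or, for a remainder of one block, by the alignment of \<open>p\<close>.\<close>

lemma remainder_emit_right:
  assumes r: "half_remainder d P Q p q" and pq: "p < q"
    and no: "\<not> (p + 2 ^ Suc d \<le> q \<and> 2 ^ Suc d dvd q - 2 ^ Suc d)"
  shows "p + 2 ^ d \<le> q" "maximal_block P Q (q - 2 ^ d, d)" "remainder (Suc d) P Q p (q - 2 ^ d)"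
proof -
  define w :: nat where "w = 2 ^ d"
  have w2: "2 ^ Suc d = 2 * w" by (simp add: w_def)
  have wpos: "w > 0" by (simp add: w_def)
  have h: "P \<le> p" "q \<le> Q" "2 * w dvd p" "w dvd q" "p < P + 2 * w" "Q < q + w"
    using r pq by (auto simp: half_remainder_def w_def)
  have wp: "w dvd p" using h(3) by (rule dvd_mult_right)
  have le: "p + w \<le> q" using multiples_gap[OF wp h(4) pq] .
  then show "p + 2 ^ d \<le> q" by (simp add: w_def)
  have short: "q = p + w \<or> p + 2 * w \<le> q"
  proof (cases "p + w < q")
    case True
    then show ?thesis using multiples_gap[of w "p + w" q] h wp by auto
  qed (use le in simp)
  have no': "\<not> 2 * w dvd i'" if "i' + w = q - w" for i'
  proof
    assume d: "2 * w dvd i'"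
    have i': "i' = q - 2 * w" using that by simp
    from short show False
    proof
      assume "q = p + w"
      then have "p = i' + w" using that by simp
      then have "2 * w dvd w" using d h(3) by (metis dvd_add_right_iff)
      then show False using wpos by (auto dest: dvd_imp_le)
    next
      assume "p + 2 * w \<le> q"
      then show False using no d i' by (simp add: w_def)
    qed
  qed
  have "w dvd q - w" using h(4) by (simp add: dvd_diff_nat)
  then show "maximal_block P Q (q - 2 ^ d, d)"
    unfolding maximal_block_def prod.case w2 w_def[symmetric]
    using h le no' by auto
  show "remainder (Suc d) P Q p (q - 2 ^ d)"
    unfolding remainder_def
  proof (intro conjI impI)
    assume "p < q - 2 ^ d"
    then have pq2: "p + 2 * w \<le> q" using short by (auto simp: w_def)
    have "w dvd q - 2 * w" using h(4) by (simp add: dvd_diff_nat)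
    moreover have "\<not> 2 ^ Suc d dvd q - 2 * w" using no pq2 by (simp add: w_def)
    ultimately have "2 ^ Suc d dvd (q - 2 * w) + w" using dvd_add_half[of d "q - 2 * w"] by (simp add: w_def)
    moreover have "(q - 2 * w) + w = q - 2 ^ d" using pq2 by (simp add: w_def)
    ultimately show "2 ^ Suc d dvd q - 2 ^ d" by simp
  qed (use h le in \<open>auto simp: w_def\<close>)
qed

text \<open>Depth \<open>d\<close> is treated with \<open>w = 2 ^ d\<close>.\<close>

definition emit :: "string \<Rightarrow> com" where
  "emit i =
     Seq (Store ''E'' (Var ''m'') (Arr ''desc'' (Plus (Arr ''base'' (Var i)) (Var ''d''))))
     (Seq (Store ''D'' (Var ''m'') (Var ''d''))
          (Assign ''m'' (Plus (Var ''m'') (Const 1))))"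

definition emit_left :: "string \<Rightarrow> string \<Rightarrow> com" where
  "emit_left p q =
     Cond (BAnd (Less (Var p) (Var q))
            (BNot (BAnd (Le (Plus (Var p) (Plus (Var ''w'') (Var ''w''))) (Var q))
                        (Less (Var ''d'') (Arr ''maxdepth'' (Var p))))))
       (Seq (emit p) (Assign p (Plus (Var p) (Var ''w''))))
       Skip"

definition emit_right :: "string \<Rightarrow> string \<Rightarrow> com" where
  "emit_right p q =
     Cond (BAnd (Less (Var p) (Var q))
            (BNot (BAnd (Le (Plus (Var p) (Plus (Var ''w'') (Var ''w''))) (Var q))
                        (Less (Var ''d'')
                           (Arr ''maxdepth'' (Minus (Var q) (Plus (Var ''w'') (Var ''w''))))))))
       (Seq (Assign q (Minus (Var q) (Var ''w''))) (emit q))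
       Skip"

definition scan_level :: com where
  "scan_level =
     Seq (emit_left ''begin1'' ''end1'') (Seq (emit_right ''begin1'' ''end1'')
     (Seq (emit_left ''begin2'' ''end2'') (Seq (emit_right ''begin2'' ''end2'')
     (Seq (Assign ''w'' (Plus (Var ''w'') (Var ''w'')))
          (Assign ''d'' (Plus (Var ''d'') (Const 1)))))))"

definition scan_cond :: bexp where
  "scan_cond = BOr (Less (Var ''begin1'') (Var ''end1'')) (Less (Var ''begin2'') (Var ''end2''))"

section \<open>Correctness of the scan\<close>

locale stored_instance = leftist_copy n \<nu> S x
  for n :: nat and \<nu> :: "nat \<times> nat \<Rightarrow> nat" and S :: "nat circuit" and x :: "nat \<Rightarrow> nat" +
  fixes L :: "nat set" and ys :: "nat list" and a :: "nat \<Rightarrow> nat" and s\<^sub>0 :: state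
  assumes L: "set ys = L" "distinct ys" "sorted (map a ys)" "L \<inter> gates S = {}"
    and stored: "stores_circuit s\<^sub>0 S" "stores_precomputed s\<^sub>0 S n x" "stores_list s\<^sub>0 ys a"
      "free_from s\<^sub>0 (verts S \<union> L)"
begin

lemma desc:
  assumes "(i, d) \<in> dyadic n"
  shows "arr s\<^sub>0 ''desc'' (arr s\<^sub>0 ''base'' i + d) = \<nu> (i, d)"
proof -
  have i: "i < n" using assms less_le_trans[of i "i + 2 ^ d" n] by (simp add: dyadic_def)
  have "d \<le> max_right_depth S (x i)"
  proof (cases d)
    case (Suc c)
    then have "c < max_right_depth S (x i)" using less_max_right_depth[OF i, of c] assms by blast
    then show ?thesis using Suc by simp
  qed simp
  then show ?thesis using stored(2) i right_descendant[OF assms] by (simp add: stores_precomputed_def)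
qed

lemma maxdepth:
  assumes "i + 2 ^ Suc d \<le> n"
  shows "d < arr s\<^sub>0 ''maxdepth'' i \<longleftrightarrow> 2 ^ Suc d dvd i"
proof -
  have "i < n" using assms less_le_trans[of i "i + 2 ^ Suc d" n] by simp
  then have "arr s\<^sub>0 ''maxdepth'' i = max_right_depth S (x i)"
    using stored(2) by (simp add: stores_precomputed_def)
  then show ?thesis using less_max_right_depth_dvd[OF assms] by simp
qed

definition scanned :: "state \<Rightarrow> (nat \<times> nat) list \<Rightarrow> nat \<Rightarrow> bool" where
  "scanned s es d \<longleftrightarrow>
     (\<forall>A. A \<noteq> ''E'' \<and> A \<noteq> ''D'' \<longrightarrow> arr s A = arr s\<^sub>0 A) \<and>
     var s ''free'' = var s\<^sub>0 ''free'' \<and> var s ''l'' = var s\<^sub>0 ''l'' \<and>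
     var s ''d'' = d \<and> var s ''w'' = 2 ^ d \<and> var s ''m'' = length es \<and>
     (\<forall>i < length es. arr s ''E'' i = \<nu> (es ! i) \<and> arr s ''D'' i = snd (es ! i))"

lemma scanned_cong:
  assumes "scanned s es d" "arr s' = arr s" "\<And>y. y \<in> {''free'', ''l'', ''d'', ''w'', ''m''} \<Longrightarrow> var s' y = var s y"
  shows "scanned s' es d"
  using assms by (simp add: scanned_def)

lemma scanned_emit:
  assumes "scanned s es d" "(var s i, d) \<in> dyadic n" "i \<noteq> ''m''"
  shows "scanned (run (emit i) s) (es @ [(var s i, d)]) d"
    "\<And>y. y \<noteq> ''m'' \<Longrightarrow> var (run (emit i) s) y = var s y"
  using assms desc[OF assms(2)] by (auto simp: scanned_def emit_def nth_append less_Suc_eq)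

lemma emit_left:
  assumes s: "scanned s es d" and names: "p \<notin> {''free'', ''l'', ''d'', ''w'', ''m''}" "q \<noteq> ''m''" "p \<noteq> q"
    and r: "remainder d P Q (var s p) (var s q)" "Q \<le> n"
  defines "s' \<equiv> run (emit_left p q) s"
  shows "\<exists>es'. scanned s' (es @ es') d \<and> (\<forall>y. y \<noteq> p \<and> y \<noteq> ''m'' \<longrightarrow> var s' y = var s y) \<and>
    half_remainder d P Q (var s' p) (var s' q) \<and> (\<forall>e \<in> set es'. maximal_block P Q e \<and> snd e = d) \<and>
    covered es' + mset_set {var s' p..<var s' q} = mset_set {var s p..<var s q}"
proof -
  let ?p = "var s p" and ?q = "var s q"
  have qn: "?q \<le> n" using r by (auto simp: remainder_def)
  have w: "var s ''w'' = 2 ^ d" "var s ''d'' = d" "arr s ''maxdepth'' = arr s\<^sub>0 ''maxdepth''"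
    using s by (auto simp: scanned_def)
  define up where "up \<longleftrightarrow> ?p + 2 ^ Suc d \<le> ?q \<and> 2 ^ Suc d dvd ?p"
  \<comment> \<open>The table is decisive only where the larger block fits below \<open>n\<close>;
    the first conjunct and \<open>?q \<le> n\<close> guarantee this.\<close>
  have up: "up \<longleftrightarrow> ?p + 2 ^ Suc d \<le> ?q \<and> d < arr s\<^sub>0 ''maxdepth'' ?p"
    using maxdepth[of ?p d] qn by (auto simp: up_def)
  show ?thesis
  proof (cases "?p < ?q \<and> \<not> up")
    case True
    note e = remainder_emit_left[OF r(1) _ True[THEN conjunct2, unfolded up_def], OF True[THEN conjunct1]]
    have s': "s' = run (Assign p (Plus (Var p) (Var ''w''))) (run (emit p) s)"
      using True up w by (auto simp: s'_def emit_left_def mult_2 not_less)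
    have dy: "(?p, d) \<in> dyadic n" using e(1,2) qn by (auto simp: maximal_block_def dyadic_def)
    note em = scanned_emit[OF s dy]
    have vars: "var s' y = (if p = y then ?p + 2 ^ d else var s y)" if "y \<noteq> ''m''" for y
      using em(2) names that w by (auto simp: s')
    have "scanned s' (es @ [(?p, d)]) d"
      by (rule scanned_cong[OF em(1)]) (use names in \<open>auto simp: s'\<close>)
    moreover have "mset_set {?p..<?p + 2 ^ d} + mset_set {?p + 2 ^ d..<?q} = mset_set {?p..<?q}"
      using e(1) by (subst mset_set_Union[symmetric]) (auto intro!: arg_cong[where f = mset_set])
    ultimately show ?thesis
      using vars names e by (intro exI[of _ "[(?p, d)]"]) auto
  next
    case False
    then have "s' = s" using up w by (auto simp: s'_def emit_left_def mult_2 not_less)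
    moreover have "half_remainder d P Q ?p ?q"
      using r(1) by (rule remainder_skip_left) (use False up_def in auto)
    ultimately show ?thesis using s by (intro exI[of _ "[]"]) auto
  qed
qed

lemma emit_right:
  assumes s: "scanned s es d" and names: "q \<notin> {''free'', ''l'', ''d'', ''w'', ''m''}" "p \<noteq> ''m''" "p \<noteq> q"
    and r: "half_remainder d P Q (var s p) (var s q)" "Q \<le> n"
  defines "s' \<equiv> run (emit_right p q) s"
  shows "\<exists>es'. scanned s' (es @ es') d \<and> (\<forall>y. y \<noteq> q \<and> y \<noteq> ''m'' \<longrightarrow> var s' y = var s y) \<and>
    remainder (Suc d) P Q (var s' p) (var s' q) \<and> (\<forall>e \<in> set es'. maximal_block P Q e \<and> snd e = d) \<and>
    covered es' + mset_set {var s' p..<var s' q} = mset_set {var s p..<var s q}"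
proof -
  let ?p = "var s p" and ?q = "var s q"
  have qn: "?q \<le> n" using r by (auto simp: half_remainder_def)
  have w: "var s ''w'' = 2 ^ d" "var s ''d'' = d" "arr s ''maxdepth'' = arr s\<^sub>0 ''maxdepth''"
    using s by (auto simp: scanned_def)
  define up where "up \<longleftrightarrow> ?p + 2 ^ Suc d \<le> ?q \<and> 2 ^ Suc d dvd ?q - 2 ^ Suc d"
  have up: "up \<longleftrightarrow> ?p + 2 ^ Suc d \<le> ?q \<and> d < arr s\<^sub>0 ''maxdepth'' (?q - 2 ^ Suc d)"
    using maxdepth[of "?q - 2 ^ Suc d" d] qn by (auto simp: up_def)
  show ?thesis
  proof (cases "?p < ?q \<and> \<not> up")
    case True
    note e = remainder_emit_right[OF r(1) _ True[THEN conjunct2, unfolded up_def], OF True[THEN conjunct1]]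
    define s1 where "s1 = run (Assign q (Minus (Var q) (Var ''w''))) s"
    have s': "s' = run (emit q) s1"
      using True up w by (auto simp: s'_def s1_def emit_right_def mult_2 not_less)
    have q1: "var s1 q = ?q - 2 ^ d" using w by (simp add: s1_def)
    have s1: "scanned s1 es d" by (rule scanned_cong[OF s]) (use names in \<open>auto simp: s1_def\<close>)
    have "maximal_block P Q (var s1 q, d)" using e(2) q1 by simp
    then have dy: "(var s1 q, d) \<in> dyadic n" using e(1) qn q1 by (auto simp: maximal_block_def dyadic_def)
    have qm: "q \<noteq> ''m''" using names by simp
    note em = scanned_emit[OF s1 dy qm]
    have vars: "var s' y = (if q = y then ?q - 2 ^ d else var s y)" if "y \<noteq> ''m''" for y
      using em(2)[OF that] w by (auto simp: s' s1_def)
    have "mset_set {?q - 2 ^ d..<?q} + mset_set {?p..<?q - 2 ^ d} = mset_set {?p..<?q}"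
      using e(1) by (subst mset_set_Union[symmetric]) (auto intro!: arg_cong[where f = mset_set])
    moreover have "?q - 2 ^ d + 2 ^ d = ?q" using e(1) by simp
    ultimately show ?thesis
      using vars names e em(1) q1 by (intro exI[of _ "[(?q - 2 ^ d, d)]"]) (auto simp: s')
  next
    case False
    then have "s' = s" using up w by (auto simp: s'_def emit_right_def mult_2 not_less)
    moreover have "remainder (Suc d) P Q ?p ?q"
      using r(1) by (rule remainder_skip_right) (use False up_def in auto)
    ultimately show ?thesis using s by (intro exI[of _ "[]"]) auto
  qed
qed

text \<open>The last conjunct accounts for each index exactly once, as emitted or as remaining. The
  bound \<open>snd e < d\<close> keeps the list sorted when the blocks of depth \<open>d\<close> are
  appended.\<close>

definition scan_invariant :: "nat \<Rightarrow> nat \<Rightarrow> nat \<Rightarrow> nat \<Rightarrow> state \<Rightarrow> (nat \<times> nat) list \<Rightarrow> nat \<Rightarrow> bool" where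
  "scan_invariant P Q P' Q' s es d \<longleftrightarrow> scanned s es d \<and>
     remainder d P Q (var s ''begin1'') (var s ''end1'') \<and>
     remainder d P' Q' (var s ''begin2'') (var s ''end2'') \<and>
     sorted (map snd es) \<and>
     (\<forall>e \<in> set es. snd e < d \<and> (maximal_block P Q e \<or> maximal_block P' Q' e)) \<and>
     covered es + mset_set {var s ''begin1''..<var s ''end1''} +
       mset_set {var s ''begin2''..<var s ''end2''} = mset_set {P..<Q} + mset_set {P'..<Q'}"

lemma scan_level:
  assumes inv: "scan_invariant P Q P' Q' s es d" and n: "Q \<le> n" "Q' \<le> n"
  shows "\<exists>es'. scan_invariant P Q P' Q' (run scan_level s) es' (Suc d)"
proof -
  define s1 where "s1 = run (emit_left ''begin1'' ''end1'') s"
  define s2 where "s2 = run (emit_right ''begin1'' ''end1'') s1"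
  define s3 where "s3 = run (emit_left ''begin2'' ''end2'') s2"
  define s4 where "s4 = run (emit_right ''begin2'' ''end2'') s3"
  define s5 where "s5 = run scan_level s"
  have s5: "s5 = s4\<lparr>var := (var s4)(''w'' := var s4 ''w'' + var s4 ''w'', ''d'' := var s4 ''d'' + 1)\<rparr>"
    by (simp add: s5_def scan_level_def s1_def s2_def s3_def s4_def)
  have i: "scanned s es d" "remainder d P Q (var s ''begin1'') (var s ''end1'')"
    "remainder d P' Q' (var s ''begin2'') (var s ''end2'')" "sorted (map snd es)"
    "\<forall>e \<in> set es. snd e < d \<and> (maximal_block P Q e \<or> maximal_block P' Q' e)"
    "covered es + mset_set {var s ''begin1''..<var s ''end1''} +
       mset_set {var s ''begin2''..<var s ''end2''} = mset_set {P..<Q} + mset_set {P'..<Q'}"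
    using inv by (auto simp: scan_invariant_def)
  have nb: "''begin1'' \<notin> {''free'', ''l'', ''d'', ''w'', ''m''}" "''begin1'' \<noteq> ''m''" "''begin1'' \<noteq> ''end1''"
    "''begin2'' \<notin> {''free'', ''l'', ''d'', ''w'', ''m''}" "''begin2'' \<noteq> ''m''" "''begin2'' \<noteq> ''end2''"
    and ne: "''end1'' \<notin> {''free'', ''l'', ''d'', ''w'', ''m''}" "''end1'' \<noteq> ''m''"
    "''end2'' \<notin> {''free'', ''l'', ''d'', ''w'', ''m''}" "''end2'' \<noteq> ''m''"
    by simp_all
  obtain e1 where 1: "scanned s1 (es @ e1) d" "\<forall>y. y \<noteq> ''begin1'' \<and> y \<noteq> ''m'' \<longrightarrow> var s1 y = var s y"
    "half_remainder d P Q (var s1 ''begin1'') (var s1 ''end1'')"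
    "\<forall>e \<in> set e1. maximal_block P Q e \<and> snd e = d"
    "covered e1 + mset_set {var s1 ''begin1''..<var s1 ''end1''} = mset_set {var s ''begin1''..<var s ''end1''}"
    using emit_left[OF i(1) nb(1) ne(2) nb(3) i(2) n(1), folded s1_def] by blast
  obtain e2 where 2: "scanned s2 ((es @ e1) @ e2) d" "\<forall>y. y \<noteq> ''end1'' \<and> y \<noteq> ''m'' \<longrightarrow> var s2 y = var s1 y"
    "remainder (Suc d) P Q (var s2 ''begin1'') (var s2 ''end1'')"
    "\<forall>e \<in> set e2. maximal_block P Q e \<and> snd e = d"
    "covered e2 + mset_set {var s2 ''begin1''..<var s2 ''end1''} = mset_set {var s1 ''begin1''..<var s1 ''end1''}"
    using emit_right[OF 1(1) ne(1) nb(2) nb(3) 1(3) n(1), folded s2_def] by blast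
  have v2: "var s2 ''begin2'' = var s ''begin2''" "var s2 ''end2'' = var s ''end2''" using 1(2) 2(2) by simp_all
  obtain e3 where 3: "scanned s3 (((es @ e1) @ e2) @ e3) d" "\<forall>y. y \<noteq> ''begin2'' \<and> y \<noteq> ''m'' \<longrightarrow> var s3 y = var s2 y"
    "half_remainder d P' Q' (var s3 ''begin2'') (var s3 ''end2'')"
    "\<forall>e \<in> set e3. maximal_block P' Q' e \<and> snd e = d"
    "covered e3 + mset_set {var s3 ''begin2''..<var s3 ''end2''} = mset_set {var s2 ''begin2''..<var s2 ''end2''}"
    using emit_left[OF 2(1) nb(4) ne(4) nb(6) i(3)[folded v2] n(2), folded s3_def] by blast
  obtain e4 where 4: "scanned s4 ((((es @ e1) @ e2) @ e3) @ e4) d" "\<forall>y. y \<noteq> ''end2'' \<and> y \<noteq> ''m'' \<longrightarrow> var s4 y = var s3 y"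
    "remainder (Suc d) P' Q' (var s4 ''begin2'') (var s4 ''end2'')"
    "\<forall>e \<in> set e4. maximal_block P' Q' e \<and> snd e = d"
    "covered e4 + mset_set {var s4 ''begin2''..<var s4 ''end2''} = mset_set {var s3 ''begin2''..<var s3 ''end2''}"
    using emit_right[OF 3(1) ne(3) nb(5) nb(6) 3(3) n(2), folded s4_def] by blast
  have v4: "var s4 ''begin1'' = var s2 ''begin1''" "var s4 ''end1'' = var s2 ''end1''" using 3(2) 4(2) by simp_all
  define e' where "e' = e1 @ e2 @ e3 @ e4"
  let ?es = "es @ e'"
  have e': "\<forall>e \<in> set e'. snd e = d" "\<forall>e \<in> set e'. maximal_block P Q e \<or> maximal_block P' Q' e"
    using 1(4) 2(4) 3(4) 4(4) unfolding e'_def set_append by blast+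
  have "scanned s5 ?es (Suc d)"
    using 4(1) by (simp add: scanned_def s5 e'_def)
  moreover have "sorted (map snd e')" using e'(1) by (induction e') auto
  then have "sorted (map snd ?es)" using i(4,5) e'(1) by (auto simp: sorted_append less_imp_le)
  moreover have "\<forall>e \<in> set ?es. snd e < Suc d \<and> (maximal_block P Q e \<or> maximal_block P' Q' e)"
    using i(5) e' by (auto simp: less_Suc_eq)
  moreover have "covered ?es + mset_set {var s5 ''begin1''..<var s5 ''end1''} +
       mset_set {var s5 ''begin2''..<var s5 ''end2''} = mset_set {P..<Q} + mset_set {P'..<Q'}"
    unfolding i(6)[symmetric] 1(5)[symmetric] 2(5)[symmetric] v2[symmetric] 3(5)[symmetric] 4(5)[symmetric]
    by (simp add: s5 v4 e'_def)
  ultimately have "scan_invariant P Q P' Q' s5 ?es (Suc d)"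
    using 2(3) 4(3) v4 by (simp add: scan_invariant_def s5)
  then show ?thesis unfolding s5_def by blast
qed

end


section \<open>Combining the two smallest items\<close>

text \<open>The items that wait to be combined form three queues sorted by value: the boundary
  vertices, the elements of \<open>L\<close>, and the new gates, whose addresses are consecutive.\<close>

definition pop :: com where
  "pop =
     Cond (BAnd (Less (Var ''h'') (Var ''free''))
            (BAnd (BOr (Le (Var ''m'') (Var ''i''))
                       (Le (Arr ''val'' (Var ''h'')) (Arr ''D'' (Var ''i''))))
                  (BOr (Le (Var ''l'') (Var ''j''))
                       (Le (Arr ''val'' (Var ''h'')) (Arr ''arrival'' (Var ''j''))))))
       (Seq (Assign ''u'' (Var ''h'')) (Seq (Assign ''z'' (Arr ''val'' (Var ''h'')))
            (Assign ''h'' (Plus (Var ''h'') (Const 1)))))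
       (Cond (BAnd (Less (Var ''i'') (Var ''m''))
               (BOr (Le (Var ''l'') (Var ''j''))
                    (Le (Arr ''D'' (Var ''i'')) (Arr ''arrival'' (Var ''j'')))))
          (Seq (Assign ''u'' (Arr ''E'' (Var ''i''))) (Seq (Assign ''z'' (Arr ''D'' (Var ''i'')))
               (Assign ''i'' (Plus (Var ''i'') (Const 1)))))
          (Seq (Assign ''u'' (Arr ''L'' (Var ''j''))) (Seq (Assign ''z'' (Arr ''arrival'' (Var ''j'')))
               (Assign ''j'' (Plus (Var ''j'') (Const 1))))))"

definition add_gate :: com where
  "add_gate =
     Seq (Store ''left'' (Var ''free'') (Var ''root''))
     (Seq (Store ''right'' (Var ''free'') (Var ''u''))
     (Seq (Store ''val'' (Var ''free'') (Plus (Var ''z'') (Const 1)))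
          (Assign ''free'' (Plus (Var ''free'') (Const 1)))))"

definition combine_step :: com where
  "combine_step = Seq pop (Seq add_gate (Seq pop (Assign ''root'' (Var ''u''))))"

definition combine_cond :: bexp where
  "combine_cond = BOr (Less (Var ''h'') (Var ''free''))
     (BOr (Less (Var ''i'') (Var ''m'')) (Less (Var ''j'') (Var ''l'')))"

definition gate_queue :: "state \<Rightarrow> (nat \<times> nat) list" where
  "gate_queue s = map (\<lambda>v. (v, arr s ''val'' v)) [var s ''h''..<var s ''free'']"

definition boundary_queue :: "state \<Rightarrow> (nat \<times> nat) list" where
  "boundary_queue s = map (\<lambda>i. (arr s ''E'' i, arr s ''D'' i)) [var s ''i''..<var s ''m'']"

definition input_queue :: "state \<Rightarrow> (nat \<times> nat) list" where
  "input_queue s = map (\<lambda>i. (arr s ''L'' i, arr s ''arrival'' i)) [var s ''j''..<var s ''l'']"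

definition pending :: "state \<Rightarrow> (nat \<times> nat) multiset" where
  "pending s = mset (gate_queue s) + mset (boundary_queue s) + mset (input_queue s)"

text \<open>\<open>b\<close> is the value popped last. A gate gets one more than the value popped
  before its creation, so gate values are at most \<open>Suc b\<close>; this is why gates can be
  appended to their queue without sorting.\<close>

definition sorted_queues :: "state \<Rightarrow> nat \<Rightarrow> bool" where
  "sorted_queues s b \<longleftrightarrow> var s ''h'' \<le> var s ''free'' \<and>
     sorted (map snd (gate_queue s)) \<and> sorted (map snd (boundary_queue s)) \<and>
     sorted (map snd (input_queue s)) \<and>
     (\<forall>p \<in># pending s. b \<le> snd p) \<and> (\<forall>p \<in> set (gate_queue s). snd p \<le> Suc b)"

lemma combine_cond: "bval combine_cond s \<longleftrightarrow> pending s \<noteq> {#}"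
  by (auto simp: combine_cond_def pending_def gate_queue_def boundary_queue_def input_queue_def
      simp del: mset_map mset_upt)

text \<open>The three alternatives in \<open>queues\<close> name the queue that loses its head. As
  each queue is sorted, the least head is the least pending value.\<close>

lemma sorted_queues_pop:
  assumes "sorted_queues s b"
    and queues: "(gate_queue s, boundary_queue s, input_queue s) \<in>
      {((u, z) # gate_queue s', boundary_queue s', input_queue s'),
       (gate_queue s', (u, z) # boundary_queue s', input_queue s'),
       (gate_queue s', boundary_queue s', (u, z) # input_queue s')}"
    and min: "\<And>p q. gate_queue s = p # q \<Longrightarrow> z \<le> snd p" "\<And>p q. boundary_queue s = p # q \<Longrightarrow> z \<le> snd p"
      "\<And>p q. input_queue s = p # q \<Longrightarrow> z \<le> snd p"
    and le: "var s' ''h'' \<le> var s' ''free''"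
  shows "pending s = add_mset (u, z) (pending s')" "sorted_queues s' z" "b \<le> z"
proof -
  show 1: "pending s = add_mset (u, z) (pending s')"
    using queues by (auto simp: pending_def)
  then show b: "b \<le> z" using assms(1) by (auto simp: sorted_queues_def)
  have srt: "sorted (map snd (gate_queue s))" "sorted (map snd (boundary_queue s))"
    "sorted (map snd (input_queue s))" and hi: "\<forall>p \<in> set (gate_queue s). snd p \<le> Suc b"
    using assms(1) by (auto simp: sorted_queues_def)
  have head: "z \<le> snd p" if "sorted (map snd Q)" "\<forall>p q. Q = p # q \<longrightarrow> z \<le> snd p" "p \<in> set Q"
    for Q :: "(nat \<times> nat) list" and p
    using that by (cases Q) (auto intro: order_trans)
  have sub: "set (gate_queue s') \<subseteq> set (gate_queue s)" "set (boundary_queue s') \<subseteq> set (boundary_queue s)"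
    "set (input_queue s') \<subseteq> set (input_queue s)"
    using queues by auto
  have srt': "sorted (map snd (gate_queue s'))" "sorted (map snd (boundary_queue s'))"
    "sorted (map snd (input_queue s'))"
    using srt queues by auto
  have "z \<le> snd p" if "p \<in># pending s'" for p
  proof -
    have "p \<in> set (gate_queue s) \<or> p \<in> set (boundary_queue s) \<or> p \<in> set (input_queue s)"
      using that sub by (auto simp: pending_def)
    then show ?thesis
      using head[OF srt(1)] head[OF srt(2)] head[OF srt(3)] min by blast
  qed
  moreover have "snd p \<le> Suc z" if "p \<in> set (gate_queue s')" for p
    using that sub(1) hi b by fastforce
  ultimately show "sorted_queues s' z" using srt' le by (simp add: sorted_queues_def)
qed

lemma pop:
  assumes q: "sorted_queues s b" and ne: "pending s \<noteq> {#}"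
  defines "s' \<equiv> run pop s"
  shows "arr s' = arr s"
    and "\<And>y. y \<notin> {''u'', ''z'', ''h'', ''i'', ''j''} \<Longrightarrow> var s' y = var s y"
    and "pending s = add_mset (var s' ''u'', var s' ''z'') (pending s')"
    and "sorted_queues s' (var s' ''z'')" and "b \<le> var s' ''z''"
proof -
  show A: "arr s' = arr s" by (simp add: s'_def pop_def)
  show V: "var s' y = var s y" if "y \<notin> {''u'', ''z'', ''h'', ''i'', ''j''}" for y
    using that by (simp add: s'_def pop_def)
  define g where "g \<longleftrightarrow> var s ''h'' < var s ''free''"
  define e where "e \<longleftrightarrow> var s ''i'' < var s ''m''"
  define l where "l \<longleftrightarrow> var s ''j'' < var s ''l''"
  define vg where "vg = arr s ''val'' (var s ''h'')"
  define ve where "ve = arr s ''D'' (var s ''i'')"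
  define vl where "vl = arr s ''arrival'' (var s ''j'')"
  have some: "g \<or> e \<or> l"
    using ne combine_cond[of s] by (auto simp: combine_cond_def g_def e_def l_def)
  have hg: "snd p = vg" if "gate_queue s = p # Q" for p Q
    using that by (auto simp: gate_queue_def vg_def upt_eq_Cons_conv)
  have gg: g if "gate_queue s = p # Q" for p Q
    using that by (auto simp: gate_queue_def g_def upt_eq_Cons_conv)
  have he: "snd p = ve" e if "boundary_queue s = p # Q" for p Q
    using that by (auto simp: boundary_queue_def ve_def e_def upt_eq_Cons_conv)
  have hl: "snd p = vl" l if "input_queue s = p # Q" for p Q
    using that by (auto simp: input_queue_def vl_def l_def upt_eq_Cons_conv)
  have le: "var s ''h'' \<le> var s ''free''" using q by (simp add: sorted_queues_def)
  define cg where "cg \<longleftrightarrow> g \<and> (e \<longrightarrow> vg \<le> ve) \<and> (l \<longrightarrow> vg \<le> vl)"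
  define ce where "ce \<longleftrightarrow> e \<and> (l \<longrightarrow> ve \<le> vl)"
  define W where "W u z y = s\<lparr>var := (var s)(''u'' := u, ''z'' := z, y := var s y + 1)\<rparr>" for u z y
  have s': "s' = (if cg then W (var s ''h'') vg ''h''
    else if ce then W (arr s ''E'' (var s ''i'')) ve ''i''
    else W (arr s ''L'' (var s ''j'')) vl ''j'')"
    unfolding s'_def pop_def cg_def ce_def g_def e_def l_def vg_def ve_def vl_def W_def
    by (auto simp: not_less)
  \<comment> \<open>\<open>R\<close> bundles the hypotheses of \<open>sorted_queues_pop\<close>, so
    that each branch of the program is unfolded only once.\<close>
  define R where "R \<longleftrightarrow> (gate_queue s, boundary_queue s, input_queue s) \<in>
      {((var s' ''u'', var s' ''z'') # gate_queue s', boundary_queue s', input_queue s'),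
       (gate_queue s', (var s' ''u'', var s' ''z'') # boundary_queue s', input_queue s'),
       (gate_queue s', boundary_queue s', (var s' ''u'', var s' ''z'') # input_queue s')} \<and>
    (g \<longrightarrow> var s' ''z'' \<le> vg) \<and> (e \<longrightarrow> var s' ''z'' \<le> ve) \<and> (l \<longrightarrow> var s' ''z'' \<le> vl) \<and>
    var s' ''h'' \<le> var s' ''free''"
  have R
  proof -
    consider "cg" | "\<not> cg" "ce" | "\<not> cg" "\<not> ce" by blast
    then show R
    proof cases
      case 1
      then show ?thesis
        by (simp add: R_def s' W_def gate_queue_def boundary_queue_def input_queue_def)
          (simp add: cg_def g_def vg_def upt_conv_Cons)
    next
      case 2
      then have "g \<longrightarrow> ve \<le> vg" by (auto simp: cg_def ce_def)
      with 2 show ?thesis using le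
        by (simp add: R_def s' W_def gate_queue_def boundary_queue_def input_queue_def)
          (simp add: ce_def e_def ve_def upt_conv_Cons)
    next
      case 3
      then have l "g \<longrightarrow> vl \<le> vg" "e \<longrightarrow> vl \<le> ve" using some by (auto simp: cg_def ce_def)
      with 3 show ?thesis using le
        by (simp add: R_def s' W_def gate_queue_def boundary_queue_def input_queue_def)
          (simp add: l_def vl_def upt_conv_Cons)
    qed
  qed
  then have queues: "(gate_queue s, boundary_queue s, input_queue s) \<in>
      {((var s' ''u'', var s' ''z'') # gate_queue s', boundary_queue s', input_queue s'),
       (gate_queue s', (var s' ''u'', var s' ''z'') # boundary_queue s', input_queue s'),
       (gate_queue s', boundary_queue s', (var s' ''u'', var s' ''z'') # input_queue s')}"
    and z: "g \<longrightarrow> var s' ''z'' \<le> vg" "e \<longrightarrow> var s' ''z'' \<le> ve" "l \<longrightarrow> var s' ''z'' \<le> vl"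
    and le': "var s' ''h'' \<le> var s' ''free''"
    unfolding R_def by blast+
  show "pending s = add_mset (var s' ''u'', var s' ''z'') (pending s')" "sorted_queues s' (var s' ''z'')"
    "b \<le> var s' ''z''"
    by (rule sorted_queues_pop[OF q queues _ _ _ le']; use z hg gg he hl in metis)+
qed


lemma add_gate:
  assumes q: "sorted_queues s (var s ''z'')"
  defines "s' \<equiv> run add_gate s" and "f \<equiv> var s ''free''"
  shows "sorted_queues s' (var s ''z'')"
    and "pending s' = add_mset (f, Suc (var s ''z'')) (pending s)"
    and "var s' = (var s)(''free'' := Suc f)"
    and "arr s' ''left'' = (arr s ''left'')(f := var s ''root'')"
    and "arr s' ''right'' = (arr s ''right'')(f := var s ''u'')"
proof -
  have s': "s' = s\<lparr>var := (var s)(''free'' := Suc f),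
    arr := (arr s)(''left'' := (arr s ''left'')(f := var s ''root''),
      ''right'' := (arr s ''right'')(f := var s ''u''), ''val'' := (arr s ''val'')(f := Suc (var s ''z'')))\<rparr>"
    by (simp add: s'_def add_gate_def f_def fun_upd_twist)
  have hf: "var s ''h'' \<le> f" using q by (simp add: sorted_queues_def f_def)
  have g: "gate_queue s' = gate_queue s @ [(f, Suc (var s ''z''))]"
    using hf by (simp add: gate_queue_def s' f_def)
  have o: "boundary_queue s' = boundary_queue s" "input_queue s' = input_queue s"
    by (simp_all add: boundary_queue_def input_queue_def s')
  have v': "var s' ''h'' \<le> var s' ''free''" using hf by (simp add: s')
  show p: "pending s' = add_mset (f, Suc (var s ''z'')) (pending s)" by (simp add: pending_def g o)
  show "sorted_queues s' (var s ''z'')"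
    using q v' unfolding sorted_queues_def p g o by (auto simp: sorted_append)
  show "var s' = (var s)(''free'' := Suc f)"
    "arr s' ''left'' = (arr s ''left'')(f := var s ''root'')"
    "arr s' ''right'' = (arr s ''right'')(f := var s ''u'')"
    by (simp_all add: s')
qed

section \<open>The growing circuit in memory and its forest\<close>

context stored_instance
begin

definition circuit_of :: "state \<Rightarrow> nat circuit" where
  "circuit_of s = result_circuit S L s\<^sub>0 s"

text \<open>New gates refer only to older addresses, which reduces acyclicity to a comparison of
  addresses.\<close>

definition well_formed :: "state \<Rightarrow> bool" where
  "well_formed s \<longleftrightarrow> var s\<^sub>0 ''free'' \<le> var s ''free'' \<and>
     (\<forall>v < var s\<^sub>0 ''free''. arr s ''left'' v = arr s\<^sub>0 ''left'' v \<and> arr s ''right'' v = arr s\<^sub>0 ''right'' v) \<and>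
     (\<forall>g \<in> {var s\<^sub>0 ''free''..<var s ''free''}.
        arr s ''left'' g \<in> verts S \<union> L \<union> {var s\<^sub>0 ''free''..<g} \<and>
        arr s ''right'' g \<in> verts S \<union> L \<union> {var s\<^sub>0 ''free''..<g} \<and>
        arr s ''left'' g \<noteq> arr s ''right'' g)"

lemma old_address: "v \<in> verts S \<union> L \<Longrightarrow> v < var s\<^sub>0 ''free''"
  using stored(4) by (auto simp: free_from_def)

lemma verts_circuit_of: "verts (circuit_of s) = verts S \<union> L \<union> {var s\<^sub>0 ''free''..<var s ''free''}"
  by (auto simp: verts_def circuit_of_def result_circuit_def)

lemma well_formed_stores: "well_formed s \<Longrightarrow> stores_circuit s S"
  using stored(1) old_address by (auto simp: stores_circuit_def well_formed_def verts_def)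

lemma is_circuit_circuit_of:
  assumes "well_formed s"
  shows "is_circuit (circuit_of s)"
proof -
  let ?C = "circuit_of s" and ?f = "var s\<^sub>0 ''free''"
  have C: "inputs ?C = inputs S \<union> L" "gates ?C = gates S \<union> {?f..<var s ''free''}"
    "lpred ?C = arr s ''left''" "rpred ?C = arr s ''right''"
    by (auto simp: circuit_of_def result_circuit_def)
  have old: "lpred ?C v = lpred S v \<and> rpred ?C v = rpred S v" if "v \<in> gates S" for v
    using that well_formed_stores[OF assms] by (auto simp: C stores_circuit_def)
  have S: "finite (verts S)" "\<And>v. v \<in> gates S \<Longrightarrow> lpred S v \<in> verts S \<and> rpred S v \<in> verts S \<and> lpred S v \<noteq> rpred S v"
    using is_circuit_S by (auto simp: is_circuit_def)
  have new: "v \<in> verts S \<union> L \<Longrightarrow> v \<notin> {?f..<var s ''free''}" for v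
    using old_address[of v] by auto
  have preds: "lpred ?C v \<in> verts ?C \<and> rpred ?C v \<in> verts ?C \<and> lpred ?C v \<noteq> rpred ?C v" if "v \<in> gates ?C" for v
  proof (cases "v \<in> gates S")
    case True
    then show ?thesis using S(2) old by (auto simp: verts_circuit_of)
  next
    case False
    then have v: "v \<in> {?f..<var s ''free''}" using that by (auto simp: C)
    then have "arr s ''left'' v \<in> verts S \<union> L \<union> {?f..<v} \<and> arr s ''right'' v \<in> verts S \<union> L \<union> {?f..<v} \<and>
      arr s ''left'' v \<noteq> arr s ''right'' v"
      using assms by (simp add: well_formed_def)
    moreover have "{?f..<v} \<subseteq> {?f..<var s ''free''}" using v by auto
    ultimately show ?thesis unfolding C(3,4) verts_circuit_of by blast
  qed
  \<comment> \<open>Old gates keep their rank, which is at most \<open>n\<close>; other old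
    addresses get 0; new gates are ordered by address above all of these.\<close>
  define \<rho> where "\<rho> v = (if v \<in> gates S then rank v else if v < ?f then 0 else Suc n + v)" for v
  have rk: "rank v \<le> n" if "v \<in> gates S" for v
    using that
  proof (rule gateE)
    fix i d assume v: "v = \<nu> (i, Suc d)" "(i, Suc d) \<in> dyadic n"
    then show ?thesis using rank less_exp[of "Suc d"] by (simp add: dyadic_def)
  qed
  have low: "\<rho> v \<le> n" if "v < ?f" for v using that rk by (simp add: \<rho>_def)
  have "\<rho> u < \<rho> v" if "(u, v) \<in> edges ?C" for u v
  proof (cases "v \<in> gates S")
    case True
    then have e: "(u, v) \<in> edges S" using that old by (auto simp: edges_def)
    then have "u \<in> verts S" using S(2) by (auto simp: edges_def)
    then show ?thesis using rank_edge[OF e] True old_address[of u] by (auto simp: \<rho>_def)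
  next
    case False
    then have v: "v \<in> {?f..<var s ''free''}" using that by (auto simp: C edges_def)
    then have "u \<in> verts S \<union> L \<union> {?f..<v}"
      using that assms by (auto simp: well_formed_def edges_def C)
    moreover have "\<rho> v = Suc n + v" using v False by (auto simp: \<rho>_def)
    moreover have "\<rho> u = Suc n + u" if "u \<in> {?f..<v}"
      using that old_address[of u] by (auto simp: \<rho>_def verts_def)
    ultimately show ?thesis using low[of u] old_address[of u] by fastforce
  qed
  then have "acyclic (edges ?C)" by (rule acyclic_rank)
  moreover have "inputs ?C \<inter> gates ?C = {}"
    using disj_S L(4) new by (auto simp: C verts_def)
  moreover have "finite (verts ?C)" using S(1) L(1) by (auto simp: verts_circuit_of)
  ultimately show ?thesis using preds by (simp add: is_circuit_def)
qed

text \<open>\<open>M\<close> consists of the roots of the trees built so far and their delays. The condition on the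
  powers of two says that these trees can still be completed to a delay-optimum tree on \<open>X\<close>.\<close>

definition forest :: "nat set \<Rightarrow> nat \<Rightarrow> state \<Rightarrow> (nat \<times> nat) multiset \<Rightarrow> bool" where
  "forest X N s M \<longleftrightarrow> well_formed s \<and> var s ''free'' + size M = var s\<^sub>0 ''free'' + N \<and>
     (\<forall>D. (\<Sum>y \<in> X. 2 ^ a y) \<le> (2 :: nat) ^ D \<longrightarrow> (\<Sum>z \<in># image_mset snd M. 2 ^ z) \<le> (2 :: nat) ^ D) \<and>
     (\<exists>F. image_mset (\<lambda>t. (tree_root t, tree_delay a t)) F = M \<and>
        (\<forall>t \<in># F. represents (circuit_of s) t) \<and>
        distinct_mset (\<Sum>t \<in># F. vertex_mset t) \<and> (\<Sum>t \<in># F. leaf_mset t) = mset_set X)"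

lemma forest_cong:
  assumes "forest X N s M" "arr s' ''left'' = arr s ''left''" "arr s' ''right'' = arr s ''right''"
    "var s' ''free'' = var s ''free''"
  shows "forest X N s' M"
  using assms by (simp add: forest_def well_formed_def circuit_of_def result_circuit_def)

text \<open>The fresh address \<open>f\<close> exceeds all vertices in use, so distinctness
  persists; \<open>kraft_merge\<close> preserves the bound on the weights. One item disappears for
  one gate created, hence the constant \<open>N\<close>.\<close>

lemma forest_combine:
  assumes F: "forest X N s (add_mset (u, y) (add_mset (v, z) M))"
    and le: "y \<le> z" "\<And>p. p \<in># M \<Longrightarrow> z \<le> snd p"
    and f: "f = var s ''free''"
    and s': "var s' ''free'' = Suc f" "arr s' ''left'' = (arr s ''left'')(f := u)"
      "arr s' ''right'' = (arr s ''right'')(f := v)"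
  shows "forest X N s' (add_mset (f, Suc z) M)"
proof -
  let ?h = "\<lambda>t. (tree_root t, tree_delay a t)"
  obtain F0 where wf: "well_formed s" and N: "var s ''free'' + Suc (Suc (size M)) = var s\<^sub>0 ''free'' + N"
    and kraft: "\<And>D. (\<Sum>y \<in> X. 2 ^ a y) \<le> (2 :: nat) ^ D \<Longrightarrow>
      2 ^ y + (2 ^ z + (\<Sum>z \<in># image_mset snd M. 2 ^ z)) \<le> (2 :: nat) ^ D"
    and F0: "image_mset ?h F0 = add_mset (u, y) (add_mset (v, z) M)"
      "\<forall>t \<in># F0. represents (circuit_of s) t"
      "distinct_mset (\<Sum>t \<in># F0. vertex_mset t)" "(\<Sum>t \<in># F0. leaf_mset t) = mset_set X"
    using F unfolding forest_def by auto
  obtain t1 F1 where 1: "F0 = add_mset t1 F1" "?h t1 = (u, y)" "image_mset ?h F1 = add_mset (v, z) M"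
    using msed_map_invR[OF F0(1)] by blast
  obtain t2 F2 where 2: "F1 = add_mset t2 F2" "?h t2 = (v, z)" "image_mset ?h F2 = M"
    using msed_map_invR[OF 1(3)] by blast
  have free: "var s\<^sub>0 ''free'' \<le> f" using wf by (simp add: well_formed_def f)
  have sub: "v < f" if "v \<in> verts (circuit_of s)" for v
    using that old_address[of v] free by (auto simp: verts_circuit_of f)
  have rep: "represents (circuit_of s') t" if t: "represents (circuit_of s) t" for t
  proof (rule represents_mono[OF t])
    fix g assume "g \<in> gates (circuit_of s)"
    then have "g < f" using sub by (auto simp: verts_def)
    then show "lpred (circuit_of s') g = lpred (circuit_of s) g \<and> rpred (circuit_of s') g = rpred (circuit_of s) g"
      by (simp add: circuit_of_def result_circuit_def s')
  qed (auto simp: circuit_of_def result_circuit_def s' f)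
  have rep0: "represents (circuit_of s) t" if "t \<in># add_mset t1 (add_mset t2 F2)" for t
    using that F0(2)[unfolded 1(1) 2(1)] by blast
  have fresh: "f \<notin># vertex_mset t" if "t \<in># add_mset t1 (add_mset t2 F2)" for t
    using represents_vertices(1)[OF rep0[OF that]] sub by blast
  define t where "t = Node t1 f t2"
  have roots: "tree_root t1 = u" "tree_root t2 = v" "tree_delay a t1 = y" "tree_delay a t2 = z" using 1 2 by auto
  have uv: "u \<in> verts (circuit_of s)" "v \<in> verts (circuit_of s)"
    using represents_vertices(1)[OF rep0[of t1]] represents_vertices(1)[OF rep0[of t2]]
      root_in_vertex_mset[of t1] root_in_vertex_mset[of t2] by (auto simp: roots)
  have "set_mset (vertex_mset t1) \<inter> set_mset (vertex_mset t2) = {}"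
    using F0(3) by (simp add: 1(1) 2(1) distinct_mset_union Int_Un_distrib)
  \<comment> \<open>\<open>u\<close> and \<open>v\<close> are roots of disjoint trees; a gate must
    have two different predecessors.\<close>
  then have "u \<noteq> v"
    using root_in_vertex_mset[of t1] root_in_vertex_mset[of t2] unfolding roots by blast
  then have "well_formed s'"
    using wf uv free unfolding well_formed_def verts_circuit_of
    by (auto simp: s' f[symmetric] less_Suc_eq)
  moreover have "f \<in> gates (circuit_of s')" "lpred (circuit_of s') f = u" "rpred (circuit_of s') f = v"
    using free by (auto simp: circuit_of_def result_circuit_def s')
  then have "represents (circuit_of s') t"
    using rep rep0 by (simp add: t_def roots)
  then have "\<forall>t \<in># add_mset t F2. represents (circuit_of s') t" using rep rep0 by auto
  moreover have "f \<notin># (\<Sum>t \<in># F0. vertex_mset t)" using fresh by (auto simp: 1(1) 2(1))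
  then have "distinct_mset (\<Sum>t \<in># add_mset t F2. vertex_mset t)"
    using F0(3) by (simp add: t_def 1(1) 2(1) distinct_mset_add_mset ac_simps)
  moreover have "(\<Sum>t \<in># add_mset t F2. leaf_mset t) = mset_set X"
    using F0(4) by (simp add: t_def 1(1) 2(1) ac_simps)
  moreover have "image_mset ?h (add_mset t F2) = add_mset (f, Suc z) M"
    using 2(3) le(1) by (simp add: t_def roots)
  moreover have "\<forall>D. (\<Sum>y \<in> X. 2 ^ a y) \<le> (2 :: nat) ^ D \<longrightarrow>
    (\<Sum>z \<in># image_mset snd (add_mset (f, Suc z) M). 2 ^ z) \<le> (2 :: nat) ^ D"
  proof (intro allI impI)
    fix D assume D: "(\<Sum>y \<in> X. 2 ^ a y) \<le> (2 :: nat) ^ D"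
    have "z \<le> w" if "w \<in># image_mset snd M" for w using that le(2) by auto
    from kraft_merge[OF le(1) this kraft[OF D]]
    show "(\<Sum>z \<in># image_mset snd (add_mset (f, Suc z) M). 2 ^ z) \<le> (2 :: nat) ^ D" by simp
  qed
  moreover have "var s' ''free'' + size (add_mset (f, Suc z) M) = var s\<^sub>0 ''free'' + N"
    using N by (simp add: s' f)
  ultimately show ?thesis unfolding forest_def by blast
qed

text \<open>Between iterations the smallest item is kept outside the queues, in \<open>root\<close>
  and \<open>z\<close>. One iteration pops its partner, appends the gate and pops the next smallest
  item, so the queues lose two items and gain one.\<close>

lemma combine_step:
  assumes "forest X N s (add_mset (var s ''root'', var s ''z'') (pending s))"
    "sorted_queues s (var s ''z'')" "pending s \<noteq> {#}"
  defines "s' \<equiv> run combine_step s"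
  shows "forest X N s' (add_mset (var s' ''root'', var s' ''z'') (pending s'))"
    "sorted_queues s' (var s' ''z'')" "size (pending s') < size (pending s)"
proof -
  define s1 where "s1 = run pop s"
  define s2 where "s2 = run add_gate s1"
  define s3 where "s3 = run pop s2"
  have s': "s' = s3\<lparr>var := (var s3)(''root'' := var s3 ''u'')\<rparr>"
    by (simp add: s'_def combine_step_def s1_def s2_def s3_def)
  note p1 = pop[OF assms(2,3), folded s1_def]
  have same: "var s1 ''root'' = var s ''root''" "var s1 ''free'' = var s ''free''"
    by (simp_all add: p1(2))
  note g = add_gate[OF p1(4), folded s2_def]
  have F1: "forest X N s1 (add_mset (var s ''root'', var s ''z'')
      (add_mset (var s1 ''u'', var s1 ''z'') (pending s1)))"
    using forest_cong[OF assms(1), of s1] p1(1,3) same by simp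
  have "\<And>p. p \<in># pending s1 \<Longrightarrow> var s1 ''z'' \<le> snd p"
    using p1(4) by (auto simp: sorted_queues_def)
  then have F2: "forest X N s2 (pending s2)"
    using forest_combine[OF F1 p1(5), of "var s1 ''free''" s2] g same by simp
  have "pending s2 \<noteq> {#}" by (simp add: g(2))
  note p2 = pop[OF g(1) this, folded s3_def]
  have F3: "forest X N s3 (pending s2)"
    using F2 by (rule forest_cong) (simp_all add: p2(1,2))
  have qs: "gate_queue s' = gate_queue s3" "boundary_queue s' = boundary_queue s3" "input_queue s' = input_queue s3"
    by (simp_all add: gate_queue_def boundary_queue_def input_queue_def s')
  then have pend: "pending s' = pending s3" by (simp add: pending_def)
  have vs: "var s' ''root'' = var s3 ''u''" "var s' ''z'' = var s3 ''z''" by (simp_all add: s')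
  show "forest X N s' (add_mset (var s' ''root'', var s' ''z'') (pending s'))"
    using forest_cong[OF F3, of s'] by (simp add: pend vs p2(3)) (simp add: s')
  show "sorted_queues s' (var s' ''z'')"
    using p2(4) unfolding sorted_queues_def pend qs vs by (simp add: s')
  show "size (pending s') < size (pending s)"
    using arg_cong[OF p1(3), of size] arg_cong[OF p2(3), of size] by (simp add: pend g(2))
qed

end


section \<open>The whole program\<close>

text \<open>Adjacent intervals are merged first: the boundary depends on \<open>K\<close> only, not on the way
  in which \<open>K\<close> is split.\<close>

definition init_scan :: com where
  "init_scan =
     Seq (Cond (Less (Var ''end1'') (Var ''begin2'')) Skip
           (Seq (Assign ''end1'' (Var ''end2'')) (Assign ''begin2'' (Var ''end2''))))
     (Seq (Assign ''w'' (Const 1)) (Seq (Assign ''d'' (Const 0)) (Assign ''m'' (Const 0))))"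

definition init_queues :: com where
  "init_queues = Seq (Assign ''h'' (Var ''free'')) (Seq (Assign ''i'' (Const 0)) (Assign ''j'' (Const 0)))"

definition init_combine :: com where
  "init_combine = Seq init_queues (Seq pop (Assign ''root'' (Var ''u'')))"

definition program :: com where
  "program = Seq init_scan (Seq (While scan_cond scan_level)
     (Seq init_combine (While combine_cond combine_step)))"

lemma loop_free_parts:
  "loop_free init_scan" "loop_free scan_level" "loop_free init_combine" "loop_free combine_step"
  by (simp_all add: init_scan_def scan_level_def emit_left_def emit_right_def emit_def
      init_combine_def init_queues_def combine_step_def pop_def add_gate_def)

section \<open>Correctness of the program\<close>

context stored_instance
begin

lemma tree_delay_block_tree:
  assumes "i + 2 ^ d \<le> n" "\<And>j. j \<in> {i..<i + 2 ^ d} \<Longrightarrow> a (x j) = 0"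
  shows "tree_delay a (block_tree \<nu> i d) = d"
  using assms
proof (induction d arbitrary: i)
  case (Suc d)
  then show ?case using Suc.IH[of i] Suc.IH[of "i + 2 ^ d"] by simp
qed (use x in force)

text \<open>A block of depth \<open>d\<close> has \<open>2 ^ d\<close> leaves of weight
  \<open>2 ^ 0\<close>, exactly the weight of an item of value \<open>d\<close>. So initially the
  weights of the items and of the inputs agree.\<close>

lemma forest_initial:
  assumes I: "finite I" "I \<subseteq> {0..<n}" and K: "K = x ` I" "\<And>y. y \<in> K \<Longrightarrow> a y = 0" "K \<inter> L = {}"
    and es: "set es \<subseteq> dyadic n" "covered es = mset_set I"
    and s: "well_formed s" "var s ''free'' = var s\<^sub>0 ''free''"
  shows "forest (K \<union> L) (length es + length ys) s
    (mset (map (\<lambda>e. (\<nu> e, snd e)) es) + mset (map (\<lambda>y. (y, a y)) ys))"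
proof -
  let ?M = "mset (map (\<lambda>e. (\<nu> e, snd e)) es) + mset (map (\<lambda>y. (y, a y)) ys)"
  let ?h = "\<lambda>t. (tree_root t, tree_delay a t)"
  define B where "B = mset (map (\<lambda>(i, d). block_tree \<nu> i d) es)"
  define F where "F = B + mset (map Leaf ys)"
  have fin: "finite K" "finite L" using I(1) K(1) L(1) by auto
  have inj: "inj_on x I" using x_inj I(2) by (rule inj_on_subset)
  have in_I: "j \<in> I" if "(i, d) \<in> set es" "j \<in> {i..<i + 2 ^ d}" for i d j
    using covered_block[OF that] I(1) by (simp add: es(2))
  have block: "i + 2 ^ d \<le> n" if "(i, d) \<in> set es" for i d
    using that es(1) by (auto simp: dyadic_def)
  have delay: "tree_delay a (block_tree \<nu> i d) = d" if "(i, d) \<in> set es" for i d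
    using block[OF that] in_I[OF that] K by (intro tree_delay_block_tree) auto
  have "(\<Sum>y \<in> K \<union> L. 2 ^ a y) = (\<Sum>y \<in> K. 2 ^ a y) + (\<Sum>y \<in> L. (2 :: nat) ^ a y)"
    using fin K(3) by (rule sum.union_disjoint)
  also have "(\<Sum>y \<in> K. (2 :: nat) ^ a y) = card I"
    using K(2) by (simp add: K(1) card_image[OF inj])
  also have "card I = (\<Sum>e \<leftarrow> es. 2 ^ snd e)"
    using arg_cong[OF es(2), of size] by (simp add: size_covered)
  also have "(\<Sum>y \<in> L. (2 :: nat) ^ a y) = (\<Sum>y \<leftarrow> ys. 2 ^ a y)"
    using L(1,2) by (simp add: sum_list_distinct_conv_sum_set)
  finally have sum: "(\<Sum>y \<in> K \<union> L. (2 :: nat) ^ a y) = (\<Sum>e \<leftarrow> es. 2 ^ snd e) + (\<Sum>y \<leftarrow> ys. 2 ^ a y)" .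
  have "(\<Sum>z \<in># image_mset snd ?M. (2 :: nat) ^ z) = (\<Sum>e \<leftarrow> es. 2 ^ snd e) + (\<Sum>y \<leftarrow> ys. 2 ^ a y)"
    by (simp add: sum_mset_sum_list flip: mset_map) (simp add: comp_def)
  with sum have 1: "(\<Sum>z \<in># image_mset snd ?M. (2 :: nat) ^ z) = (\<Sum>y \<in> K \<union> L. 2 ^ a y)" by simp
  have "image_mset ?h B = mset (map (\<lambda>e. (\<nu> e, snd e)) es)"
    using delay by (auto simp: B_def simp flip: mset_map intro!: arg_cong[where f = mset])
  then have 2: "image_mset ?h F = ?M"
    by (simp add: F_def multiset.map_comp comp_def)
  have repS: "represents S t" if "t \<in># B" for t
    using that es(1) represents_block_tree by (auto simp: B_def)
  have old: "represents (circuit_of s) t" if "t \<in># B" for t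
    using repS[OF that]
  proof (rule represents_mono)
    show "lpred (circuit_of s) g = lpred S g \<and> rpred (circuit_of s) g = rpred S g" if "g \<in> gates S" for g
      using well_formed_stores[OF s(1)] that by (simp add: stores_circuit_def circuit_of_def result_circuit_def)
  qed (auto simp: circuit_of_def result_circuit_def)
  have "represents (circuit_of s) (Leaf y)" if "y \<in> set ys" for y
    using that L(1) by (simp add: circuit_of_def result_circuit_def)
  then have 3: "\<forall>t \<in># F. represents (circuit_of s) t" using old by (auto simp: F_def)
  have leafB: "(\<Sum>t \<in># B. leaf_mset t) = mset_set K"
  proof -
    have "(\<Sum>t \<in># B. leaf_mset t) = (\<Sum>(i, d) \<leftarrow> es. image_mset x (mset_set {i..<i + 2 ^ d}))"
      using block by (auto simp: B_def sum_mset_sum_list leaf_mset_block_tree simp flip: mset_map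
          intro!: arg_cong[where f = sum_list])
    also have "\<dots> = image_mset x (covered es)"
      by (induction es) auto
    finally show ?thesis using inj by (simp add: es(2) K(1) image_mset_mset_set)
  qed
  have leafY: "(\<Sum>t \<in># mset (map Leaf ys). leaf_mset t) = mset_set L"
    "(\<Sum>t \<in># mset (map Leaf ys). vertex_mset t) = mset_set L"
  proof -
    have "(\<Sum>y \<in># mset ys. {#y#}) = mset_set L"
      using L(1,2) mset_set_set[of ys] by simp
    then show "(\<Sum>t \<in># mset (map Leaf ys). leaf_mset t) = mset_set L"
      "(\<Sum>t \<in># mset (map Leaf ys). vertex_mset t) = mset_set L"
      by (simp_all add: multiset.map_comp comp_def)
  qed
  have 4: "(\<Sum>t \<in># F. leaf_mset t) = mset_set (K \<union> L)"
    using fin K(3) by (simp add: F_def leafB leafY[simplified] mset_set_Union)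
  have "(\<Sum>t \<in># B. vertex_mset t) = (\<Sum>(i, d) \<leftarrow> es. vertex_mset (block_tree \<nu> i d))"
    by (auto simp: B_def sum_mset_sum_list simp flip: mset_map intro!: arg_cong[where f = sum_list])
  then have "distinct_mset (\<Sum>t \<in># B. vertex_mset t)"
    using distinct_vertex_mset_blocks[OF es(1)] by (simp add: es(2) distinct_mset_mset_set)
  \<comment> \<open>\<open>L\<close> may contain inputs of \<open>S\<close>. Such an element, if it
    were a vertex of a block tree, would be one of its leaves and thus belong to
    \<open>K\<close>.\<close>
  moreover have "v \<notin> L" if "t \<in># B" "v \<in># vertex_mset t" for t v
  proof
    assume v: "v \<in> L"
    have "v \<in> verts S" using represents_vertices(1)[OF repS[OF that(1)]] that(2) by blast
    then have "v \<in> inputs S" using v L(4) by (auto simp: verts_def)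
    then have "v \<in># leaf_mset t" using represents_inputs[OF repS[OF that(1)] disj_S] that(2) by blast
    then have "v \<in># (\<Sum>t \<in># B. leaf_mset t)" using that(1) by auto
    then show False using v K(3) fin by (auto simp: leafB)
  qed
  then have "set_mset (\<Sum>t \<in># B. vertex_mset t) \<inter> L = {}" by auto
  ultimately have 5: "distinct_mset (\<Sum>t \<in># F. vertex_mset t)"
    using fin by (simp add: F_def leafY[simplified] distinct_mset_union distinct_mset_mset_set)
  have 6: "var s ''free'' + size ?M = var s\<^sub>0 ''free'' + (length es + length ys)" by (simp add: s(2))
  show ?thesis
    unfolding forest_def 1 using s(1) 2 3 4 5 6 by blast
qed

text \<open>In the sorted list, equal depths at distance two would give three boundary trees of the
  same depth, which \<open>triangular_depth\<close> excludes.\<close>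

lemma number_of_boundary_trees:
  assumes K: "K = x ` ({P..<Q} \<union> {P'..<Q'})" "Q \<le> n" "Q' \<le> n" "Q < P' \<or> P' = Q'"
    and tri: "triangular S n x K"
    and es: "sorted (map snd es)" "\<And>e. e \<in> set es \<Longrightarrow> maximal_block P Q e \<or> maximal_block P' Q' e"
      "distinct es" "(\<Sum>e \<leftarrow> es. 2 ^ snd e) = (k :: nat)" "k \<ge> 3"
  shows "2 ^ (length es + 1) \<le> k\<^sup>2"
proof -
  let ?ds = "map snd es"
  have "?ds ! i < ?ds ! (i + 2)" if i: "i + 2 < length ?ds" for i
  proof (rule ccontr)
    assume "\<not> ?ds ! i < ?ds ! (i + 2)"
    moreover have "?ds ! i \<le> ?ds ! (i + 1)" "?ds ! (i + 1) \<le> ?ds ! (i + 2)"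
      using i by (intro sorted_nth_mono[OF es(1)]; simp)+
    ultimately have "snd (es ! (i + 1)) = snd (es ! i)" "snd (es ! (i + 2)) = snd (es ! i)"
      using i by simp_all
    moreover have "es ! i \<in> set es" "es ! (i + 1) \<in> set es" "es ! (i + 2) \<in> set es"
      using i by simp_all
    moreover have "distinct [es ! i, es ! (i + 1), es ! (i + 2)]"
      using i es(3) by (simp add: nth_eq_iff_index_eq)
    ultimately show False
    proof (intro triangular_depth[OF tri])
      fix e assume "e \<in> {es ! i, es ! (i + 1), es ! (i + 2)}"
      then have "e \<in> set es" "snd e = snd (es ! i)"
        using \<open>es ! i \<in> set es\<close> \<open>es ! (i + 1) \<in> set es\<close> \<open>es ! (i + 2) \<in> set es\<close>
          \<open>snd (es ! (i + 1)) = snd (es ! i)\<close> \<open>snd (es ! (i + 2)) = snd (es ! i)\<close> by blast+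
      then show "e \<in> dyadic n \<and> \<nu> e \<in> boundary K S \<and> snd e = snd (es ! i)"
        using maximal_block_boundary[OF K es(2)] by blast
    qed
  qed
  then have "2 ^ (length ?ds + 1) \<le> k\<^sup>2"
    using es(1,4,5) by (intro number_of_blocks_bound) (auto simp: comp_def)
  then show ?thesis by simp
qed

text \<open>Depth \<open>d\<close> is entered only while some remainder is nonempty. Its ends are
  multiples of \<open>2 ^ d\<close>, so it contains at least \<open>2 ^ d\<close> indices, and
  \<open>d \<le> N\<close> follows.\<close>

lemma scan_correct:
  assumes inv: "scan_invariant P Q P' Q' s [] 0" and n: "Q \<le> n" "Q' \<le> n"
    and N: "(Q - P) + (Q' - P') < 2 ^ Suc N"
  shows "\<exists>t s' es d. exec (While scan_cond scan_level) s t s' \<and> scan_invariant P Q P' Q' s' es d \<and>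
    covered es = mset_set {P..<Q} + mset_set {P'..<Q'} \<and>
    t \<le> Suc N * (com_cost scan_level + bcost scan_cond) + bcost scan_cond"
proof -
  let ?I = "\<lambda>s. \<exists>es. scan_invariant P Q P' Q' s es (var s ''d'')"
  let ?\<mu> = "\<lambda>s. Suc N - var s ''d''"
  have d: "scan_invariant P Q P' Q' s es d \<Longrightarrow> var s ''d'' = d" for s es d
    by (simp add: scan_invariant_def scanned_def)
  have I: "?I s" using inv d[OF inv] by auto
  have step: "?I (run scan_level s) \<and> ?\<mu> (run scan_level s) < ?\<mu> s"
    if i: "?I s" and c: "bval scan_cond s" for s
  proof -
    obtain es where es: "scan_invariant P Q P' Q' s es (var s ''d'')" using i by blast
    obtain es' where es': "scan_invariant P Q P' Q' (run scan_level s) es' (Suc (var s ''d''))"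
      using scan_level[OF es n] by blast
    have long: "2 ^ d \<le> Q - P" if "remainder d P Q p q" "p < q" for d P Q p q
      using that multiples_gap[of "2 ^ d" p q] by (auto simp: remainder_def)
    have "2 ^ var s ''d'' \<le> Q - P \<or> 2 ^ var s ''d'' \<le> Q' - P'"
      using es c long[of "var s ''d''" P Q "var s ''begin1''" "var s ''end1''"]
        long[of "var s ''d''" P' Q' "var s ''begin2''" "var s ''end2''"]
      by (auto simp: scan_invariant_def scan_cond_def)
    then have "(2 :: nat) ^ var s ''d'' < 2 ^ Suc N" using N by linarith
    then have "var s ''d'' < Suc N" by (rule power_less_imp_less_exp[rotated]) simp
    then show ?thesis using es' d[OF es'] by auto
  qed
  obtain t s' where ex: "exec (While scan_cond scan_level) s t s'" "?I s'" "\<not> bval scan_cond s'"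
    "t \<le> ?\<mu> s * (com_cost scan_level + bcost scan_cond) + bcost scan_cond"
    using exec_While[where I = ?I and \<mu> = ?\<mu>, OF loop_free_parts(2) I step] by blast
  obtain es where es: "scan_invariant P Q P' Q' s' es (var s' ''d'')" using ex(2) by blast
  have "covered es = mset_set {P..<Q} + mset_set {P'..<Q'}"
    using es ex(3) by (simp add: scan_invariant_def scan_cond_def)
  moreover have "?\<mu> s = Suc N" using d[OF inv] by simp
  ultimately show ?thesis using ex(1,4) es by metis
qed

lemma combine_correct:
  assumes F: "forest X N s (pending s)" and q: "sorted_queues s b" and ne: "pending s \<noteq> {#}"
    and X: "finite X"
  shows "\<exists>t s'. exec (Seq (Seq pop (Assign ''root'' (Var ''u''))) (While combine_cond combine_step)) s t s' \<and>
    t \<le> com_cost (Seq pop (Assign ''root'' (Var ''u''))) +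
      (size (pending s) * (com_cost combine_step + bcost combine_cond) + bcost combine_cond) \<and>
    well_formed s' \<and> var s' ''free'' + 1 = var s\<^sub>0 ''free'' + N \<and>
    var s' ''root'' \<in> verts (circuit_of s') \<and>
    delay_optimum_tree op a X (subcircuit (circuit_of s') (var s' ''root'')) (var s' ''root'')"
proof -
  define s1 where "s1 = run pop s"
  define s2 where "s2 = run (Assign ''root'' (Var ''u'')) s1"
  note p = pop[OF q ne, folded s1_def]
  have s2: "s2 = s1\<lparr>var := (var s1)(''root'' := var s1 ''u'')\<rparr>" by (simp add: s2_def)
  have qs: "gate_queue s2 = gate_queue s1" "boundary_queue s2 = boundary_queue s1"
    "input_queue s2 = input_queue s1"
    by (simp_all add: gate_queue_def boundary_queue_def input_queue_def s2)
  then have pend: "pending s2 = pending s1" by (simp add: pending_def)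
  let ?I = "\<lambda>s. forest X N s (add_mset (var s ''root'', var s ''z'') (pending s)) \<and>
    sorted_queues s (var s ''z'')"
  have "forest X N s2 (pending s)"
    using F by (rule forest_cong) (simp_all add: s2 p(1,2))
  then have "forest X N s2 (add_mset (var s2 ''root'', var s2 ''z'') (pending s2))"
    unfolding p(3) pend by (simp add: s2)
  moreover have "sorted_queues s2 (var s2 ''z'')"
    using p(4) unfolding sorted_queues_def pend qs by (simp add: s2)
  ultimately have I: "?I s2" by blast
  have step: "?I (run combine_step s) \<and> size (pending (run combine_step s)) < size (pending s)"
    if "?I s" "bval combine_cond s" for s
    using combine_step[of X N s] that unfolding combine_cond by blast
  obtain t s' where ex: "exec (While combine_cond combine_step) s2 t s'" "?I s'" "\<not> bval combine_cond s'"
    "t \<le> size (pending s2) * (com_cost combine_step + bcost combine_cond) + bcost combine_cond"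
    using exec_While[where I = ?I and \<mu> = "\<lambda>s. size (pending s)", OF loop_free_parts(4) I step] by blast
  have "loop_free (Seq pop (Assign ''root'' (Var ''u'')))" by (simp add: pop_def)
  moreover have "run (Seq pop (Assign ''root'' (Var ''u''))) s = s2" by (simp add: s1_def s2_def)
  ultimately obtain t0 where t0: "t0 \<le> com_cost (Seq pop (Assign ''root'' (Var ''u'')))"
    "exec (Seq pop (Assign ''root'' (Var ''u''))) s t0 s2"
    using exec_loop_free by metis
  note whole = exec.Seq[OF t0(2) ex(1)]
  have "size (pending s2) \<le> size (pending s)" by (simp add: pend p(3))
  then have "t \<le> size (pending s) * (com_cost combine_step + bcost combine_cond) + bcost combine_cond"
    using ex(4) by (meson add_le_mono1 le_trans mult_le_mono1)
  then have time: "t0 + t \<le> com_cost (Seq pop (Assign ''root'' (Var ''u''))) +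
      (size (pending s) * (com_cost combine_step + bcost combine_cond) + bcost combine_cond)"
    using t0(1) by linarith
  let ?r = "var s' ''root''" and ?z = "var s' ''z''"
  have "forest X N s' {#(?r, ?z)#}" using ex(2,3) by (simp add: combine_cond)
  then obtain F where wf: "well_formed s'" and free: "var s' ''free'' + 1 = var s\<^sub>0 ''free'' + N"
    and kraft: "\<And>D. (\<Sum>y \<in> X. 2 ^ a y) \<le> (2 :: nat) ^ D \<Longrightarrow> (2 :: nat) ^ ?z \<le> 2 ^ D"
    and F: "image_mset (\<lambda>t. (tree_root t, tree_delay a t)) F = {#(?r, ?z)#}"
      "\<forall>t \<in># F. represents (circuit_of s') t" "distinct_mset (\<Sum>t \<in># F. vertex_mset t)"
      "(\<Sum>t \<in># F. leaf_mset t) = mset_set X"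
    unfolding forest_def by auto
  obtain T where T: "F = {#T#}" "tree_root T = ?r" "tree_delay a T = ?z"
    using msed_map_invR[OF F(1)] by auto
  have rep: "represents (circuit_of s') T" and dist: "distinct_mset (vertex_mset T)"
    and leaves: "leaf_mset T = mset_set X"
    using F(2-4) by (simp_all add: T(1))
  have "?r \<in> verts (circuit_of s')"
    using represents_vertices(1)[OF rep] root_in_vertex_mset[of T] T(2) by auto
  moreover have "tree_delay a T \<le> D" if "(\<Sum>y \<in># leaf_mset T. 2 ^ a y) \<le> (2 :: nat) ^ D" for D
    using kraft[of D] that by (simp add: T(3) leaves sum_unfold_sum_mset)
  then have "delay_optimum_tree op a X (subcircuit (circuit_of s') ?r) ?r"
    using delay_optimum_tree_represents[OF is_circuit_circuit_of[OF wf] rep dist _ leaves X, where op = op]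
    by (simp add: T(2))
  ultimately show ?thesis using whole time wf free by blast
qed


lemma program_correct:
  assumes K: "stores_intervals s\<^sub>0 n x K" "triangular S n x K" "K \<inter> L = {}" "K \<union> L \<noteq> {}"
      "\<And>y. y \<in> K \<Longrightarrow> a y = 0"
    and N: "card K < 2 ^ Suc N"
  shows "\<exists>t s' m. exec program s\<^sub>0 t s' \<and>
    t \<le> com_cost init_scan + (Suc N * (com_cost scan_level + bcost scan_cond) + bcost scan_cond) +
      com_cost init_combine + ((m + length ys) * (com_cost combine_step + bcost combine_cond) + bcost combine_cond) \<and>
    m \<le> card K \<and> (3 \<le> card K \<longrightarrow> 2 ^ (m + 1) \<le> (card K)\<^sup>2) \<and>
    well_formed s' \<and> var s' ''free'' + 1 = var s\<^sub>0 ''free'' + (m + length ys) \<and>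
    var s' ''root'' \<in> verts (circuit_of s') \<and>
    delay_optimum_tree op a (K \<union> L) (subcircuit (circuit_of s') (var s' ''root'')) (var s' ''root'')"
proof -
  define s1 where "s1 = run init_scan s\<^sub>0"
  obtain t1 where t1: "t1 \<le> com_cost init_scan" "exec init_scan s\<^sub>0 t1 s1"
    using exec_loop_free[OF loop_free_parts(1)] unfolding s1_def by blast
  define P where "P = var s1 ''begin1''"
  define Q where "Q = var s1 ''end1''"
  define P' where "P' = var s1 ''begin2''"
  define Q' where "Q' = var s1 ''end2''"
  define I where "I = {P..<Q} \<union> {P'..<Q'}"
  have iv: "P \<le> Q" "Q \<le> P'" "P' \<le> Q'" "Q' \<le> n" "Q < P' \<or> P' = Q'" and KI: "K = x ` I"
  proof -
    let ?v = "var s\<^sub>0"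
    have st: "?v ''begin1'' \<le> ?v ''end1''" "?v ''end1'' \<le> ?v ''begin2''" "?v ''begin2'' \<le> ?v ''end2''"
      "?v ''end2'' \<le> n"
      "K = x ` ({?v ''begin1''..<?v ''end1''} \<union> {?v ''begin2''..<?v ''end2''})"
      using K(1) by (auto simp: stores_intervals_def)
    have "P = ?v ''begin1''" "Q' = ?v ''end2''"
      "Q = (if ?v ''end1'' < ?v ''begin2'' then ?v ''end1'' else ?v ''end2'')"
      "P' = (if ?v ''end1'' < ?v ''begin2'' then ?v ''begin2'' else ?v ''end2'')"
      by (simp_all add: P_def Q_def P'_def Q'_def s1_def init_scan_def)
    \<comment> \<open>Adjacent intervals become one, and the second one becomes empty at
      \<open>end2\<close>; this provides the gap condition of
      \<open>maximal_block_boundary\<close>.\<close>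
    moreover have "{?v ''begin1''..<?v ''end1''} \<union> {?v ''begin2''..<?v ''end2''} = {?v ''begin1''..<?v ''end2''}"
      if "\<not> ?v ''end1'' < ?v ''begin2''"
      using st(1-3) that by auto
    ultimately show "P \<le> Q" "Q \<le> P'" "P' \<le> Q'" "Q' \<le> n" "Q < P' \<or> P' = Q'" "K = x ` I"
      using st by (simp_all add: I_def)
  qed
  have In: "finite I" "I \<subseteq> {0..<n}" using iv by (auto simp: I_def)
  have cI: "mset_set {P..<Q} + mset_set {P'..<Q'} = mset_set I"
    using iv(2) unfolding I_def by (intro mset_set_Union[symmetric]) auto
  have "card K = card I" using card_image[OF inj_on_subset[OF x_inj In(2)]] by (simp add: KI)
  then have cK: "card K = (Q - P) + (Q' - P')"
    using arg_cong[OF cI, of size] by simp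
  have Qn: "Q \<le> n" "Q' \<le> n" using iv by auto
  have "scan_invariant P Q P' Q' s1 [] 0"
    using iv by (simp add: scan_invariant_def scanned_def remainder_def P_def Q_def P'_def Q'_def)
      (simp add: s1_def init_scan_def)
  from scan_correct[OF this Qn N[unfolded cK]] obtain t2 s2 es d
    where t2: "exec (While scan_cond scan_level) s1 t2 s2"
      "t2 \<le> Suc N * (com_cost scan_level + bcost scan_cond) + bcost scan_cond"
      and inv: "scan_invariant P Q P' Q' s2 es d" and cov: "covered es = mset_set I"
    unfolding cI by blast
  have sc: "scanned s2 es d" and srt: "sorted (map snd es)"
    and mb: "\<And>e. e \<in> set es \<Longrightarrow> maximal_block P Q e \<or> maximal_block P' Q' e"
    using inv unfolding scan_invariant_def by blast+
  have dy: "set es \<subseteq> dyadic n"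
    using maximal_block_boundary(1)[OF KI[unfolded I_def] Qn iv(5) mb] by blast
  have dist: "distinct es" using cov by (intro covered_distinct) (simp add: distinct_mset_mset_set)
  have size: "(\<Sum>e \<leftarrow> es. 2 ^ snd e) = card K"
    using arg_cong[OF cov, of size] by (simp add: size_covered \<open>card K = card I\<close>)
  have "length es \<le> (\<Sum>e \<leftarrow> es. 2 ^ snd e)"
  proof (induction es)
    case (Cons e es)
    then have "1 + length es \<le> 2 ^ snd e + (\<Sum>e \<leftarrow> es. 2 ^ snd e)" by (intro add_mono) simp_all
    then show ?case by simp
  qed simp
  then have m: "length es \<le> card K" using size by simp
  have m3: "3 \<le> card K \<longrightarrow> 2 ^ (length es + 1) \<le> (card K)\<^sup>2"
    using number_of_boundary_trees[OF KI[unfolded I_def] Qn iv(5) K(2) srt mb dist size] by blast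
  define s3 where "s3 = run init_queues s2"
  have s3: "s3 = s2\<lparr>var := (var s2)(''h'' := var s2 ''free'', ''i'' := 0, ''j'' := 0)\<rparr>"
    by (simp add: s3_def init_queues_def)
  have arrs: "arr s3 A = arr s\<^sub>0 A" if "A \<noteq> ''E''" "A \<noteq> ''D''" for A
    using sc that by (simp add: s3 scanned_def)
  have vars: "var s3 ''free'' = var s\<^sub>0 ''free''" "var s3 ''m'' = length es" "var s3 ''l'' = length ys"
    using sc stored(3) by (simp_all add: s3 scanned_def stores_list_def)
  have gq: "gate_queue s3 = []" by (simp add: gate_queue_def s3)
  have bq: "boundary_queue s3 = map (\<lambda>e. (\<nu> e, snd e)) es"
    using sc by (intro nth_equalityI) (simp_all add: boundary_queue_def s3 scanned_def)
  have iq: "input_queue s3 = map (\<lambda>y. (y, a y)) ys"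
    using stored(3) vars(3) arrs by (intro nth_equalityI) (simp_all add: input_queue_def stores_list_def s3)
  have pend: "pending s3 = mset (map (\<lambda>e. (\<nu> e, snd e)) es) + mset (map (\<lambda>y. (y, a y)) ys)"
    by (simp add: pending_def gq bq iq)
  have q: "sorted_queues s3 0"
    using srt L(3) by (simp add: sorted_queues_def gq bq iq comp_def) (simp add: s3)
  have "es \<noteq> [] \<or> ys \<noteq> []"
  proof (rule ccontr)
    assume "\<not> (es \<noteq> [] \<or> ys \<noteq> [])"
    then have "mset_set I = {#}" "L = {}" using cov L(1) by simp_all
    then have "I = {}" "L = {}" using In(1) by (simp_all add: mset_set_empty_iff)
    then show False using K(4) by (simp add: KI)
  qed
  then have ne: "pending s3 \<noteq> {#}" by (auto simp: pend)
  have wf: "well_formed s3" by (simp add: well_formed_def vars arrs)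
  have "forest (K \<union> L) (length es + length ys) s3 (pending s3)"
    unfolding pend by (rule forest_initial[OF In KI K(5,3) dy cov wf vars(1)])
  moreover have "finite (K \<union> L)" using In(1) L(1) by (auto simp: KI)
  ultimately obtain t4 s' where t4:
    "exec (Seq (Seq pop (Assign ''root'' (Var ''u''))) (While combine_cond combine_step)) s3 t4 s'"
    "t4 \<le> com_cost (Seq pop (Assign ''root'' (Var ''u''))) +
      (size (pending s3) * (com_cost combine_step + bcost combine_cond) + bcost combine_cond)"
    and res: "well_formed s'" "var s' ''free'' + 1 = var s\<^sub>0 ''free'' + (length es + length ys)"
    "var s' ''root'' \<in> verts (circuit_of s')"
    "delay_optimum_tree op a (K \<union> L) (subcircuit (circuit_of s') (var s' ''root'')) (var s' ''root'')"
    using combine_correct[OF _ q ne] by blast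
  have sz: "size (pending s3) = length es + length ys" by (simp add: pend)
  obtain t3 where t3: "t3 \<le> com_cost init_queues" "exec init_queues s2 t3 s3"
    using exec_loop_free[of init_queues s2] unfolding s3_def by (auto simp: init_queues_def)
  \<comment> \<open>\<open>combine_correct\<close> groups the first \<open>pop\<close> with the
    loop, whereas the program groups it with the initialization; the run is split and reassembled
    accordingly.\<close>
  obtain t5 t6 s4 where t5: "exec (Seq pop (Assign ''root'' (Var ''u''))) s3 t5 s4"
    "exec (While combine_cond combine_step) s4 t6 s'" "t4 = t5 + t6"
    using t4(1) by (auto elim: exec.cases)
  have "exec program s\<^sub>0 (t1 + (t2 + ((t3 + t5) + t6))) s'"
    unfolding program_def init_combine_def
    using t1(2) t2(1) t3(2) t5(1,2) by (intro exec.Seq)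
  moreover have "com_cost init_combine = com_cost init_queues + com_cost (Seq pop (Assign ''root'' (Var ''u'')))"
    by (simp add: init_combine_def)
  then have "t1 + (t2 + ((t3 + t5) + t6)) \<le> com_cost init_scan +
      (Suc N * (com_cost scan_level + bcost scan_cond) + bcost scan_cond) + com_cost init_combine +
      ((length es + length ys) * (com_cost combine_step + bcost combine_cond) + bcost combine_cond)"
    using t1(1) t2(2) t3(1) t4(2) t5(3) unfolding sz by linarith
  ultimately show ?thesis using m m3 res by blast
qed

end

section \<open>The time constant and the final bounds\<close>

definition time_constant :: nat where
  "time_constant = com_cost init_scan + com_cost scan_level + bcost scan_cond + bcost scan_cond +
     com_cost init_combine + com_cost combine_step + bcost combine_cond + bcost combine_cond"

text \<open>\<open>log 2 k + l\<close> vanishes for \<open>k = 1\<close> and \<open>l = 0\<close>,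
  hence the \<open>max 1\<close>. The factor 4 comes from
  \<open>m + l \<le> 2 * log 2 k + 2 + l\<close>, where both \<open>2 * (log 2 k + l)\<close> and 2
  are at most twice the maximum.\<close>

lemma time_bound:
  fixes t m l N k :: nat
  assumes t: "t \<le> com_cost init_scan + (Suc N * (com_cost scan_level + bcost scan_cond) + bcost scan_cond) +
      com_cost init_combine + ((m + l) * (com_cost combine_step + bcost combine_cond) + bcost combine_cond)"
    and N: "real N \<le> log 2 k" and m: "real m \<le> 2 * log 2 k + 2"
  shows "real t \<le> 4 * real time_constant * max 1 (log 2 k + l)"
proof -
  define X where "X = log 2 k + real l"
  define U where "U = real (com_cost scan_level + bcost scan_cond)"
  define V where "V = real (com_cost combine_step + bcost combine_cond)"
  define W where "W = real (com_cost init_scan + bcost scan_cond + com_cost init_combine + bcost combine_cond)"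
  have pos: "U \<ge> 0" "V \<ge> 0" "W \<ge> 0" by (simp_all add: U_def V_def W_def)
  have Y: "max 1 X \<ge> 1" "max 1 X \<ge> X" by auto
  have "real t \<le> W + (1 + real N) * U + real (m + l) * V"
    using of_nat_mono[OF t, where 'a = real] by (simp add: U_def V_def W_def algebra_simps)
  also have "\<dots> \<le> W * max 1 X + (2 * max 1 X) * U + (4 * max 1 X) * V"
  proof (intro add_mono mult_right_mono)
    show "W \<le> W * max 1 X" using pos Y by (simp add: mult_le_cancel_left1)
    have "log 2 k \<le> X" "real l \<le> X" using N by (auto simp: X_def)
    then show "1 + real N \<le> 2 * max 1 X" using N Y by linarith
    have "2 * log 2 k + 2 + real l \<le> 2 * X + 2 * 1" by (simp add: X_def)
    also have "\<dots> \<le> 2 * max 1 X + 2 * max 1 X" using Y by (intro add_mono mult_left_mono) auto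
    finally show "real (m + l) \<le> 4 * max 1 X" using m by simp
  qed (use pos in auto)
  also have "\<dots> \<le> 4 * (W + U + V) * max 1 X"
  proof -
    have "0 \<le> W * max 1 X" "0 \<le> U * max 1 X" using pos Y by simp_all
    then show ?thesis by (simp add: algebra_simps)
  qed
  also have "W + U + V = real time_constant" by (simp add: W_def U_def V_def time_constant_def)
  finally show ?thesis by (simp add: X_def)
qed

theorem mainTheorem2:
  shows "\<exists>(P :: com) (c :: real).
    \<forall>(op :: bop) (n :: nat) (S :: nat circuit) (\<nu> :: nat \<times> nat \<Rightarrow> nat) (x :: nat \<Rightarrow> nat)
       (K :: nat set) (L :: nat set) (ys :: nat list) (a :: nat \<Rightarrow> nat) (k :: nat) (l :: nat)
       (s :: state).
      circuit_iso \<nu> (leftist n) S \<and> (\<forall>i < n. x i = \<nu> (i, 0)) \<and>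
      K \<subseteq> x ` {0..<n} \<and> triangular S n x K \<and> k = card K \<and>
      finite L \<and> l = card L \<and> L \<inter> gates S = {} \<and> K \<inter> L = {} \<and> K \<union> L \<noteq> {} \<and>
      (\<forall>y \<in> K. a y = 0) \<and>
      set ys = L \<and> distinct ys \<and> sorted (map a ys) \<and>
      stores_circuit s S \<and> stores_precomputed s S n x \<and> stores_intervals s n x K \<and>
      stores_list s ys a \<and> free_from s (verts S \<union> L)
      \<longrightarrow>
      (\<exists>t s' C r T.
         exec P s t s' \<and>
         real t \<le> c * max 1 (log 2 (real k) + real l) \<and>
         C = result_circuit S L s s' \<and> is_circuit C \<and> stores_circuit s' S \<and>
         r = var s' ''root'' \<and> r \<in> verts C \<and> T = subcircuit C r \<and>
         delay_optimum_tree op a (K \<union> L) T r \<and>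
         (k \<le> 2 \<longrightarrow> real (card (gates T - gates S)) \<le> real k + real l - 1) \<and>
         (k \<ge> 3 \<longrightarrow> real (card (gates T - gates S)) \<le> 2 * log 2 (real k) + real l - 2))"
proof (intro exI[of _ program] exI[of _ "4 * real time_constant"] allI impI, elim conjE)
  fix op n and S :: "nat circuit" and \<nu> x and K L :: "nat set" and ys a and k l :: nat and s
  assume iso: "circuit_iso \<nu> (leftist n) S" "\<forall>i < n. x i = \<nu> (i, 0)"
    and K: "triangular S n x K" "k = card K" "K \<inter> L = {}" "K \<union> L \<noteq> {}" "\<forall>y \<in> K. a y = 0"
    and l: "l = card L" and L: "L \<inter> gates S = {}" "set ys = L" "distinct ys" "sorted (map a ys)"
    and st: "stores_circuit s S" "stores_precomputed s S n x" "stores_intervals s n x K"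
      "stores_list s ys a" "free_from s (verts S \<union> L)"
  interpret stored_instance n \<nu> S x L ys a s
    by unfold_locales (use iso L st in auto)
  have len: "length ys = l" using l L distinct_card[of ys] by simp
  obtain N where N: "card K < 2 ^ Suc N" "real N \<le> log 2 (real k)"
  proof (cases "k = 0")
    \<comment> \<open>The default value of \<open>log 2 0\<close> is 0, so \<open>N = 0\<close>
      fits.\<close>
    case True
    then show ?thesis using that[of 0] K(2) by (simp add: log_def)
  next
    case False
    then obtain N where "2 ^ N \<le> k" "k < 2 ^ Suc N"
      using ex_power_ivl1[of 2 k] by auto
    then show ?thesis using that[of N] K(2) le_log2_of_power by simp
  qed
  obtain t s' m where ex: "exec program s t s'"
    and t: "t \<le> com_cost init_scan + (Suc N * (com_cost scan_level + bcost scan_cond) + bcost scan_cond) +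
      com_cost init_combine + ((m + length ys) * (com_cost combine_step + bcost combine_cond) + bcost combine_cond)"
    and m: "m \<le> k" "3 \<le> k \<longrightarrow> 2 ^ (m + 1) \<le> k\<^sup>2"
    and wf: "well_formed s'" and free: "var s' ''free'' + 1 = var s ''free'' + (m + length ys)"
    and root: "var s' ''root'' \<in> verts (circuit_of s')"
    and opt: "delay_optimum_tree op a (K \<union> L) (subcircuit (circuit_of s') (var s' ''root'')) (var s' ''root'')"
    using program_correct[OF st(3) K(1,3,4) _ N(1), of op] K(2,5) by blast
  have m3: "real m + 1 \<le> 2 * log 2 (real k)" if "3 \<le> k"
  proof -
    have "real (m + 1) \<le> log 2 (real (k\<^sup>2))" using m(2) that by (intro le_log2_of_power) simp
    also have "\<dots> = 2 * log 2 (real k)" using that by (simp add: log_nat_power)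
    finally show ?thesis by simp
  qed
  have "0 \<le> log 2 (real k)" using N(2) by linarith
  \<comment> \<open>The summand 2 covers \<open>k \<le> 2\<close>, where the bound is
    \<open>m \<le> k\<close>.\<close>
  then have "real m \<le> 2 * log 2 (real k) + 2" using m(1) m3 by (cases "3 \<le> k") auto
  from time_bound[OF t N(2) this] have time: "real t \<le> 4 * real time_constant * max 1 (log 2 (real k) + real l)"
    by (simp add: len)
  define T where "T = subcircuit (circuit_of s') (var s' ''root'')"
  have "gates T - gates S \<subseteq> {var s ''free''..<var s' ''free''}"
    by (auto simp: T_def subcircuit_def circuit_of_def result_circuit_def)
  then have "card (gates T - gates S) \<le> card {var s ''free''..<var s' ''free''}"
    by (intro card_mono) auto
  then have "card (gates T - gates S) + 1 \<le> m + l"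
    using free wf unfolding well_formed_def len card_atLeastLessThan by linarith
  \<comment> \<open>With \<open>m \<le> k\<close> this is the claim for \<open>k \<le> 2\<close>;
    with \<open>m + 1 \<le> 2 * log 2 k\<close> it is the claim for
    \<open>k \<ge> 3\<close>.\<close>
  then have count: "real (card (gates T - gates S)) \<le> real m + real l - 1" by linarith
  show "\<exists>t s' C r T. exec program s t s' \<and>
         real t \<le> 4 * real time_constant * max 1 (log 2 (real k) + real l) \<and>
         C = result_circuit S L s s' \<and> is_circuit C \<and> stores_circuit s' S \<and>
         r = var s' ''root'' \<and> r \<in> verts C \<and> T = subcircuit C r \<and>
         delay_optimum_tree op a (K \<union> L) T r \<and>
         (k \<le> 2 \<longrightarrow> real (card (gates T - gates S)) \<le> real k + real l - 1) \<and>
         (k \<ge> 3 \<longrightarrow> real (card (gates T - gates S)) \<le> 2 * log 2 (real k) + real l - 2)"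
  proof (intro exI conjI impI)
    show "exec program s t s'" by (fact ex)
    show "real t \<le> 4 * real time_constant * max 1 (log 2 (real k) + real l)" by (fact time)
    show "is_circuit (result_circuit S L s s')"
      using is_circuit_circuit_of[OF wf] by (simp add: circuit_of_def)
    show "stores_circuit s' S" by (rule well_formed_stores[OF wf])
    show "var s' ''root'' \<in> verts (result_circuit S L s s')" using root by (simp add: circuit_of_def)
    show "delay_optimum_tree op a (K \<union> L) (subcircuit (result_circuit S L s s') (var s' ''root'')) (var s' ''root'')"
      using opt by (simp add: circuit_of_def)
    show "real (card (gates (subcircuit (result_circuit S L s s') (var s' ''root'')) - gates S)) \<le> real k + real l - 1"
      using count m(1) by (simp add: T_def circuit_of_def)
    show "real (card (gates (subcircuit (result_circuit S L s s') (var s' ''root'')) - gates S)) \<le>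
        2 * log 2 (real k) + real l - 2" if "k \<ge> 3"
      using count m3[OF that] by (simp add: T_def circuit_of_def)
  qed (rule refl)+
qed

end
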